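(* Let $(R,\mathfrak m)$ be a Noetherian local ring, let $I$ be an ideal of $R$, and let $M$ be an $I$-filtered module with filtration $\{M_n\}_{n\ge 0}$. Then $\ell\big(H^0_{\mathfrak m}(M/M_n)\big) = O(n^{\dim M})$. In particular (for the filtration $M_n = I^nM$ on a finitely generated module $M$), with $d = \dim M$, $$\epsilon(I,M) := \limsup_{n\to\infty} \frac{d!\,\ell\big(H^0_{\mathfrak m}(M/I^nM)\big)}{n^{\dim M}} < \infty.$$
   Context: Rings are commutative with identity. $\ell(-)$ denotes length and $H^0_{\mathfrak m}(N) = \{x \in N : \mathfrak m^k x = 0 \text{ for some } k\}$ is the zeroth local cohomology module. A finitely generated $R$-module $M$ is called an $I$-filtered module if it is endowed with a descending filtration by submodules $M = M_0 \supseteq M_1 \supseteq \cdots \supseteq M_n \supseteq \cdots$ such that (1) $I M_n \subseteq M_{n+1}$ for all $n$, and (2) $\bigoplus_{n\ge 0} M_n$ is a finitely generated module over the Rees ring $\bigoplus_{n \ge 0} I^n$. $\dim M$ is the Krull dimension of $M$. *)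

theory Defs
  imports
    "HOL-Algebra.Ring_Divisibility"
    "HOL-Algebra.Ideal_Product"
    "HOL-Algebra.UnivPoly"
    "HOL-Library.Extended_Real"
    "HOL-Library.Landau_Symbols"
begin

locale noetherian_local_ring = cring R + noetherian_ring R for R (structure) and m +
  assumes maximal: "maximalideal m R"
    and unique_maximal: "maximalideal J R \<Longrightarrow> J = m"

definition ideal_power :: "('a, 'b) ring_scheme \<Rightarrow> 'a set \<Rightarrow> nat \<Rightarrow> 'a set"
  where "ideal_power R I n = I [^]\<^bsub>ideals_set R\<^esub> n"


subsection \<open>Modules\<close>

definition submodule_span ::
  "('a, 'b) ring_scheme \<Rightarrow> ('a, 'c, 'd) module_scheme \<Rightarrow> 'c set \<Rightarrow> 'c set"
  where "submodule_span R M A = \<Inter>{N. submodule N R M \<and> A \<subseteq> N}"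

definition finitely_generated ::
  "('a, 'b) ring_scheme \<Rightarrow> ('a, 'c, 'd) module_scheme \<Rightarrow> bool"
  where "finitely_generated R M \<longleftrightarrow>
    (\<exists>A. finite A \<and> A \<subseteq> carrier M \<and> carrier M = submodule_span R M A)"

definition ideal_smult ::
  "('a, 'b) ring_scheme \<Rightarrow> ('a, 'c, 'd) module_scheme \<Rightarrow> 'a set \<Rightarrow> 'c set \<Rightarrow> 'c set"
  where "ideal_smult R M I N = submodule_span R M {a \<odot>\<^bsub>M\<^esub> x | a x. a \<in> I \<and> x \<in> N}"

text \<open>The fields \<^const>\<open>mult\<close> and \<^const>\<open>one\<close> of a module record play no role in
  \<^locale>\<open>module\<close> and are left unspecified in the records built below.\<close>

definition quotient_module :: "('a, 'c, 'd) module_scheme \<Rightarrow> 'c set \<Rightarrow> ('a, 'c set) module"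
  where "quotient_module M N =
    \<lparr>carrier = a_rcosets\<^bsub>M\<^esub> N, mult = undefined, one = undefined,
     zero = N, add = set_add M,
     smult = (\<lambda>a X. \<Union>x\<in>X. N +>\<^bsub>M\<^esub> (a \<odot>\<^bsub>M\<^esub> x))\<rparr>"

text \<open>The length is the supremum of the lengths of strict chains of submodules
  (\<open>\<infinity>\<close> if these are unbounded).\<close>

definition module_length :: "('a, 'b) ring_scheme \<Rightarrow> ('a, 'c, 'd) module_scheme \<Rightarrow> enat"
  where "module_length R M =
    Sup {enat k | k. \<exists>C :: nat \<Rightarrow> 'c set.
      (\<forall>i\<le>k. submodule (C i) R M) \<and> (\<forall>i<k. C i \<subset> C (Suc i))}"

definition local_cohomology0 ::
  "('a, 'b) ring_scheme \<Rightarrow> 'a set \<Rightarrow> ('a, 'c, 'd) module_scheme \<Rightarrow> 'c set"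
  where "local_cohomology0 R m N =
    {x \<in> carrier N. \<exists>k. \<forall>a \<in> ideal_power R m k. a \<odot>\<^bsub>N\<^esub> x = \<zero>\<^bsub>N\<^esub>}"

definition length_H0 ::
  "('a, 'b) ring_scheme \<Rightarrow> 'a set \<Rightarrow> ('a, 'c, 'd) module_scheme \<Rightarrow> enat"
  where "length_H0 R m N = module_length R (N\<lparr>carrier := local_cohomology0 R m N\<rparr>)"


subsection \<open>Krull dimension\<close>

text \<open>The value is \<open>- \<infinity>\<close> for the zero ring (the supremum of the empty set), hence also
  for the zero module below.\<close>

definition krull_dim :: "('a, 'b) ring_scheme \<Rightarrow> ereal"
  where "krull_dim R =
    Sup {ereal (real k) | k. \<exists>P :: nat \<Rightarrow> 'a set.
      (\<forall>i\<le>k. primeideal (P i) R) \<and> (\<forall>i<k. P i \<subset> P (Suc i))}"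

definition annihilator :: "('a, 'b) ring_scheme \<Rightarrow> ('a, 'c, 'd) module_scheme \<Rightarrow> 'a set"
  where "annihilator R M = {a \<in> carrier R. \<forall>x \<in> carrier M. a \<odot>\<^bsub>M\<^esub> x = \<zero>\<^bsub>M\<^esub>}"

definition module_dim :: "('a, 'b) ring_scheme \<Rightarrow> ('a, 'c, 'd) module_scheme \<Rightarrow> ereal"
  where "module_dim R M = krull_dim (R Quot annihilator R M)"

text \<open>\<open>nat_of_dim\<close> reads a finite dimension as a natural number (it is \<open>0\<close> at \<open>\<plusminus>\<infinity>\<close>);
  \<open>dim_power n D\<close> is \<open>n\<close> to the power \<open>D\<close>, with \<open>n\<close> to the power \<open>- \<infinity>\<close> being \<open>0\<close>.\<close>

definition nat_of_dim :: "ereal \<Rightarrow> nat"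
  where "nat_of_dim D = nat \<lfloor>real_of_ereal D\<rfloor>"

definition dim_power :: "nat \<Rightarrow> ereal \<Rightarrow> real"
  where "dim_power n D = (if D = - \<infinity> then 0 else real n ^ nat_of_dim D)"


subsection \<open>Filtered modules\<close>

text \<open>The Rees ring is realised as the graded subring of the polynomial ring whose
  coefficients in degree \<open>n\<close> lie in the \<open>n\<close>-th power of \<open>I\<close>; an element of the direct sum
  of the \<open>F n\<close> is a finitely supported sequence, and the Rees ring acts by convolution.\<close>

definition rees_ring :: "('a, 'b) ring_scheme \<Rightarrow> 'a set \<Rightarrow> ('a, nat \<Rightarrow> 'a) up_ring"
  where "rees_ring R I =
    (UP R)\<lparr>carrier := {f \<in> carrier (UP R). \<forall>n. coeff (UP R) f n \<in> ideal_power R I n}\<rparr>"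

definition rees_module ::
  "('a, 'c, 'd) module_scheme \<Rightarrow> (nat \<Rightarrow> 'c set) \<Rightarrow> (nat \<Rightarrow> 'a, nat \<Rightarrow> 'c) module"
  where "rees_module M F =
    \<lparr>carrier = {f. (\<forall>n. f n \<in> F n) \<and> finite {n. f n \<noteq> \<zero>\<^bsub>M\<^esub>}},
     mult = undefined, one = undefined,
     zero = (\<lambda>n. \<zero>\<^bsub>M\<^esub>), add = (\<lambda>f g n. f n \<oplus>\<^bsub>M\<^esub> g n),
     smult = (\<lambda>a f n. \<Oplus>\<^bsub>M\<^esub>i \<in> {..n}. a i \<odot>\<^bsub>M\<^esub> f (n - i))\<rparr>"

locale filtered_module = module R M for R (structure) and M (structure) +
  fixes I :: "'a set" and F :: "nat \<Rightarrow> 'c set"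
  assumes fin_gen: "finitely_generated R M"
    and filtration_submodule: "submodule (F n) R M"
    and filtration_0: "F 0 = carrier M"
    and filtration_decreasing: "F (Suc n) \<subseteq> F n"
    and filtration_mult: "ideal_smult R M I (F n) \<subseteq> F (Suc n)"
    and rees_fin_gen: "finitely_generated (rees_ring R I) (rees_module M F)"

definition epsilon_multiplicity ::
  "('a, 'b) ring_scheme \<Rightarrow> 'a set \<Rightarrow> 'a set \<Rightarrow> ('a, 'c, 'd) module_scheme \<Rightarrow> ereal"
  where "epsilon_multiplicity R m I M =
    limsup (\<lambda>n. ereal (fact (nat_of_dim (module_dim R M))) *
      ereal_of_enat
        (length_H0 R m (quotient_module M (ideal_smult R M (ideal_power R I n) (carrier M))))
      / ereal (dim_power n (module_dim R M)))"

end

theory Submission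
  imports Defs "HOL-Library.Product_Plus"
begin

text \<open>Consider the bigraded module with components \<open>K_i \<inter> m^a F_i\<close>, where \<open>K_i\<close> consists of the
  elements of \<open>F_i\<close> that some power of \<open>m\<close> multiplies into \<open>F_(i+1)\<close>. By Hilbert's basis theorem it is
  finitely generated over the bigraded Rees ring of \<open>m\<close> and \<open>I\<close>, which yields a single \<open>e\<close> with
  \<open>K_i \<inter> m^a F_i \<subseteq> m^(a-e) F_(i+1)\<close> for all \<open>i\<close> and all \<open>a \<ge> e\<close>. Going down the filtration, an element
  of \<open>m^(en) M\<close> that some power of \<open>m\<close> multiplies into \<open>F_n\<close> lies in \<open>F_n\<close>. Hence the length of
  \<open>H^0_m(M / F_n)\<close> is at most that of \<open>M / m^(en) M\<close>, and only the classical bound on the Hilbert-Samuel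
  function in terms of the dimension is left. For that bound, \<open>M\<close> is replaced by \<open>R / ann M\<close>, and
  \<open>\<chi>_J(n) = length (R / (J + m^n))\<close> is estimated by Noetherian induction on \<open>J\<close>, with
  \<open>\<chi>_J \<le> \<chi>_(J:a) + \<chi>_(J+a)\<close> if \<open>J\<close> is not prime and
  \<open>\<chi>_J(n) \<le> \<chi>_J(n-1) + \<chi>_(J+x)(n)\<close> for \<open>x \<in> m - J\<close> if \<open>J\<close> is prime. The dimension is finite because a
  chain of \<open>k\<close> inclusions of primes starting at \<open>P\<close> forces \<open>\<chi>_P\<close> to grow at least like \<open>n^k\<close>, by
  \<open>\<chi>_P(n) \<ge> \<chi>_P(n-c) + \<chi>_P'(n)\<close> for primes \<open>P \<subset> P'\<close>.\<close>

section \<open>Submodules and powers of ideals\<close>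

text \<open>The exponent k with m^k x contained in F_(i+1) depends on x, and applying Artin-Rees to
  each F_n separately would give a constant depending on n. One constant for all i comes from finite
  generation: only finitely many generators matter, so e is the largest degree in \<open>m\<close>
  of a generator plus the largest exponent k of a generator. Each of the n steps costs e, hence
  m^(en), and replacing n by en changes a polynomial bound only by a constant factor. The bigraded
  module is finitely generated because it sits inside one generated in finitely many degrees; here
  finite generation over the Rees ring enters, through F_n contained in I^(n-n0) M for a fixed n0.
  Graded objects appear only through homogeneous elements, as pairs of a degree and an element of M,
  so no polynomial ring or direct sum has to be built. Finiteness of the dimension cannot be read
  off the upper estimate, which presupposes a bound on prime chains; the growth along chains is
  played against a cruder polynomial bound, uniform in J, whose degree is the number of generators
  of \<open>m\<close>.\<close>

context module
begin

lemma submodule_carrier: "submodule N R M \<Longrightarrow> x \<in> N \<Longrightarrow> x \<in> carrier M"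
  using submoduleE(1) by blast

lemma submodule_zero: "submodule N R M \<Longrightarrow> \<zero>\<^bsub>M\<^esub> \<in> N"
  using subgroup.one_closed[OF submodule.axioms(1)] by fastforce

lemma submodule_minus: "submodule N R M \<Longrightarrow> x \<in> N \<Longrightarrow> y \<in> N \<Longrightarrow> x \<ominus>\<^bsub>M\<^esub> y \<in> N"
  by (simp add: a_minus_def submoduleE(3,5))

lemma submoduleI':
  assumes "H \<subseteq> carrier M" "\<zero>\<^bsub>M\<^esub> \<in> H"
    and "\<And>x y. x \<in> H \<Longrightarrow> y \<in> H \<Longrightarrow> x \<oplus>\<^bsub>M\<^esub> y \<in> H"
    and s: "\<And>a x. a \<in> carrier R \<Longrightarrow> x \<in> H \<Longrightarrow> a \<odot>\<^bsub>M\<^esub> x \<in> H"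
  shows "submodule H R M"
proof (rule submoduleI)
  fix x assume "x \<in> H"
  with s[of "\<ominus> \<one>" x] assms(1) show "\<ominus>\<^bsub>M\<^esub> x \<in> H"
    by (auto simp: smult_l_minus subset_iff)
qed (use assms in auto)

lemma submodule_Int:
  "submodule N R M \<Longrightarrow> submodule L R M \<Longrightarrow> submodule (N \<inter> L) R M"
  by (rule submoduleI') (auto simp: submodule_zero submodule_carrier submoduleE(4,5))

lemma submodule_set_add:
  assumes N: "submodule N R M" and L: "submodule L R M"
  shows "submodule (N <+>\<^bsub>M\<^esub> L) R M"
proof (rule submoduleI')
  note c = submodule_carrier[OF N] submodule_carrier[OF L]
  show "N <+>\<^bsub>M\<^esub> L \<subseteq> carrier M" by (auto simp: set_add_def' c)
  have "\<zero>\<^bsub>M\<^esub> = \<zero>\<^bsub>M\<^esub> \<oplus>\<^bsub>M\<^esub> \<zero>\<^bsub>M\<^esub>" by simp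
  with submodule_zero[OF N] submodule_zero[OF L] show "\<zero>\<^bsub>M\<^esub> \<in> N <+>\<^bsub>M\<^esub> L"
    unfolding set_add_def' by blast
  fix x y assume "x \<in> N <+>\<^bsub>M\<^esub> L" "y \<in> N <+>\<^bsub>M\<^esub> L"
  then obtain a b a' b' where *: "a \<in> N" "b \<in> L" "a' \<in> N" "b' \<in> L"
      "x = a \<oplus>\<^bsub>M\<^esub> b" "y = a' \<oplus>\<^bsub>M\<^esub> b'"
    by (auto simp: set_add_def')
  then have "x \<oplus>\<^bsub>M\<^esub> y = (a \<oplus>\<^bsub>M\<^esub> a') \<oplus>\<^bsub>M\<^esub> (b \<oplus>\<^bsub>M\<^esub> b')"
    by (simp add: c M.add.m_ac)
  moreover have "a \<oplus>\<^bsub>M\<^esub> a' \<in> N" "b \<oplus>\<^bsub>M\<^esub> b' \<in> L"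
    using * submoduleE(5)[OF N] submoduleE(5)[OF L] by auto
  ultimately show "x \<oplus>\<^bsub>M\<^esub> y \<in> N <+>\<^bsub>M\<^esub> L"
    unfolding set_add_def' by blast
next
  note c = submodule_carrier[OF N] submodule_carrier[OF L]
  fix r x assume r: "r \<in> carrier R" and "x \<in> N <+>\<^bsub>M\<^esub> L"
  then obtain a b where *: "a \<in> N" "b \<in> L" "x = a \<oplus>\<^bsub>M\<^esub> b" by (auto simp: set_add_def')
  with r have "r \<odot>\<^bsub>M\<^esub> x = r \<odot>\<^bsub>M\<^esub> a \<oplus>\<^bsub>M\<^esub> r \<odot>\<^bsub>M\<^esub> b" by (simp add: c smult_r_distr)
  moreover have "r \<odot>\<^bsub>M\<^esub> a \<in> N" "r \<odot>\<^bsub>M\<^esub> b \<in> L"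
    using * r submoduleE(4)[OF N] submoduleE(4)[OF L] by auto
  ultimately show "r \<odot>\<^bsub>M\<^esub> x \<in> N <+>\<^bsub>M\<^esub> L"
    unfolding set_add_def' by blast
qed

lemma set_add_incl1:
  assumes "submodule N R M" "submodule L R M" shows "N \<subseteq> N <+>\<^bsub>M\<^esub> L"
proof
  fix x assume "x \<in> N"
  then have "x = x \<oplus>\<^bsub>M\<^esub> \<zero>\<^bsub>M\<^esub>" using submodule_carrier[OF assms(1)] by simp
  with \<open>x \<in> N\<close> submodule_zero[OF assms(2)] show "x \<in> N <+>\<^bsub>M\<^esub> L"
    unfolding set_add_def' by blast
qed

lemma set_add_incl2:
  assumes "submodule N R M" "submodule L R M" shows "L \<subseteq> N <+>\<^bsub>M\<^esub> L"
proof
  fix x assume "x \<in> L"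
  then have "x = \<zero>\<^bsub>M\<^esub> \<oplus>\<^bsub>M\<^esub> x" using submodule_carrier[OF assms(2)] by simp
  with \<open>x \<in> L\<close> submodule_zero[OF assms(1)] show "x \<in> N <+>\<^bsub>M\<^esub> L"
    unfolding set_add_def' by blast
qed

lemma set_add_least:
  "submodule L R M \<Longrightarrow> A \<subseteq> L \<Longrightarrow> B \<subseteq> L \<Longrightarrow> A <+>\<^bsub>M\<^esub> B \<subseteq> L"
  by (auto simp: set_add_def' submoduleE(5) subset_iff)

text \<open>Reduces a claim about r x for all x in a spanned submodule to the spanning elements: an
  inclusion of \<open>ideal_smult\<close> into this preimage only has to be tested on
  products.\<close>

lemma submodule_smult_vimage:
  assumes "submodule N R M" "r \<in> carrier R"
  shows "submodule {x \<in> carrier M. r \<odot>\<^bsub>M\<^esub> x \<in> N} R M"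
proof (rule submoduleI')
  fix a x assume "a \<in> carrier R" "x \<in> {x \<in> carrier M. r \<odot>\<^bsub>M\<^esub> x \<in> N}"
  moreover from this assms have "r \<odot>\<^bsub>M\<^esub> (a \<odot>\<^bsub>M\<^esub> x) = a \<odot>\<^bsub>M\<^esub> (r \<odot>\<^bsub>M\<^esub> x)"
    by (simp flip: smult_assoc1 add: R.m_comm)
  ultimately show "a \<odot>\<^bsub>M\<^esub> x \<in> {x \<in> carrier M. r \<odot>\<^bsub>M\<^esub> x \<in> N}"
    using assms by (simp add: submoduleE(4))
qed (use assms in \<open>auto simp: submodule_zero submoduleE(4,5) smult_r_distr\<close>)

text \<open>Membership of r x in N need only be checked for r in a generating set of an ideal, or
  for products in an ideal product. This is the device by which statements pass from generators to
  powers of \<open>m\<close> and \<open>I\<close>.\<close>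

lemma colon_ideal:
  assumes N: "submodule N R M" and x: "x \<in> carrier M"
  shows "ideal {r \<in> carrier R. r \<odot>\<^bsub>M\<^esub> x \<in> N} R"
proof (rule idealI)
  show "ring R" ..
  have "\<zero> \<in> {r \<in> carrier R. r \<odot>\<^bsub>M\<^esub> x \<in> N}"
    using assms by (simp add: submodule_zero)
  then show "subgroup {r \<in> carrier R. r \<odot>\<^bsub>M\<^esub> x \<in> N} (add_monoid R)"
  proof (intro R.add.subgroupI)
    fix a assume "a \<in> {r \<in> carrier R. r \<odot>\<^bsub>M\<^esub> x \<in> N}"
    then have "a \<in> carrier R" "a \<odot>\<^bsub>M\<^esub> x \<in> N" by auto
    with submoduleE(3)[OF N this(2)] x
    show "\<ominus> a \<in> {r \<in> carrier R. r \<odot>\<^bsub>M\<^esub> x \<in> N}"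
      by (simp add: smult_l_minus)
  next
    fix a b assume "a \<in> {r \<in> carrier R. r \<odot>\<^bsub>M\<^esub> x \<in> N}" "b \<in> {r \<in> carrier R. r \<odot>\<^bsub>M\<^esub> x \<in> N}"
    with x submoduleE(5)[OF N, of "a \<odot>\<^bsub>M\<^esub> x" "b \<odot>\<^bsub>M\<^esub> x"]
    show "a \<oplus> b \<in> {r \<in> carrier R. r \<odot>\<^bsub>M\<^esub> x \<in> N}"
      by (simp add: smult_l_distr)
  qed auto
  fix a b assume a: "a \<in> {r \<in> carrier R. r \<odot>\<^bsub>M\<^esub> x \<in> N}" and b: "b \<in> carrier R"
  then show "b \<otimes> a \<in> {r \<in> carrier R. r \<odot>\<^bsub>M\<^esub> x \<in> N}"
    using assms by (simp add: smult_assoc1 submoduleE(4))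
  with a b show "a \<otimes> b \<in> {r \<in> carrier R. r \<odot>\<^bsub>M\<^esub> x \<in> N}"
    by (simp add: R.m_comm)
qed

lemma submodule_span_submodule:
  assumes "A \<subseteq> carrier M" shows "submodule (submodule_span R M A) R M"
proof (rule submoduleI')
  show "submodule_span R M A \<subseteq> carrier M"
    unfolding submodule_span_def using assms carrier_is_submodule by blast
next
  fix x y assume xy: "x \<in> submodule_span R M A" "y \<in> submodule_span R M A"
  show "x \<oplus>\<^bsub>M\<^esub> y \<in> submodule_span R M A"
    unfolding submodule_span_def
  proof clarify
    fix N assume N: "submodule N R M" "A \<subseteq> N"
    with xy have "x \<in> N" "y \<in> N" unfolding submodule_span_def by blast+
    then show "x \<oplus>\<^bsub>M\<^esub> y \<in> N" by (rule submoduleE(5)[OF N(1)])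
  qed
next
  fix r x assume r: "r \<in> carrier R" and x: "x \<in> submodule_span R M A"
  show "r \<odot>\<^bsub>M\<^esub> x \<in> submodule_span R M A"
    unfolding submodule_span_def
  proof clarify
    fix N assume N: "submodule N R M" "A \<subseteq> N"
    with x have "x \<in> N" unfolding submodule_span_def by blast
    then show "r \<odot>\<^bsub>M\<^esub> x \<in> N" by (rule submoduleE(4)[OF N(1) r])
  qed
qed (auto simp: submodule_span_def submodule_zero)

lemma submodule_span_incl: "A \<subseteq> submodule_span R M A"
  unfolding submodule_span_def by blast

lemma submodule_span_least: "submodule N R M \<Longrightarrow> A \<subseteq> N \<Longrightarrow> submodule_span R M A \<subseteq> N"
  unfolding submodule_span_def by blast

lemma ideal_smult_submodule:
  assumes "J \<subseteq> carrier R" "N \<subseteq> carrier M" shows "submodule (ideal_smult R M J N) R M"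
proof -
  have "{a \<odot>\<^bsub>M\<^esub> x | a x. a \<in> J \<and> x \<in> N} \<subseteq> carrier M"
    using assms by (auto simp: subset_iff)
  then show ?thesis unfolding ideal_smult_def by (rule submodule_span_submodule)
qed

lemma ideal_smultI: "a \<in> J \<Longrightarrow> x \<in> N \<Longrightarrow> a \<odot>\<^bsub>M\<^esub> x \<in> ideal_smult R M J N"
  unfolding ideal_smult_def by (rule subsetD[OF submodule_span_incl]) blast

lemma ideal_smult_least:
  assumes "submodule L R M" "\<And>a x. a \<in> J \<Longrightarrow> x \<in> N \<Longrightarrow> a \<odot>\<^bsub>M\<^esub> x \<in> L"
  shows "ideal_smult R M J N \<subseteq> L"
  unfolding ideal_smult_def by (rule submodule_span_least[OF assms(1)]) (use assms(2) in blast)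

lemma ideal_smult_subset:
  assumes "J \<subseteq> carrier R" "submodule N R M" shows "ideal_smult R M J N \<subseteq> N"
  by (rule ideal_smult_least[OF assms(2)]) (use assms(1) submoduleE(4)[OF assms(2)] in blast)

end

section \<open>Powers of an ideal in a commutative ring\<close>

context cring
begin

lemma ideal_power_0: "ideal_power R I 0 = carrier R"
  by (simp add: ideal_power_def ideals_set_def)

lemma ideal_power_Suc: "ideal_power R I (Suc n) = ideal_power R I n \<cdot> I"
  by (simp add: ideal_power_def ideals_set_def nat_pow_def)

lemma ideal_power_ideal:
  assumes "ideal I R" shows "ideal (ideal_power R I n) R"
proof (induction n)
  case 0
  show ?case unfolding ideal_power_0 by (rule oneideal)
next
  case (Suc n)
  show ?case unfolding ideal_power_Suc by (rule ideal_prod_is_ideal[OF Suc assms])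
qed

lemma ideal_power_subset_carrier: "ideal I R \<Longrightarrow> ideal_power R I n \<subseteq> carrier R"
  by (rule subsetI) (rule ideal.Icarr[OF ideal_power_ideal])

lemma ideal_power_add:
  assumes "ideal I R"
  shows "ideal_power R I (a + b) = ideal_power R I a \<cdot> ideal_power R I b"
proof (induction b)
  case 0
  show ?case by (simp add: ideal_power_0 ideal_prod_one ideal_power_ideal assms)
next
  case (Suc b)
  show ?case unfolding add_Suc_right ideal_power_Suc Suc
    by (rule ideal_prod_assoc) (rule ideal_power_ideal[OF assms] assms)+
qed

lemma ideal_power_mult:
  "ideal I R \<Longrightarrow> r \<in> ideal_power R I a \<Longrightarrow> s \<in> ideal_power R I b \<Longrightarrow> r \<otimes> s \<in> ideal_power R I (a + b)"
  by (simp add: ideal_power_add ideal_prod.prod)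

lemma ideal_power_1:
  assumes "ideal I R" shows "ideal_power R I 1 = I"
  using ideal_prod_commute[OF oneideal assms] ideal_prod_one[OF assms]
  unfolding One_nat_def ideal_power_Suc ideal_power_0 by simp

lemma ideal_power_antimono:
  assumes "ideal I R" "a \<le> b" shows "ideal_power R I b \<subseteq> ideal_power R I a"
proof -
  from assms(2) obtain c where b: "b = a + c" using le_Suc_ex by blast
  show ?thesis
    unfolding b ideal_power_add[OF assms(1)]
    using ideal_prod_inter[OF ideal_power_ideal[OF assms(1)] ideal_power_ideal[OF assms(1)]] by blast
qed

end

context module
begin

lemma ideal_power_smult_submodule:
  "ideal I R \<Longrightarrow> N \<subseteq> carrier M \<Longrightarrow> submodule (ideal_smult R M (ideal_power R I n) N) R M"
  by (rule ideal_smult_submodule) (auto simp: ideal_power_subset_carrier)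

lemma ideal_power_smult_mult:
  assumes I: "ideal I R" and N: "N \<subseteq> carrier M"
    and r: "r \<in> ideal_power R I a" and x: "x \<in> ideal_smult R M (ideal_power R I b) N"
  shows "r \<odot>\<^bsub>M\<^esub> x \<in> ideal_smult R M (ideal_power R I (a + b)) N"
proof -
  let ?L = "ideal_smult R M (ideal_power R I (a + b)) N"
  note c = subsetD[OF ideal_power_subset_carrier[OF I]]
  have "ideal_smult R M (ideal_power R I b) N \<subseteq> {x \<in> carrier M. r \<odot>\<^bsub>M\<^esub> x \<in> ?L}"
  proof (rule ideal_smult_least)
    show "submodule {x \<in> carrier M. r \<odot>\<^bsub>M\<^esub> x \<in> ?L} R M"
      by (rule submodule_smult_vimage[OF ideal_power_smult_submodule[OF I N]]) (use r c in auto)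
    fix s y assume s: "s \<in> ideal_power R I b" and y: "y \<in> N"
    have "(r \<otimes> s) \<odot>\<^bsub>M\<^esub> y \<in> ?L"
      by (rule ideal_smultI[OF ideal_power_mult[OF I r s] y])
    moreover have "(r \<otimes> s) \<odot>\<^bsub>M\<^esub> y = r \<odot>\<^bsub>M\<^esub> (s \<odot>\<^bsub>M\<^esub> y)"
      by (rule smult_assoc1) (use r s y N c in auto)
    ultimately show "s \<odot>\<^bsub>M\<^esub> y \<in> {x \<in> carrier M. r \<odot>\<^bsub>M\<^esub> x \<in> ?L}"
      using s y N c by (auto simp: subset_iff)
  qed
  with x show ?thesis by blast
qed

lemma ideal_power_smult_antimono:
  assumes "ideal I R" "N \<subseteq> carrier M" "a \<le> b"
  shows "ideal_smult R M (ideal_power R I b) N \<subseteq> ideal_smult R M (ideal_power R I a) N"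
  by (rule ideal_smult_least[OF ideal_power_smult_submodule[OF assms(1,2)]])
    (use ideal_power_antimono[OF assms(1,3)] in \<open>auto intro: ideal_smultI\<close>)

lemma ideal_power_0_smult:
  assumes "submodule N R M" shows "ideal_smult R M (ideal_power R I 0) N = N"
proof
  show "ideal_smult R M (ideal_power R I 0) N \<subseteq> N"
    using assms by (intro ideal_smult_subset) (auto simp: ideal_power_0)
  show "N \<subseteq> ideal_smult R M (ideal_power R I 0) N"
  proof
    fix x assume "x \<in> N"
    with ideal_smultI[of \<one> "ideal_power R I 0" x N] submodule_carrier[OF assms]
    show "x \<in> ideal_smult R M (ideal_power R I 0) N" by (simp add: ideal_power_0)
  qed
qed

end

section \<open>Noetherian modules\<close>

context module
begin

text \<open>Finiteness relative to a subset of \<open>M\<close>, with spans taken in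
  \<open>M\<close> itself. Generators can thus be added one at a time without passing to quotient
  modules or to restricted module records.\<close>

definition noetherian_submodule :: "'c set \<Rightarrow> bool"
  where "noetherian_submodule A \<longleftrightarrow>
    (\<forall>N. submodule N R M \<and> N \<subseteq> A \<longrightarrow> (\<exists>S. finite S \<and> S \<subseteq> N \<and> N \<subseteq> submodule_span R M S))"

text \<open>Elementwise form of the extension of A by the cyclic module (Rx + A)/A. For a submodule
  N, both the ideal of all r with r x in N + A and the intersection of N with A are finitely
  generated; a submodule L of N with the same ideal and the same intersection equals N.\<close>

lemma noetherian_submodule_insert:
  assumes noeth: "noetherian_ring R" and A: "submodule A R M" "noetherian_submodule A"
    and x: "x \<in> carrier M"
  shows "noetherian_submodule {r \<odot>\<^bsub>M\<^esub> x \<oplus>\<^bsub>M\<^esub> a | r a. r \<in> carrier R \<and> a \<in> A}"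
  unfolding noetherian_submodule_def
proof clarify
  fix N assume N: "submodule N R M" and NA: "N \<subseteq> {r \<odot>\<^bsub>M\<^esub> x \<oplus>\<^bsub>M\<^esub> a | r a. r \<in> carrier R \<and> a \<in> A}"
  note Ac = submodule_carrier[OF A(1)]
  define lead where "lead B = {r \<in> carrier R. r \<odot>\<^bsub>M\<^esub> x \<in> B <+>\<^bsub>M\<^esub> A}" for B
  have ideal_lead: "ideal (lead B) R" if "submodule B R M" for B
    unfolding lead_def by (rule colon_ideal[OF submodule_set_add[OF that A(1)] x])
  from noetherian_ring.finetely_gen[OF noeth ideal_lead[OF N]]
  obtain W where W: "W \<subseteq> carrier R" "finite W" "lead N = Idl W" by blast
  have "\<forall>w\<in>W. \<exists>n\<in>N. \<exists>a\<in>A. w \<odot>\<^bsub>M\<^esub> x = n \<oplus>\<^bsub>M\<^esub> a"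
    using genideal_self[OF W(1)] W(3) unfolding lead_def set_add_def' by blast
  then obtain f where f: "\<And>w. w \<in> W \<Longrightarrow> f w \<in> N" "\<And>w. w \<in> W \<Longrightarrow> \<exists>a\<in>A. w \<odot>\<^bsub>M\<^esub> x = f w \<oplus>\<^bsub>M\<^esub> a"
    by metis
  from A(2) submodule_Int[OF N A(1)] obtain S where S: "finite S" "S \<subseteq> N \<inter> A" "N \<inter> A \<subseteq> submodule_span R M S"
    unfolding noetherian_submodule_def by (meson inf_le2)
  define T where "T = S \<union> f ` W"
  have TN: "T \<subseteq> N" using S(2) f(1) by (auto simp: T_def)
  define L where "L = submodule_span R M T"
  have L: "submodule L R M" unfolding L_def
    by (rule submodule_span_submodule) (use TN submodule_carrier[OF N] in blast)
  have TL: "T \<subseteq> L" unfolding L_def by (rule submodule_span_incl)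
  have LN: "L \<subseteq> N" unfolding L_def by (rule submodule_span_least[OF N TN])
  have "W \<subseteq> lead L"
  proof
    fix w assume w: "w \<in> W"
    with TL have "f w \<in> L" by (auto simp: T_def)
    with f(2)[OF w] w W(1) show "w \<in> lead L" unfolding lead_def set_add_def' by blast
  qed
  then have lead: "lead N \<subseteq> lead L" unfolding W(3) by (rule genideal_minimal[OF ideal_lead[OF L]])
  have NAL: "N \<inter> A \<subseteq> L"
  proof -
    have "submodule_span R M S \<subseteq> L"
      by (rule submodule_span_least[OF L]) (use TL in \<open>auto simp: T_def\<close>)
    with S(3) show ?thesis by blast
  qed
  have "N \<subseteq> L"
  proof
    fix y assume y: "y \<in> N"
    with NA obtain r a where ra: "r \<in> carrier R" "a \<in> A" "y = r \<odot>\<^bsub>M\<^esub> x \<oplus>\<^bsub>M\<^esub> a" by blast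
    then have "r \<odot>\<^bsub>M\<^esub> x = y \<oplus>\<^bsub>M\<^esub> (\<ominus>\<^bsub>M\<^esub> a)" using x Ac by (simp add: M.add.inv_solve_right)
    with y submoduleE(3)[OF A(1) ra(2)] ra(1) have "r \<in> lead N"
      unfolding lead_def set_add_def' by blast
    \<comment> \<open>An element of L with the same coefficient r is subtracted; the difference lies
      in N and in A, hence in L.\<close>
    with lead obtain l a' where l: "l \<in> L" "a' \<in> A" "r \<odot>\<^bsub>M\<^esub> x = l \<oplus>\<^bsub>M\<^esub> a'"
      unfolding lead_def set_add_def' by blast
    have c: "l \<in> carrier M" "a \<in> carrier M" "a' \<in> carrier M" using l ra L Ac submodule_carrier by blast+
    have eq: "y = l \<oplus>\<^bsub>M\<^esub> (a' \<oplus>\<^bsub>M\<^esub> a)" unfolding ra(3) l(3) using c by (simp add: M.a_assoc)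
    then have "a' \<oplus>\<^bsub>M\<^esub> a = y \<ominus>\<^bsub>M\<^esub> l" using c by (simp add: a_minus_def M.add.m_ac M.r_neg1 M.r_neg)
    also have "\<dots> \<in> N" using submodule_minus[OF N y] l(1) LN by blast
    finally have "a' \<oplus>\<^bsub>M\<^esub> a \<in> N \<inter> A" using submoduleE(5)[OF A(1) l(2) ra(2)] by blast
    with NAL have "a' \<oplus>\<^bsub>M\<^esub> a \<in> L" by blast
    with eq submoduleE(5)[OF L l(1)] show "y \<in> L" by simp
  qed
  moreover have "finite T" using S(1) W(2) by (simp add: T_def)
  ultimately show "\<exists>S. finite S \<and> S \<subseteq> N \<and> N \<subseteq> submodule_span R M S" using TN unfolding L_def by blast
qed

lemma submodule_cyclic:
  assumes x: "x \<in> carrier M" shows "submodule {r \<odot>\<^bsub>M\<^esub> x | r. r \<in> carrier R} R M"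
proof (rule submoduleI')
  show "\<zero>\<^bsub>M\<^esub> \<in> {r \<odot>\<^bsub>M\<^esub> x | r. r \<in> carrier R}"
    using smult_l_null[OF x] by (metis (mono_tags, lifting) R.zero_closed mem_Collect_eq)
next
  fix y z assume "y \<in> {r \<odot>\<^bsub>M\<^esub> x | r. r \<in> carrier R}" "z \<in> {r \<odot>\<^bsub>M\<^esub> x | r. r \<in> carrier R}"
  then obtain r s where "r \<in> carrier R" "s \<in> carrier R" "y = r \<odot>\<^bsub>M\<^esub> x" "z = s \<odot>\<^bsub>M\<^esub> x" by blast
  then have "y \<oplus>\<^bsub>M\<^esub> z = (r \<oplus> s) \<odot>\<^bsub>M\<^esub> x \<and> r \<oplus> s \<in> carrier R" using x by (simp add: smult_l_distr)
  then show "y \<oplus>\<^bsub>M\<^esub> z \<in> {r \<odot>\<^bsub>M\<^esub> x | r. r \<in> carrier R}" by blast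
next
  fix s y assume "s \<in> carrier R" "y \<in> {r \<odot>\<^bsub>M\<^esub> x | r. r \<in> carrier R}"
  then obtain r where "r \<in> carrier R" "s \<in> carrier R" "y = r \<odot>\<^bsub>M\<^esub> x" by blast
  then have "s \<odot>\<^bsub>M\<^esub> y = (s \<otimes> r) \<odot>\<^bsub>M\<^esub> x \<and> s \<otimes> r \<in> carrier R" using x by (simp add: smult_assoc1)
  then show "s \<odot>\<^bsub>M\<^esub> y \<in> {r \<odot>\<^bsub>M\<^esub> x | r. r \<in> carrier R}" by blast
qed (use x in auto)

text \<open>A finite generating set is adjoined to the zero submodule one element at a time.\<close>

lemma noetherian_submodule_carrier:
  assumes noeth: "noetherian_ring R" and fg: "finitely_generated R M"
  shows "noetherian_submodule (carrier M)"
proof -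
  have "\<exists>A. submodule A R M \<and> noetherian_submodule A \<and> X \<subseteq> A" if "finite X" "X \<subseteq> carrier M" for X
    using that
  proof (induction X)
    case empty
    have sub: "submodule {\<zero>\<^bsub>M\<^esub>} R M" by (rule submoduleI') auto
    moreover have "noetherian_submodule {\<zero>\<^bsub>M\<^esub>}"
      unfolding noetherian_submodule_def
    proof clarify
      fix N assume "submodule N R M" "N \<subseteq> {\<zero>\<^bsub>M\<^esub>}"
      then have "N = {\<zero>\<^bsub>M\<^esub>}" using submodule_zero by blast
      then show "\<exists>S. finite S \<and> S \<subseteq> N \<and> N \<subseteq> submodule_span R M S"
        using submodule_span_incl[of N] by blast
    qed
    ultimately show ?case by blast
  next
    case (insert x X)
    then obtain A where A: "submodule A R M" "noetherian_submodule A" "X \<subseteq> A" and x: "x \<in> carrier M" by auto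
    note Ac = submodule_carrier[OF A(1)]
    let ?B = "{r \<odot>\<^bsub>M\<^esub> x \<oplus>\<^bsub>M\<^esub> a | r a. r \<in> carrier R \<and> a \<in> A}"
    note rx = submodule_cyclic[OF x]
    have eq: "?B = {r \<odot>\<^bsub>M\<^esub> x | r. r \<in> carrier R} <+>\<^bsub>M\<^esub> A" unfolding set_add_def' by blast
    have "submodule ?B R M" unfolding eq by (rule submodule_set_add[OF rx A(1)])
    moreover have "noetherian_submodule ?B" by (rule noetherian_submodule_insert[OF noeth A(1,2) x])
    moreover have "x \<in> ?B"
    proof -
      have "\<one> \<odot>\<^bsub>M\<^esub> x \<oplus>\<^bsub>M\<^esub> \<zero>\<^bsub>M\<^esub> \<in> ?B" using submodule_zero[OF A(1)] by blast
      then show ?thesis using x by simp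
    qed
    moreover have "X \<subseteq> ?B"
      using A(3) set_add_incl2[OF rx A(1)] unfolding eq by blast
    ultimately show ?case by (meson insert_subset)
  qed
  moreover obtain X where X: "finite X" "X \<subseteq> carrier M" "carrier M = submodule_span R M X"
    using fg unfolding finitely_generated_def by blast
  ultimately obtain A where A: "submodule A R M" "noetherian_submodule A" "X \<subseteq> A" by meson
  have "carrier M \<subseteq> A" using submodule_span_least[OF A(1,3)] X(3) by blast
  with A(2) show ?thesis unfolding noetherian_submodule_def by blast
qed

end

section \<open>Hilbert's basis theorem for graded modules\<close>

text \<open>The pair (g, x) stands for x placed in degree g, and (z, \<delta>) in \<open>Z\<close>
  for a variable of degree \<delta> acting as multiplication by z. The set consists of the
  homogeneous elements of the submodule generated by \<open>S\<close> over the polynomial ring in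
  these variables; the same x may occur in several degrees. Degrees form a group so that they can be
  shifted back in the induction on the variables.\<close>

inductive_set graded_span ::
  "('a, 'b) ring_scheme \<Rightarrow> ('a, 'c, 'd) module_scheme \<Rightarrow> ('a \<times> 'g) set \<Rightarrow> ('g \<times> 'c) set
    \<Rightarrow> ('g::ab_group_add \<times> 'c) set"
  for R and M and Z and S where
  base: "p \<in> S \<Longrightarrow> p \<in> graded_span R M Z S"
| zero: "(g, \<zero>\<^bsub>M\<^esub>) \<in> graded_span R M Z S"
| add: "(g, x) \<in> graded_span R M Z S \<Longrightarrow> (g, y) \<in> graded_span R M Z S
    \<Longrightarrow> (g, x \<oplus>\<^bsub>M\<^esub> y) \<in> graded_span R M Z S"
| smult: "r \<in> carrier R \<Longrightarrow> (g, x) \<in> graded_span R M Z S \<Longrightarrow> (g, r \<odot>\<^bsub>M\<^esub> x) \<in> graded_span R M Z S"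
| oper: "(z, \<delta>) \<in> Z \<Longrightarrow> (g, x) \<in> graded_span R M Z S \<Longrightarrow> (g + \<delta>, z \<odot>\<^bsub>M\<^esub> x) \<in> graded_span R M Z S"

context module
begin

definition graded_submodule :: "('a \<times> 'g) set \<Rightarrow> ('g::ab_group_add \<times> 'c) set \<Rightarrow> bool"
  where "graded_submodule Z B \<longleftrightarrow> snd ` B \<subseteq> carrier M \<and> graded_span R M Z B \<subseteq> B"

definition graded_noetherian :: "('a \<times> 'g) set \<Rightarrow> ('g::ab_group_add \<times> 'c) set \<Rightarrow> bool"
  where "graded_noetherian Z A \<longleftrightarrow>
    (\<forall>B. B \<subseteq> A \<and> graded_submodule Z B \<longrightarrow> (\<exists>S. finite S \<and> S \<subseteq> B \<and> B \<subseteq> graded_span R M Z S))"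

lemma graded_submoduleI:
  assumes "\<And>g x. (g, x) \<in> B \<Longrightarrow> x \<in> carrier M"
    and "\<And>g. (g, \<zero>\<^bsub>M\<^esub>) \<in> B"
    and "\<And>g x y. (g, x) \<in> B \<Longrightarrow> (g, y) \<in> B \<Longrightarrow> (g, x \<oplus>\<^bsub>M\<^esub> y) \<in> B"
    and "\<And>r g x. r \<in> carrier R \<Longrightarrow> (g, x) \<in> B \<Longrightarrow> (g, r \<odot>\<^bsub>M\<^esub> x) \<in> B"
    and "\<And>z \<delta> g x. (z, \<delta>) \<in> Z \<Longrightarrow> (g, x) \<in> B \<Longrightarrow> (g + \<delta>, z \<odot>\<^bsub>M\<^esub> x) \<in> B"
  shows "graded_submodule Z B"
proof -
  have "p \<in> B" if "p \<in> graded_span R M Z B" for p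
    using that by induction (use assms in auto)
  with assms(1) show ?thesis unfolding graded_submodule_def by auto
qed

lemma graded_submoduleD:
  assumes "graded_submodule Z B"
  shows "\<And>g x. (g, x) \<in> B \<Longrightarrow> x \<in> carrier M"
    and "\<And>g. (g, \<zero>\<^bsub>M\<^esub>) \<in> B"
    and "\<And>g x y. (g, x) \<in> B \<Longrightarrow> (g, y) \<in> B \<Longrightarrow> (g, x \<oplus>\<^bsub>M\<^esub> y) \<in> B"
    and "\<And>r g x. r \<in> carrier R \<Longrightarrow> (g, x) \<in> B \<Longrightarrow> (g, r \<odot>\<^bsub>M\<^esub> x) \<in> B"
    and "\<And>z \<delta> g x. (z, \<delta>) \<in> Z \<Longrightarrow> (g, x) \<in> B \<Longrightarrow> (g + \<delta>, z \<odot>\<^bsub>M\<^esub> x) \<in> B"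
proof -
  have s: "graded_span R M Z B \<subseteq> B" and c: "snd ` B \<subseteq> carrier M"
    using assms unfolding graded_submodule_def by auto
  note sD = subsetD[OF s]
  show "\<And>g x. (g, x) \<in> B \<Longrightarrow> x \<in> carrier M" using c by force
  show "\<And>g. (g, \<zero>\<^bsub>M\<^esub>) \<in> B" by (rule sD[OF graded_span.zero])
  show "\<And>g x y. (g, x) \<in> B \<Longrightarrow> (g, y) \<in> B \<Longrightarrow> (g, x \<oplus>\<^bsub>M\<^esub> y) \<in> B"
    by (rule sD[OF graded_span.add]) (erule graded_span.base)+
  show "\<And>r g x. r \<in> carrier R \<Longrightarrow> (g, x) \<in> B \<Longrightarrow> (g, r \<odot>\<^bsub>M\<^esub> x) \<in> B"
    by (rule sD[OF graded_span.smult]) (auto intro: graded_span.base)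
  show "\<And>z \<delta> g x. (z, \<delta>) \<in> Z \<Longrightarrow> (g, x) \<in> B \<Longrightarrow> (g + \<delta>, z \<odot>\<^bsub>M\<^esub> x) \<in> B"
    by (rule sD[OF graded_span.oper]) (auto intro: graded_span.base)
qed

lemma graded_span_least:
  assumes "graded_submodule Z B" "S \<subseteq> B" shows "graded_span R M Z S \<subseteq> B"
proof
  fix p assume "p \<in> graded_span R M Z S"
  then show "p \<in> B" by induction (use assms(2) graded_submoduleD[OF assms(1)] in auto)
qed

lemma graded_submodule_span:
  assumes "snd ` S \<subseteq> carrier M" "fst ` Z \<subseteq> carrier R"
  shows "graded_submodule Z (graded_span R M Z S)"
proof (rule graded_submoduleI)
  fix g x assume "(g, x) \<in> graded_span R M Z S"
  then have "snd (g, x) \<in> carrier M" by induction (use assms in force)+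
  then show "x \<in> carrier M" by simp
qed (auto intro: graded_span.intros)

lemma graded_submodule_minus:
  assumes "graded_submodule Z B" "(g, x) \<in> B" "(g, y) \<in> B" shows "(g, x \<ominus>\<^bsub>M\<^esub> y) \<in> B"
proof -
  note D = graded_submoduleD[OF assms(1)]
  have "(g, (\<ominus> \<one>) \<odot>\<^bsub>M\<^esub> y) \<in> B" using D(4)[OF _ assms(3)] by simp
  moreover have "(\<ominus> \<one>) \<odot>\<^bsub>M\<^esub> y = \<ominus>\<^bsub>M\<^esub> y" using D(1)[OF assms(3)] by (simp add: smult_l_minus)
  ultimately show ?thesis using D(3)[OF assms(2)] unfolding a_minus_def by simp
qed

lemma graded_noetherian_mono:
  "graded_noetherian Z A \<Longrightarrow> A' \<subseteq> A \<Longrightarrow> graded_noetherian Z A'"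
  unfolding graded_noetherian_def by blast

text \<open>Without operators the degrees do not interact: each of the finitely many components in
  degrees of \<open>G\<close> is a submodule of the Noetherian module \<open>M\<close>, and all
  others are zero.\<close>

lemma graded_noetherian_base:
  assumes noeth: "noetherian_submodule (carrier M)" and G: "finite G"
  shows "graded_noetherian {} {(g, x). x = \<zero>\<^bsub>M\<^esub> \<or> g \<in> G \<and> x \<in> carrier M}"
  unfolding graded_noetherian_def
proof clarify
  fix B assume B: "B \<subseteq> {(g, x). x = \<zero>\<^bsub>M\<^esub> \<or> g \<in> G \<and> x \<in> carrier M}" and "graded_submodule {} B"
  note D = graded_submoduleD[OF this(2)]
  have sub: "submodule {x. (g, x) \<in> B} R M" for g
    by (rule submoduleI') (auto intro: D)
  have "\<exists>S. finite S \<and> S \<subseteq> {x. (g, x) \<in> B} \<and> {x. (g, x) \<in> B} \<subseteq> submodule_span R M S" for g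
    using noeth sub[of g] D(1) unfolding noetherian_submodule_def by (metis mem_Collect_eq subsetI)
  then obtain S where S: "\<And>g. finite (S g)" "\<And>g. S g \<subseteq> {x. (g, x) \<in> B}"
      "\<And>g. {x. (g, x) \<in> B} \<subseteq> submodule_span R M (S g)"
    by metis
  define T where "T = Sigma G S"
  have TB: "T \<subseteq> B" using S(2) by (auto simp: T_def)
  have T: "graded_submodule {} (graded_span R M {} T)"
    by (rule graded_submodule_span) (use TB D(1) in auto)
  note DT = graded_submoduleD[OF T]
  have "p \<in> graded_span R M {} T" if p: "p \<in> B" for p
  proof (cases "fst p \<in> G")
    case False
    with B p have "snd p = \<zero>\<^bsub>M\<^esub>" by auto
    then show ?thesis using DT(2)[of "fst p"] by (metis prod.collapse)
  next
    case True
    have "submodule {x. (fst p, x) \<in> graded_span R M {} T} R M"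
      by (rule submoduleI') (auto intro: DT)
    moreover have "S (fst p) \<subseteq> {x. (fst p, x) \<in> graded_span R M {} T}"
      using True by (auto simp: T_def intro: graded_span.base)
    ultimately have "submodule_span R M (S (fst p)) \<subseteq> {x. (fst p, x) \<in> graded_span R M {} T}"
      by (rule submodule_span_least)
    moreover have "snd p \<in> submodule_span R M (S (fst p))"
      using S(3)[of "fst p"] p by auto
    ultimately show ?thesis by auto
  qed
  moreover have "finite T" using G S(1) by (simp add: T_def)
  ultimately show "\<exists>S. finite S \<and> S \<subseteq> B \<and> B \<subseteq> graded_span R M {} S" using TB by blast
qed

text \<open>The induction step of Hilbert's basis theorem: \<open>E i\<close> consists of the elements of degree less
  than \<open>i\<close> in the new operator, and \<open>lead B i\<close> of the leading coefficients of the elements of degree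
  \<open>i\<close> in \<open>B\<close>. Nothing is assumed about relations between the operators.\<close>

lemma graded_noetherian_insert:
  assumes A: "graded_submodule Z A" and noeth: "graded_noetherian Z A"
    and Z: "fst ` Z \<subseteq> carrier R" and z: "z \<in> carrier R"
  shows "graded_noetherian (insert (z, \<delta>) Z) (graded_span R M (insert (z, \<delta>) Z) A)"
proof -
  note DA = graded_submoduleD[OF A]
  define Z' where "Z' = insert (z, \<delta>) Z"
  have Z': "fst ` Z' \<subseteq> carrier R" using Z z by (simp add: Z'_def)
  \<comment> \<open>\<open>d i\<close> and \<open>p i\<close> are the degree and the action of the
    i-th power of the new operator, obtained by iteration because degrees live in an arbitrary
    abelian group.\<close>
  define d where "d i = (((+) \<delta>) ^^ i) 0" for i :: nat
  have d0: "d 0 = 0" and dSuc: "d (Suc i) = d i + \<delta>" for i by (simp_all add: d_def)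
  define p where "p i = ((\<lambda>x. z \<odot>\<^bsub>M\<^esub> x) ^^ i)" for i :: nat
  have p0: "p 0 x = x" and pSuc: "p (Suc i) x = z \<odot>\<^bsub>M\<^esub> p i x" for i x by (simp_all add: p_def)
  have pc: "p i x \<in> carrier M" if "x \<in> carrier M" for i x
    using that z by (induction i) (auto simp: p0 pSuc)
  have padd: "p i (x \<oplus>\<^bsub>M\<^esub> y) = p i x \<oplus>\<^bsub>M\<^esub> p i y" if "x \<in> carrier M" "y \<in> carrier M" for i x y
    using that z by (induction i) (auto simp: p0 pSuc pc smult_r_distr)
  have psmult: "p i (r \<odot>\<^bsub>M\<^esub> x) = r \<odot>\<^bsub>M\<^esub> p i x" if "r \<in> carrier R" "x \<in> carrier M" for i r x
  proof (induction i)
    case (Suc i)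
    have "z \<odot>\<^bsub>M\<^esub> (r \<odot>\<^bsub>M\<^esub> p i x) = r \<odot>\<^bsub>M\<^esub> (z \<odot>\<^bsub>M\<^esub> p i x)"
      using that z pc[OF that(2), of i] by (simp flip: smult_assoc1 add: R.m_comm)
    with Suc show ?case by (simp add: pSuc)
  qed (simp add: p0)
  have pzero: "p i \<zero>\<^bsub>M\<^esub> = \<zero>\<^bsub>M\<^esub>" for i using z by (induction i) (auto simp: p0 pSuc)
  \<comment> \<open>\<open>E i\<close> holds the sums of z^j x_j over j < i with x_j in
    \<open>A\<close>, in the degree shifted back by \<open>d j\<close>. Such expressions need not be
    unique; the argument only uses that an element has one.\<close>
  define E where "E = rec_nat {(g, x). x = \<zero>\<^bsub>M\<^esub>}
    (\<lambda>i Ei. {(g, p i x \<oplus>\<^bsub>M\<^esub> y) | g x y. (g - d i, x) \<in> A \<and> (g, y) \<in> Ei})"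
  have E0: "E 0 = {(g, x). x = \<zero>\<^bsub>M\<^esub>}" by (simp add: E_def)
  have ESuc: "E (Suc i) = {(g, p i x \<oplus>\<^bsub>M\<^esub> y) | g x y. (g - d i, x) \<in> A \<and> (g, y) \<in> E i}" for i
    by (simp add: E_def)
  have ZR: "z' \<in> carrier R" if "(z', \<delta>') \<in> Z" for z' \<delta>' using Z that by force
  have E: "graded_submodule Z (E i)" for i
  proof (induction i)
    case 0
    show ?case by (rule graded_submoduleI) (auto simp: E0 ZR)
  next
    case (Suc i)
    note DE = graded_submoduleD[OF Suc]
    show ?case
    proof (rule graded_submoduleI)
      fix g x assume "(g, x) \<in> E (Suc i)"
      then show "x \<in> carrier M" using DA(1) DE(1) pc by (auto simp: ESuc)
    next
      fix g
      have "(g, p i \<zero>\<^bsub>M\<^esub> \<oplus>\<^bsub>M\<^esub> \<zero>\<^bsub>M\<^esub>) \<in> E (Suc i)" using DA(2) DE(2) unfolding ESuc by blast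
      then show "(g, \<zero>\<^bsub>M\<^esub>) \<in> E (Suc i)" by (simp add: pzero)
    next
      fix g u v assume "(g, u) \<in> E (Suc i)" "(g, v) \<in> E (Suc i)"
      then obtain x y x' y' where *: "(g - d i, x) \<in> A" "(g, y) \<in> E i" "u = p i x \<oplus>\<^bsub>M\<^esub> y"
          "(g - d i, x') \<in> A" "(g, y') \<in> E i" "v = p i x' \<oplus>\<^bsub>M\<^esub> y'"
        unfolding ESuc by blast
      note c = DA(1)[OF *(1)] DE(1)[OF *(2)] DA(1)[OF *(4)] DE(1)[OF *(5)]
      have "u \<oplus>\<^bsub>M\<^esub> v = p i (x \<oplus>\<^bsub>M\<^esub> x') \<oplus>\<^bsub>M\<^esub> (y \<oplus>\<^bsub>M\<^esub> y')"
        using c pc by (simp add: *(3,6) padd M.add.m_ac)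
      then show "(g, u \<oplus>\<^bsub>M\<^esub> v) \<in> E (Suc i)"
        using DA(3)[OF *(1,4)] DE(3)[OF *(2,5)] unfolding ESuc by blast
    next
      fix r g u assume r: "r \<in> carrier R" and "(g, u) \<in> E (Suc i)"
      then obtain x y where *: "(g - d i, x) \<in> A" "(g, y) \<in> E i" "u = p i x \<oplus>\<^bsub>M\<^esub> y"
        unfolding ESuc by blast
      note c = DA(1)[OF *(1)] DE(1)[OF *(2)]
      have "r \<odot>\<^bsub>M\<^esub> u = p i (r \<odot>\<^bsub>M\<^esub> x) \<oplus>\<^bsub>M\<^esub> r \<odot>\<^bsub>M\<^esub> y"
        using c pc r by (simp add: *(3) psmult smult_r_distr)
      then show "(g, r \<odot>\<^bsub>M\<^esub> u) \<in> E (Suc i)"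
        using DA(4)[OF r *(1)] DE(4)[OF r *(2)] unfolding ESuc by blast
    next
      fix z' \<delta>' g u assume zz: "(z', \<delta>') \<in> Z" and "(g, u) \<in> E (Suc i)"
      then obtain x y where *: "(g - d i, x) \<in> A" "(g, y) \<in> E i" "u = p i x \<oplus>\<^bsub>M\<^esub> y"
        unfolding ESuc by blast
      note c = DA(1)[OF *(1)] DE(1)[OF *(2)]
      have "z' \<odot>\<^bsub>M\<^esub> u = p i (z' \<odot>\<^bsub>M\<^esub> x) \<oplus>\<^bsub>M\<^esub> z' \<odot>\<^bsub>M\<^esub> y"
        using c pc ZR[OF zz] by (simp add: *(3) psmult smult_r_distr)
      moreover have "(g + \<delta>' - d i, z' \<odot>\<^bsub>M\<^esub> x) \<in> A"
        using DA(5)[OF zz *(1)] by (simp add: algebra_simps)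
      ultimately show "(g + \<delta>', z' \<odot>\<^bsub>M\<^esub> u) \<in> E (Suc i)"
        using DE(5)[OF zz *(2)] unfolding ESuc by blast
    qed
  qed
  note DE = graded_submoduleD[OF E]
  have E_step: "E i \<subseteq> E (Suc i)" for i
  proof
    fix q assume q: "q \<in> E i"
    obtain g x where gx: "q = (g, x)" by (cases q)
    have "(g, p i \<zero>\<^bsub>M\<^esub> \<oplus>\<^bsub>M\<^esub> x) \<in> E (Suc i)" using DA(2) q unfolding ESuc gx by blast
    then show "q \<in> E (Suc i)" using DE(1) q by (simp add: pzero gx)
  qed
  then have E_mono: "i \<le> j \<Longrightarrow> E i \<subseteq> E j" for i j by (rule lift_Suc_mono_le)
  have E_oper: "(g, u) \<in> E i \<Longrightarrow> (g + \<delta>, z \<odot>\<^bsub>M\<^esub> u) \<in> E (Suc i)" for g u i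
  proof (induction i arbitrary: g u)
    case 0
    then show ?case using DE(2) z by (simp add: E0)
  next
    case (Suc i)
    then obtain x y where *: "(g - d i, x) \<in> A" "(g, y) \<in> E i" "u = p i x \<oplus>\<^bsub>M\<^esub> y"
      unfolding ESuc[of i] by blast
    note c = DA(1)[OF *(1)] DE(1)[OF *(2)]
    have "z \<odot>\<^bsub>M\<^esub> u = p (Suc i) x \<oplus>\<^bsub>M\<^esub> z \<odot>\<^bsub>M\<^esub> y"
      using c pc z by (simp add: *(3) pSuc smult_r_distr)
    moreover have "(g + \<delta> - d (Suc i), x) \<in> A" using *(1) by (simp add: dSuc)
    ultimately show ?case using Suc.IH[OF *(2)] unfolding ESuc[of "Suc i"] by blast
  qed
  have A_E: "A \<subseteq> E 1"
  proof
    fix q assume q: "q \<in> A"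
    obtain g x where gx: "q = (g, x)" by (cases q)
    have "(g - d 0, x) \<in> A" using q gx by (simp add: d0)
    then have "(g, p 0 x \<oplus>\<^bsub>M\<^esub> \<zero>\<^bsub>M\<^esub>) \<in> E (Suc 0)" using DE(2) unfolding ESuc by blast
    then show "q \<in> E 1" using DA(1) q by (simp add: p0 gx)
  qed
  have UE: "graded_submodule Z' (\<Union>i. E i)"
  proof (rule graded_submoduleI)
    fix g x y assume "(g, x) \<in> (\<Union>i. E i)" "(g, y) \<in> (\<Union>i. E i)"
    then obtain i j where "(g, x) \<in> E i" "(g, y) \<in> E j" by blast
    then have "(g, x) \<in> E (max i j)" "(g, y) \<in> E (max i j)"
      using E_mono[of i "max i j"] E_mono[of j "max i j"] by auto
    from DE(3)[OF this] show "(g, x \<oplus>\<^bsub>M\<^esub> y) \<in> (\<Union>i. E i)" by blast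
  next
    fix z' \<delta>' g x assume zz: "(z', \<delta>') \<in> Z'" and "(g, x) \<in> (\<Union>i. E i)"
    then obtain i where x: "(g, x) \<in> E i" by blast
    have "(g + \<delta>', z' \<odot>\<^bsub>M\<^esub> x) \<in> E (Suc i)"
    proof (cases "(z', \<delta>') \<in> Z")
      case True
      from DE(5)[OF this x] E_step show ?thesis by blast
    next
      case False
      with zz E_oper[OF x] show ?thesis by (simp add: Z'_def)
    qed
    then show "(g + \<delta>', z' \<odot>\<^bsub>M\<^esub> x) \<in> (\<Union>i. E i)" by blast
  next
    fix g x assume "(g, x) \<in> (\<Union>i. E i)"
    then show "x \<in> carrier M" using DE(1) by auto
  next
    fix r g x assume r: "r \<in> carrier R" and "(g, x) \<in> (\<Union>i. E i)"
    then show "(g, r \<odot>\<^bsub>M\<^esub> x) \<in> (\<Union>i. E i)" using DE(4)[OF r] by auto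
  qed (use DE(2) in auto)
  have span_E: "graded_span R M Z' A \<subseteq> (\<Union>i. E i)"
    by (rule graded_span_least[OF UE]) (use A_E in blast)
  \<comment> \<open>A leading coefficient is stored in its own degree, before the shift by
    \<open>d i\<close>; this makes \<open>lead B i\<close> comparable for different i. The remainder
    y must have lower degree in z, that is, lie in \<open>E i\<close>.\<close>
  define lead where "lead B i =
    {(g, x). (g, x) \<in> A \<and> (\<exists>y. (g + d i, y) \<in> E i \<and> (g + d i, p i x \<oplus>\<^bsub>M\<^esub> y) \<in> B)}" for B i
  have lead_sub: "graded_submodule Z (lead B i)" if B: "graded_submodule Z' B" for B i
  proof -
    note DB = graded_submoduleD[OF B]
    show ?thesis
    proof (rule graded_submoduleI)
      fix g x assume "(g, x) \<in> lead B i"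
      then show "x \<in> carrier M" using DA(1) unfolding lead_def by blast
    next
      fix g
      have "(g + d i, p i \<zero>\<^bsub>M\<^esub> \<oplus>\<^bsub>M\<^esub> \<zero>\<^bsub>M\<^esub>) \<in> B" using DB(2) by (simp add: pzero)
      then show "(g, \<zero>\<^bsub>M\<^esub>) \<in> lead B i" using DA(2) DE(2) unfolding lead_def by blast
    next
      fix g x x' assume "(g, x) \<in> lead B i" "(g, x') \<in> lead B i"
      then obtain y y' where *: "(g, x) \<in> A" "(g + d i, y) \<in> E i" "(g + d i, p i x \<oplus>\<^bsub>M\<^esub> y) \<in> B"
        "(g, x') \<in> A" "(g + d i, y') \<in> E i" "(g + d i, p i x' \<oplus>\<^bsub>M\<^esub> y') \<in> B" unfolding lead_def by blast
      note c = DA(1)[OF *(1)] DE(1)[OF *(2)] DA(1)[OF *(4)] DE(1)[OF *(5)]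
      have "(p i x \<oplus>\<^bsub>M\<^esub> y) \<oplus>\<^bsub>M\<^esub> (p i x' \<oplus>\<^bsub>M\<^esub> y') = p i (x \<oplus>\<^bsub>M\<^esub> x') \<oplus>\<^bsub>M\<^esub> (y \<oplus>\<^bsub>M\<^esub> y')"
        using c pc by (simp add: padd M.add.m_ac)
      with DB(3)[OF *(3,6)] have "(g + d i, p i (x \<oplus>\<^bsub>M\<^esub> x') \<oplus>\<^bsub>M\<^esub> (y \<oplus>\<^bsub>M\<^esub> y')) \<in> B" by simp
      then show "(g, x \<oplus>\<^bsub>M\<^esub> x') \<in> lead B i"
        using DA(3)[OF *(1,4)] DE(3)[OF *(2,5)] unfolding lead_def by blast
    next
      fix r g x assume r: "r \<in> carrier R" and "(g, x) \<in> lead B i"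
      then obtain y where *: "(g, x) \<in> A" "(g + d i, y) \<in> E i" "(g + d i, p i x \<oplus>\<^bsub>M\<^esub> y) \<in> B"
        unfolding lead_def by blast
      note c = DA(1)[OF *(1)] DE(1)[OF *(2)]
      have "r \<odot>\<^bsub>M\<^esub> (p i x \<oplus>\<^bsub>M\<^esub> y) = p i (r \<odot>\<^bsub>M\<^esub> x) \<oplus>\<^bsub>M\<^esub> r \<odot>\<^bsub>M\<^esub> y"
        using c pc r by (simp add: psmult smult_r_distr)
      with DB(4)[OF r *(3)] have "(g + d i, p i (r \<odot>\<^bsub>M\<^esub> x) \<oplus>\<^bsub>M\<^esub> r \<odot>\<^bsub>M\<^esub> y) \<in> B" by simp
      then show "(g, r \<odot>\<^bsub>M\<^esub> x) \<in> lead B i"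
        using DA(4)[OF r *(1)] DE(4)[OF r *(2)] unfolding lead_def by blast
    next
      fix z' \<delta>' g x assume zz: "(z', \<delta>') \<in> Z" and "(g, x) \<in> lead B i"
      then obtain y where *: "(g, x) \<in> A" "(g + d i, y) \<in> E i" "(g + d i, p i x \<oplus>\<^bsub>M\<^esub> y) \<in> B"
        unfolding lead_def by blast
      note c = DA(1)[OF *(1)] DE(1)[OF *(2)]
      have eq: "g + d i + \<delta>' = g + \<delta>' + d i" by (simp add: algebra_simps)
      have "z' \<odot>\<^bsub>M\<^esub> (p i x \<oplus>\<^bsub>M\<^esub> y) = p i (z' \<odot>\<^bsub>M\<^esub> x) \<oplus>\<^bsub>M\<^esub> z' \<odot>\<^bsub>M\<^esub> y"
        using c pc ZR[OF zz] by (simp add: psmult smult_r_distr)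
      moreover have "(z', \<delta>') \<in> Z'" using zz by (simp add: Z'_def)
      ultimately have "(g + \<delta>' + d i, p i (z' \<odot>\<^bsub>M\<^esub> x) \<oplus>\<^bsub>M\<^esub> z' \<odot>\<^bsub>M\<^esub> y) \<in> B"
        using DB(5)[of z' \<delta>', OF _ *(3)] unfolding eq by simp
      then show "(g + \<delta>', z' \<odot>\<^bsub>M\<^esub> x) \<in> lead B i"
        using DA(5)[OF zz *(1)] DE(5)[OF zz *(2)] unfolding lead_def eq by blast
    qed
  qed
  \<comment> \<open>Multiplying by z keeps the coefficient and raises the degree in z by
    one.\<close>
  have lead_mono: "lead B i \<subseteq> lead B j" if B: "graded_submodule Z' B" and "i \<le> j" for B i j
    using that(2)
  proof (rule lift_Suc_mono_le[rotated])
    fix i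
    show "lead B i \<subseteq> lead B (Suc i)"
    proof clarify
      fix g x assume "(g, x) \<in> lead B i"
      then obtain y where *: "(g, x) \<in> A" "(g + d i, y) \<in> E i" "(g + d i, p i x \<oplus>\<^bsub>M\<^esub> y) \<in> B"
        unfolding lead_def by blast
      note c = DA(1)[OF *(1)] DE(1)[OF *(2)]
      have eq: "g + d i + \<delta> = g + d (Suc i)" by (simp add: dSuc algebra_simps)
      have "z \<odot>\<^bsub>M\<^esub> (p i x \<oplus>\<^bsub>M\<^esub> y) = p (Suc i) x \<oplus>\<^bsub>M\<^esub> z \<odot>\<^bsub>M\<^esub> y"
        using c pc z by (simp add: pSuc smult_r_distr)
      moreover have "(z, \<delta>) \<in> Z'" by (simp add: Z'_def)
      ultimately have "(g + d (Suc i), p (Suc i) x \<oplus>\<^bsub>M\<^esub> z \<odot>\<^bsub>M\<^esub> y) \<in> B"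
        using graded_submoduleD(5)[OF B, of z \<delta>, OF _ *(3)] unfolding eq by simp
      then show "(g, x) \<in> lead B (Suc i)"
        using *(1) E_oper[OF *(2)] unfolding lead_def eq by blast
    qed
  qed
  show ?thesis
    unfolding graded_noetherian_def Z'_def[symmetric]
  proof clarify
    fix B assume BA: "B \<subseteq> graded_span R M Z' A" and B: "graded_submodule Z' B"
    have leadA: "lead B i \<subseteq> A" for i unfolding lead_def by blast
    note DL = graded_submoduleD[OF lead_sub[OF B]]
    \<comment> \<open>The increasing union of the \<open>lead B i\<close> is itself closed under
      \<open>Z\<close>, hence finitely spanned, and its finitely many generators occur together at
      one stage q. From there on the sequence is constant.\<close>
    have UL: "graded_submodule Z (\<Union>i. lead B i)"
    proof (rule graded_submoduleI)
      fix g x y assume "(g, x) \<in> (\<Union>i. lead B i)" "(g, y) \<in> (\<Union>i. lead B i)"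
      then obtain i j where "(g, x) \<in> lead B i" "(g, y) \<in> lead B j" by blast
      then have "(g, x) \<in> lead B (max i j)" "(g, y) \<in> lead B (max i j)"
        using lead_mono[OF B, of i "max i j"] lead_mono[OF B, of j "max i j"] by auto
      from DL(3)[OF this] show "(g, x \<oplus>\<^bsub>M\<^esub> y) \<in> (\<Union>i. lead B i)" by blast
    next
      fix g x assume "(g, x) \<in> (\<Union>i. lead B i)"
      then show "x \<in> carrier M" using DL(1) by auto
    next
      fix r g x assume r: "r \<in> carrier R" and "(g, x) \<in> (\<Union>i. lead B i)"
      then show "(g, r \<odot>\<^bsub>M\<^esub> x) \<in> (\<Union>i. lead B i)" using DL(4)[OF r] by auto
    next
      fix z' \<delta>' g x assume zz: "(z', \<delta>') \<in> Z" and "(g, x) \<in> (\<Union>i. lead B i)"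
      then show "(g + \<delta>', z' \<odot>\<^bsub>M\<^esub> x) \<in> (\<Union>i. lead B i)" using DL(5)[OF zz] by auto
    qed (use DL(2) in auto)
    from noeth leadA UL obtain S where S: "finite S" "S \<subseteq> (\<Union>i. lead B i)"
        "(\<Union>i. lead B i) \<subseteq> graded_span R M Z S"
      unfolding graded_noetherian_def by (meson UN_least)
    have "\<exists>q. S \<subseteq> lead B q" using S(1,2)
    proof (induction S)
      case (insert s S)
      then obtain q i where "S \<subseteq> lead B q" "s \<in> lead B i" by blast
      then have "insert s S \<subseteq> lead B (max q i)"
        using lead_mono[OF B, of q "max q i"] lead_mono[OF B, of i "max q i"] by auto
      then show ?case by blast
    qed simp
    then obtain q where "S \<subseteq> lead B q" by blast
    from graded_span_least[OF lead_sub[OF B] this] S(3)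
    have q: "lead B i \<subseteq> lead B q" for i by blast
    have "\<exists>S. finite S \<and> S \<subseteq> lead B i \<and> lead B i \<subseteq> graded_span R M Z S" for i
      using noeth leadA[of i] lead_sub[OF B, of i] unfolding graded_noetherian_def by blast
    then obtain S where S: "\<And>i. finite (S i)" "\<And>i. S i \<subseteq> lead B i"
        "\<And>i. lead B i \<subseteq> graded_span R M Z (S i)"
      by metis
    have "\<forall>i. \<forall>s\<in>S i. \<exists>y. (fst s + d i, y) \<in> E i \<and> (fst s + d i, p i (snd s) \<oplus>\<^bsub>M\<^esub> y) \<in> B"
      using S(2) unfolding lead_def by fastforce
    then obtain Y where Y: "\<And>i s. s \<in> S i \<Longrightarrow> (fst s + d i, Y i s) \<in> E i"
        "\<And>i s. s \<in> S i \<Longrightarrow> (fst s + d i, p i (snd s) \<oplus>\<^bsub>M\<^esub> Y i s) \<in> B"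
      by metis
    \<comment> \<open>Lifts to \<open>B\<close> of generators of the leading coefficients; degrees
      beyond q are served by multiplying the elements of degree q by powers of z.\<close>
    define T where "T = (\<Union>i\<le>q. (\<lambda>s. (fst s + d i, p i (snd s) \<oplus>\<^bsub>M\<^esub> Y i s)) ` S i)"
    have finT: "finite T" using S(1) by (simp add: T_def)
    have TB: "T \<subseteq> B" using Y(2) by (auto simp: T_def)
    define B' where "B' = graded_span R M Z' T"
    have B': "graded_submodule Z' B'"
      unfolding B'_def by (rule graded_submodule_span[OF _ Z']) (use TB graded_submoduleD(1)[OF B] in auto)
    have B'B: "B' \<subseteq> B" unfolding B'_def by (rule graded_span_least[OF B TB])
    have lead_le: "lead B i \<subseteq> lead B' i" if "i \<le> q" for i
    proof -
      have "S i \<subseteq> lead B' i"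
      proof
        fix s assume s: "s \<in> S i"
        with that have "(fst s + d i, p i (snd s) \<oplus>\<^bsub>M\<^esub> Y i s) \<in> T" by (auto simp: T_def)
        then have "(fst s + d i, p i (snd s) \<oplus>\<^bsub>M\<^esub> Y i s) \<in> B'"
          unfolding B'_def by (rule graded_span.base)
        moreover have "(fst s, snd s) \<in> A" using s S(2) leadA by auto
        ultimately have "(fst s, snd s) \<in> lead B' i" using Y(1)[OF s] unfolding lead_def by blast
        then show "s \<in> lead B' i" by simp
      qed
      from graded_span_least[OF lead_sub[OF B'] this] S(3)[of i] show ?thesis by blast
    qed
    have lead_all: "lead B i \<subseteq> lead B' i" for i
    proof (cases "i \<le> q")
      case False
      then have "lead B' q \<subseteq> lead B' i" by (intro lead_mono[OF B']) simp
      with q[of i] lead_le[of q] show ?thesis by blast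
    qed (rule lead_le)
    \<comment> \<open>Induction on the degree in z: subtracting an element of \<open>B'\<close> with
      the same leading coefficient leaves an element of \<open>B\<close> in \<open>E i\<close>. By
      \<open>span_E\<close> every element of \<open>B\<close> lies in some
      \<open>E i\<close>.\<close>
    have "B \<inter> E i \<subseteq> B'" for i
    proof (induction i)
      case 0
      show ?case using graded_submoduleD(2)[OF B'] by (auto simp: E0)
    next
      case (Suc i)
      show ?case
      proof clarify
        fix g u assume u: "(g, u) \<in> B" "(g, u) \<in> E (Suc i)"
        then obtain x y where *: "(g - d i, x) \<in> A" "(g, y) \<in> E i" "u = p i x \<oplus>\<^bsub>M\<^esub> y"
          unfolding ESuc by blast
        with u(1) have "(g - d i, x) \<in> lead B i" unfolding lead_def by auto
        with lead_all have "(g - d i, x) \<in> lead B' i" by blast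
        then obtain y' where y': "(g, y') \<in> E i" "(g, p i x \<oplus>\<^bsub>M\<^esub> y') \<in> B'"
          unfolding lead_def by auto
        note c = pc[OF DA(1)[OF *(1)], of i] DE(1)[OF *(2)] DE(1)[OF y'(1)]
        have eq: "u \<ominus>\<^bsub>M\<^esub> (p i x \<oplus>\<^bsub>M\<^esub> y') = y \<ominus>\<^bsub>M\<^esub> y'"
          using c by (simp add: *(3) a_minus_def M.minus_add M.add.m_ac M.r_neg1 M.r_neg2 M.r_neg)
        have "(g, y \<ominus>\<^bsub>M\<^esub> y') \<in> B"
          using graded_submodule_minus[OF B u(1)] y'(2) B'B unfolding eq[symmetric] by blast
        moreover have "(g, y \<ominus>\<^bsub>M\<^esub> y') \<in> E i"
          by (rule graded_submodule_minus[OF E *(2) y'(1)])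
        ultimately have "(g, y \<ominus>\<^bsub>M\<^esub> y') \<in> B'" using Suc by blast
        from graded_submoduleD(3)[OF B' y'(2) this]
        have "(g, (p i x \<oplus>\<^bsub>M\<^esub> y') \<oplus>\<^bsub>M\<^esub> (y \<ominus>\<^bsub>M\<^esub> y')) \<in> B'" .
        moreover have "(p i x \<oplus>\<^bsub>M\<^esub> y') \<oplus>\<^bsub>M\<^esub> (y \<ominus>\<^bsub>M\<^esub> y') = u"
          using c by (simp add: *(3) a_minus_def M.add.m_ac M.r_neg1 M.r_neg2 M.r_neg)
        ultimately show "(g, u) \<in> B'" by simp
      qed
    qed
    with BA span_E have "B \<subseteq> B'" by blast
    with finT TB show "\<exists>S. finite S \<and> S \<subseteq> B \<and> B \<subseteq> graded_span R M Z' S"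
      unfolding B'_def by blast
  qed
qed

text \<open>The operators are adjoined one at a time, starting from finitely many copies of
  \<open>M\<close> placed in the degrees of \<open>G\<close>. In the applications a closed set is
  shown to lie in such a span, and its finitely many generators then yield uniform
  constants.\<close>

theorem graded_hilbert_basis:
  assumes noeth: "noetherian_submodule (carrier M)"
    and G: "finite G" and Z: "finite Z" "fst ` Z \<subseteq> carrier R"
    and B: "graded_submodule Z B" "B \<subseteq> graded_span R M Z (G \<times> carrier M)"
  shows "\<exists>S. finite S \<and> S \<subseteq> B \<and> B \<subseteq> graded_span R M Z S"
proof -
  \<comment> \<open>Zero is added in every degree because a graded submodule contains it in every
    degree.\<close>
  let ?A = "{(g, x). x = \<zero>\<^bsub>M\<^esub> \<or> g \<in> G \<and> x \<in> carrier M}"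
  have A: "snd ` ?A \<subseteq> carrier M" by auto
  have "graded_noetherian Z (graded_span R M Z ?A)" using Z
  proof (induction Z)
    case empty
    have "graded_span R M {} ?A \<subseteq> ?A"
      by (rule graded_span_least) (auto intro!: graded_submoduleI)
    with graded_noetherian_base[OF noeth G] show ?case by (rule graded_noetherian_mono)
  next
    case (insert w Z)
    obtain z \<delta> where w: "w = (z, \<delta>)" by (cases w)
    from insert have Z: "fst ` Z \<subseteq> carrier R" and z: "z \<in> carrier R" by (auto simp: w)
    have "graded_span R M (insert w Z) ?A \<subseteq> graded_span R M (insert w Z) (graded_span R M Z ?A)"
    proof (rule graded_span_least)
      show "graded_submodule (insert w Z) (graded_span R M (insert w Z) (graded_span R M Z ?A))"
      proof (rule graded_submodule_span)
        show "snd ` graded_span R M Z ?A \<subseteq> carrier M"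
          using graded_submodule_span[OF A Z] unfolding graded_submodule_def by blast
      qed (use insert.prems in auto)
    qed (auto intro: graded_span.base)
    with graded_noetherian_insert[OF graded_submodule_span[OF A Z] insert.IH[OF Z] Z z, of \<delta>]
    show ?case unfolding w by (rule graded_noetherian_mono)
  qed
  moreover have "graded_span R M Z (G \<times> carrier M) \<subseteq> graded_span R M Z ?A"
    by (rule graded_span_least[OF graded_submodule_span[OF A Z(2)]]) (auto intro: graded_span.base)
  ultimately show ?thesis using B unfolding graded_noetherian_def by (meson subset_trans)
qed

end

section \<open>Uniform Artin-Rees bounds\<close>

lemma (in ring) ideal_prod_least:
  assumes "ideal K R" "\<And>i j. i \<in> I \<Longrightarrow> j \<in> J \<Longrightarrow> i \<otimes> j \<in> K"
  shows "I \<cdot> J \<subseteq> K"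
proof
  fix s assume "s \<in> I \<cdot> J"
  then show "s \<in> K"
    by induction (use assms in \<open>auto intro: additive_subgroup.a_closed ideal.axioms(1)\<close>)
qed

context module
begin

lemma graded_component_submodule:
  assumes "graded_submodule Z B" shows "submodule {x. (g, x) \<in> B} R M"
  by (rule submoduleI') (auto intro: graded_submoduleD[OF assms])

text \<open>The operators carry only finitely many generators of an ideal. A colon ideal extends
  closure from \<open>W\<close> to \<open>Idl W\<close>, and iteration gives the action of the whole
  u-th power, with u shifts by \<delta>.\<close>

lemma graded_ideal_power_smult:
  assumes B: "graded_submodule Z B" and W: "W \<subseteq> carrier R" "\<And>w. w \<in> W \<Longrightarrow> (w, \<delta>) \<in> Z"
    and x: "(g, x) \<in> B" and r: "r \<in> ideal_power R (Idl W) u"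
  shows "(((+) \<delta> ^^ u) g, r \<odot>\<^bsub>M\<^esub> x) \<in> B"
  using x r
proof (induction u arbitrary: g x r)
  case 0
  then show ?case using graded_submoduleD(4)[OF B] by (simp add: ideal_power_0)
next
  case (Suc u)
  note D = graded_submoduleD[OF B]
  note colon = colon_ideal[OF graded_component_submodule[OF B]]
  have x: "x \<in> carrier M" by (rule D(1)[OF Suc.prems(1)])
  have I: "ideal (Idl W) R" by (rule genideal_ideal[OF W(1)])
  have "W \<subseteq> {j \<in> carrier R. j \<odot>\<^bsub>M\<^esub> x \<in> {y. (g + \<delta>, y) \<in> B}}"
    using D(5)[OF W(2) Suc.prems(1)] W(1) by auto
  from genideal_minimal[OF colon[OF x] this]
  have j: "(\<delta> + g, j \<odot>\<^bsub>M\<^esub> x) \<in> B" if "j \<in> Idl W" for j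
    using that by (auto simp: add.commute)
  have "ideal_power R (Idl W) u \<cdot> (Idl W)
    \<subseteq> {r \<in> carrier R. r \<odot>\<^bsub>M\<^esub> x \<in> {y. (((+) \<delta> ^^ Suc u) g, y) \<in> B}}"
  proof (rule ideal_prod_least[OF colon[OF x]])
    fix i k assume i: "i \<in> ideal_power R (Idl W) u" and k: "k \<in> Idl W"
    have c: "i \<in> carrier R" "k \<in> carrier R"
      using i k ideal.Icarr[OF I] ideal.Icarr[OF ideal_power_ideal[OF I]] by auto
    have "(((+) \<delta> ^^ u) (\<delta> + g), i \<odot>\<^bsub>M\<^esub> (k \<odot>\<^bsub>M\<^esub> x)) \<in> B"
      by (rule Suc.IH[OF j[OF k] i])
    then show "i \<otimes> k \<in> {r \<in> carrier R. r \<odot>\<^bsub>M\<^esub> x \<in> {y. (((+) \<delta> ^^ Suc u) g, y) \<in> B}}"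
      using c x by (simp add: smult_assoc1 funpow_swap1)
  qed
  with Suc.prems(2) show ?case by (auto simp: ideal_power_Suc)
qed

text \<open>The graded set with N \<inter> m^n M in degree n is finitely spanned. If its generators
  have degree at most c, every element in degree n arises from elements of N by at least n - c
  multiplications from \<open>m\<close>.\<close>

lemma artin_rees:
  assumes noeth: "noetherian_ring R" and fg: "finitely_generated R M"
    and m: "ideal m R" and N: "submodule N R M"
  shows "\<exists>c. \<forall>n. N \<inter> ideal_smult R M (ideal_power R m n) (carrier M)
    \<subseteq> ideal_smult R M (ideal_power R m (n - c)) N"
proof -
  note noethM = noetherian_submodule_carrier[OF noeth fg]
  obtain W where W: "W \<subseteq> carrier R" "finite W" "m = Idl W"
    using noetherian_ring.finetely_gen[OF noeth m] by blast
  have Wm: "w \<in> m" if "w \<in> W" for w using genideal_self[OF W(1)] that W(3) by blast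
  let ?P = "\<lambda>n N. ideal_smult R M (ideal_power R m n) N"
  have P: "submodule (?P n N) R M" if "N \<subseteq> carrier M" for n N
    by (rule ideal_power_smult_submodule[OF m that])
  have Nc: "N \<subseteq> carrier M" using submoduleE(1)[OF N] .
  have P1: "z \<odot>\<^bsub>M\<^esub> x \<in> ?P (Suc n) N" if "z \<in> m" "x \<in> ?P n N" "N \<subseteq> carrier M" for z x n N
    using ideal_power_smult_mult[OF m that(3), of z 1 x n] that(1,2) by (simp add: ideal_power_1[OF m] del: One_nat_def flip: plus_1_eq_Suc)
  define Z where "Z = (\<lambda>w. (w, 1::int)) ` W"
  have Z: "finite Z" "fst ` Z \<subseteq> carrier R" using W by (auto simp: Z_def)
  \<comment> \<open>Degrees are integers because the grading needs a group; negative degrees contain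
    only zero.\<close>
  define B where "B = {(g, x). x = \<zero>\<^bsub>M\<^esub> \<or> (\<exists>n. g = int n \<and> x \<in> N \<and> x \<in> ?P n (carrier M))}"
  have B: "graded_submodule Z B"
  proof (rule graded_submoduleI)
    fix g x assume "(g, x) \<in> B" then show "x \<in> carrier M" using Nc by (auto simp: B_def)
  next
    fix g x y assume xy: "(g, x) \<in> B" "(g, y) \<in> B"
    consider "x = \<zero>\<^bsub>M\<^esub>" | "y = \<zero>\<^bsub>M\<^esub>"
      | n where "g = int n" "x \<in> N" "x \<in> ?P n (carrier M)" "y \<in> N" "y \<in> ?P n (carrier M)"
      using xy by (auto simp: B_def)
    then show "(g, x \<oplus>\<^bsub>M\<^esub> y) \<in> B"
    proof cases
      case 3
      then show ?thesis using submoduleE(5)[OF N] submoduleE(5)[OF P[of "carrier M" n]] by (auto simp: B_def)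
    qed (use xy Nc in \<open>auto simp: B_def\<close>)
  next
    fix r g x assume "r \<in> carrier R" "(g, x) \<in> B"
    then show "(g, r \<odot>\<^bsub>M\<^esub> x) \<in> B"
      using submoduleE(4)[OF N] submoduleE(4)[OF P[of "carrier M"]] by (auto simp: B_def)
  next
    fix z \<delta> g x assume z: "(z, \<delta>) \<in> Z" and x: "(g, x) \<in> B"
    from z have z': "\<delta> = 1" "z \<in> m" "z \<in> carrier R" using Wm W(1) by (auto simp: Z_def)
    show "(g + \<delta>, z \<odot>\<^bsub>M\<^esub> x) \<in> B"
    proof (cases "x = \<zero>\<^bsub>M\<^esub>")
      case True
      then show ?thesis using z' by (simp add: B_def)
    next
      case False
      with x obtain n where n: "g = int n" "x \<in> N" "x \<in> ?P n (carrier M)" by (auto simp: B_def)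
      have "g + \<delta> = int (Suc n)" by (simp add: n z')
      moreover have "z \<odot>\<^bsub>M\<^esub> x \<in> N" by (rule submoduleE(4)[OF N z'(3) n(2)])
      moreover have "z \<odot>\<^bsub>M\<^esub> x \<in> ?P (Suc n) (carrier M)" by (rule P1[OF z'(2) n(3)]) simp
      ultimately show ?thesis unfolding B_def by blast
    qed
  qed (simp add: B_def)
  have shift: "((+) (1::int) ^^ u) g = g + int u" for u g by (induction u) auto
  let ?S = "graded_span R M Z ({0} \<times> carrier M)"
  have span: "graded_submodule Z ?S" by (rule graded_submodule_span[OF _ Z(2)]) auto
  have "B \<subseteq> ?S"
  proof clarify
    fix g x assume x: "(g, x) \<in> B"
    show "(g, x) \<in> ?S"
    proof (cases "x = \<zero>\<^bsub>M\<^esub>")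
      case True
      then show ?thesis by (simp add: graded_span.zero)
    next
      case False
      with x obtain n where n: "g = int n" "x \<in> ?P n (carrier M)" by (auto simp: B_def)
      have "?P n (carrier M) \<subseteq> {x. (int n, x) \<in> ?S}"
      proof (rule ideal_smult_least[OF graded_component_submodule[OF span]])
        fix r y assume r: "r \<in> ideal_power R m n" and y: "y \<in> carrier M"
        have "(0, y) \<in> ?S" using y by (auto intro: graded_span.base)
        from graded_ideal_power_smult[OF span W(1) _ this r[unfolded W(3)], of 1]
        show "r \<odot>\<^bsub>M\<^esub> y \<in> {x. (int n, x) \<in> ?S}" by (simp add: Z_def shift)
      qed
      with n show ?thesis by blast
    qed
  qed
  from graded_hilbert_basis[OF noethM _ Z B this] obtain T where
    T: "finite T" "T \<subseteq> B" "B \<subseteq> graded_span R M Z T" by auto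
  define c where "c = Max ((\<lambda>t. nat (fst t)) ` T)"
  have c: "nat (fst t) \<le> c" if "t \<in> T" for t
    unfolding c_def using T(1) that by (intro Max_ge) auto
  \<comment> \<open>Truncated subtraction makes the component in degree n equal to N for n at most
    c, which is why the generators lie in it.\<close>
  let ?B' = "{(g, x). x = \<zero>\<^bsub>M\<^esub> \<or> (\<exists>n. g = int n \<and> x \<in> ?P (n - c) N)}"
  have "graded_submodule Z ?B'"
  proof (rule graded_submoduleI)
    fix g x assume "(g, x) \<in> ?B'" then show "x \<in> carrier M" using submodule_carrier[OF P[OF Nc]] by auto
  next
    fix g x y assume xy: "(g, x) \<in> ?B'" "(g, y) \<in> ?B'"
    then show "(g, x \<oplus>\<^bsub>M\<^esub> y) \<in> ?B'"
      using submoduleE(5)[OF P[OF Nc]] submodule_carrier[OF P[OF Nc]] by auto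
  next
    fix r g x assume "r \<in> carrier R" "(g, x) \<in> ?B'"
    then show "(g, r \<odot>\<^bsub>M\<^esub> x) \<in> ?B'"
      using submoduleE(4)[OF P[OF Nc]] by auto
  next
    fix z \<delta> g x assume z: "(z, \<delta>) \<in> Z" and x: "(g, x) \<in> ?B'"
    from z have z': "\<delta> = 1" "z \<in> m" "z \<in> carrier R" using Wm W(1) by (auto simp: Z_def)
    show "(g + \<delta>, z \<odot>\<^bsub>M\<^esub> x) \<in> ?B'"
    proof (cases "x = \<zero>\<^bsub>M\<^esub>")
      case True
      then show ?thesis using z' by simp
    next
      case False
      with x obtain n where n: "g = int n" "x \<in> ?P (n - c) N" by auto
      have "g + \<delta> = int (Suc n)" by (simp add: n z')
      moreover have "z \<odot>\<^bsub>M\<^esub> x \<in> ?P (Suc (n - c)) N" by (rule P1[OF z'(2) n(2) Nc])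
      moreover have "?P (Suc (n - c)) N \<subseteq> ?P (Suc n - c) N"
        by (rule ideal_power_smult_antimono[OF m Nc]) simp
      ultimately show ?thesis by blast
    qed
  qed simp
  moreover have "T \<subseteq> ?B'"
  proof clarify
    fix g x assume t: "(g, x) \<in> T" and "\<not> (\<exists>n. g = int n \<and> x \<in> ?P (n - c) N)"
    moreover from t T(2) have "x = \<zero>\<^bsub>M\<^esub> \<or> (\<exists>n. g = int n \<and> x \<in> N)" by (auto simp: B_def)
    moreover have "?P (n - c) N = N" if "g = int n" for n
      using c[OF t] that ideal_power_0_smult[OF N, of m] by simp
    ultimately show "x = \<zero>\<^bsub>M\<^esub>" by auto
  qed
  ultimately have sub: "B \<subseteq> ?B'" using graded_span_least T(3) by blast
  have "N \<inter> ?P n (carrier M) \<subseteq> ?P (n - c) N" for n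
  proof
    fix x assume "x \<in> N \<inter> ?P n (carrier M)"
    then have "(int n, x) \<in> B" by (auto simp: B_def)
    with sub have "x = \<zero>\<^bsub>M\<^esub> \<or> x \<in> ?P (n - c) N" by auto
    then show "x \<in> ?P (n - c) N" using submodule_zero[OF P[OF Nc]] by auto
  qed
  then show ?thesis by blast
qed


text \<open>Operators from \<open>m\<close> raise the first degree a, operators from
  \<open>I\<close> the second degree i. The finitely many generators have a common bound c on the
  first degree and a common exponent k carrying them into the next member of the filtration; the
  property recorded in \<open>Q\<close> with e = c + k holds for them and survives both kinds of
  operators.\<close>

lemma filtration_artin_rees:
  assumes noeth: "noetherian_ring R" and fg: "finitely_generated R M"
    and m: "ideal m R" and I: "ideal I R"
    and F: "\<And>i. submodule (F i) R M"
    and IF: "\<And>i. ideal_smult R M I (F i) \<subseteq> F (Suc i)"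
    and F_le: "\<And>i. F i \<subseteq> ideal_smult R M (ideal_power R I (i - n0)) (carrier M)"
  shows "\<exists>e. \<forall>a i x k. a \<ge> e \<longrightarrow> x \<in> ideal_smult R M (ideal_power R m a) (F i)
    \<longrightarrow> (\<forall>r \<in> ideal_power R m k. r \<odot>\<^bsub>M\<^esub> x \<in> F (Suc i))
    \<longrightarrow> x \<in> ideal_smult R M (ideal_power R m (a - e)) (F (Suc i))"
proof -
  note noethM = noetherian_submodule_carrier[OF noeth fg]
  obtain W where W: "W \<subseteq> carrier R" "finite W" "m = Idl W"
    using noetherian_ring.finetely_gen[OF noeth m] by blast
  obtain V where V: "V \<subseteq> carrier R" "finite V" "I = Idl V"
    using noetherian_ring.finetely_gen[OF noeth I] by blast
  have Wm: "w \<in> m" if "w \<in> W" for w using genideal_self[OF W(1)] that W(3) by blast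
  have VI: "v \<in> I" if "v \<in> V" for v using genideal_self[OF V(1)] that V(3) by blast
  have pc: "r \<in> carrier R" if "r \<in> ideal_power R m k" for r k
    using ideal_power_subset_carrier[OF m] that by blast
  note Fc = submodule_carrier[OF F]
  have Fcar: "F i \<subseteq> carrier M" for i using submoduleE(1)[OF F] .
  have Fmult: "z \<odot>\<^bsub>M\<^esub> x \<in> F (Suc i)" if "z \<in> I" "x \<in> F i" for z x i
    using IF ideal_smultI[OF that] by blast
  define P where "P n i = ideal_smult R M (ideal_power R m n) (F i)" for n i
  have P: "submodule (P n i) R M" for n i
    unfolding P_def by (rule ideal_power_smult_submodule[OF m Fcar])
  have P1: "z \<odot>\<^bsub>M\<^esub> x \<in> P (Suc n) i" if "z \<in> m" "x \<in> P n i" for z x n i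
    using ideal_power_smult_mult[OF m Fcar, of z 1 x n] that
    by (simp add: P_def ideal_power_1[OF m] del: One_nat_def flip: plus_1_eq_Suc)
  have P_mono: "P b i \<subseteq> P a i" if "a \<le> b" for a b i
    unfolding P_def by (rule ideal_power_smult_antimono[OF m Fcar that])
  have PI: "z \<odot>\<^bsub>M\<^esub> x \<in> P n (Suc i)" if z: "z \<in> I" and x: "x \<in> P n i" for z x n i
  proof -
    have zc: "z \<in> carrier R" using ideal.Icarr[OF I z] .
    have "P n i \<subseteq> {x \<in> carrier M. z \<odot>\<^bsub>M\<^esub> x \<in> P n (Suc i)}"
      unfolding P_def[of n i]
    proof (rule ideal_smult_least[OF submodule_smult_vimage[OF P zc]])
      fix r y assume r: "r \<in> ideal_power R m n" and y: "y \<in> F i"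
      have "r \<odot>\<^bsub>M\<^esub> (z \<odot>\<^bsub>M\<^esub> y) \<in> P n (Suc i)"
        unfolding P_def by (rule ideal_smultI[OF r Fmult[OF z y]])
      moreover have "r \<odot>\<^bsub>M\<^esub> (z \<odot>\<^bsub>M\<^esub> y) = z \<odot>\<^bsub>M\<^esub> (r \<odot>\<^bsub>M\<^esub> y)"
        using pc[OF r] zc Fc[OF y] by (simp flip: smult_assoc1 add: R.m_comm)
      ultimately show "r \<odot>\<^bsub>M\<^esub> y \<in> {x \<in> carrier M. z \<odot>\<^bsub>M\<^esub> x \<in> P n (Suc i)}"
        using pc[OF r] Fc[OF y] by simp
    qed
    with x show ?thesis by blast
  qed
  define K where "K i = {x \<in> F i. \<exists>k. \<forall>r \<in> ideal_power R m k. r \<odot>\<^bsub>M\<^esub> x \<in> F (Suc i)}" for i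
  have K: "submodule (K i) R M" for i
  proof (rule submoduleI')
    show "K i \<subseteq> carrier M" using Fcar by (auto simp: K_def)
    show "\<zero>\<^bsub>M\<^esub> \<in> K i"
      using submodule_zero[OF F] pc by (auto simp: K_def)
  next
    fix x y assume "x \<in> K i" "y \<in> K i"
    then obtain k l where *: "x \<in> F i" "\<forall>r \<in> ideal_power R m k. r \<odot>\<^bsub>M\<^esub> x \<in> F (Suc i)"
      "y \<in> F i" "\<forall>r \<in> ideal_power R m l. r \<odot>\<^bsub>M\<^esub> y \<in> F (Suc i)" by (auto simp: K_def)
    have "r \<odot>\<^bsub>M\<^esub> (x \<oplus>\<^bsub>M\<^esub> y) \<in> F (Suc i)" if r: "r \<in> ideal_power R m (max k l)" for r
    proof -
      have "r \<in> ideal_power R m k" "r \<in> ideal_power R m l"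
        using r ideal_power_antimono[OF m, of k "max k l"] ideal_power_antimono[OF m, of l "max k l"] by auto
      with * submoduleE(5)[OF F, of "r \<odot>\<^bsub>M\<^esub> x" "Suc i" "r \<odot>\<^bsub>M\<^esub> y"] pc[OF r] Fc[OF *(1)] Fc[OF *(3)]
      show ?thesis by (simp add: smult_r_distr)
    qed
    then show "x \<oplus>\<^bsub>M\<^esub> y \<in> K i" using submoduleE(5)[OF F *(1,3)] by (auto simp: K_def)
  next
    fix s x assume s: "s \<in> carrier R" and "x \<in> K i"
    then obtain k where *: "x \<in> F i" "\<forall>r \<in> ideal_power R m k. r \<odot>\<^bsub>M\<^esub> x \<in> F (Suc i)"
      by (auto simp: K_def)
    have "r \<odot>\<^bsub>M\<^esub> (s \<odot>\<^bsub>M\<^esub> x) \<in> F (Suc i)" if r: "r \<in> ideal_power R m k" for r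
    proof -
      have "r \<odot>\<^bsub>M\<^esub> (s \<odot>\<^bsub>M\<^esub> x) = s \<odot>\<^bsub>M\<^esub> (r \<odot>\<^bsub>M\<^esub> x)"
        using pc[OF r] s Fc[OF *(1)] by (simp flip: smult_assoc1 add: R.m_comm)
      with * r s submoduleE(4)[OF F s] show ?thesis by simp
    qed
    then show "s \<odot>\<^bsub>M\<^esub> x \<in> K i" using submoduleE(4)[OF F s *(1)] by (auto simp: K_def)
  qed
  have KI: "z \<odot>\<^bsub>M\<^esub> x \<in> K (Suc i)" if z: "z \<in> I" and "x \<in> K i" for z x i
  proof -
    from that obtain k where *: "x \<in> F i" "\<forall>r \<in> ideal_power R m k. r \<odot>\<^bsub>M\<^esub> x \<in> F (Suc i)"
      by (auto simp: K_def)
    have "r \<odot>\<^bsub>M\<^esub> (z \<odot>\<^bsub>M\<^esub> x) \<in> F (Suc (Suc i))" if r: "r \<in> ideal_power R m k" for r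
    proof -
      have "r \<odot>\<^bsub>M\<^esub> (z \<odot>\<^bsub>M\<^esub> x) = z \<odot>\<^bsub>M\<^esub> (r \<odot>\<^bsub>M\<^esub> x)"
        using pc[OF r] ideal.Icarr[OF I z] Fc[OF *(1)] by (simp flip: smult_assoc1 add: R.m_comm)
      with * r Fmult[OF z] show ?thesis by simp
    qed
    then show ?thesis using Fmult[OF z *(1)] by (auto simp: K_def)
  qed
  define Z where "Z = (\<lambda>w. (w, (1::int, 0::int))) ` W \<union> (\<lambda>v. (v, (0, 1))) ` V"
  have Z: "finite Z" "fst ` Z \<subseteq> carrier R" using W V by (auto simp: Z_def)
  have Zcases: "(z \<in> m \<and> \<delta> = (1, 0) \<or> z \<in> I \<and> \<delta> = (0, 1)) \<and> z \<in> carrier R" if "(z, \<delta>) \<in> Z" for z \<delta>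
    using that Wm VI W(1) V(1) by (auto simp: Z_def)
  define B where "B = {(g, x). x = \<zero>\<^bsub>M\<^esub> \<or> (\<exists>a i. g = (int a, int i) \<and> x \<in> K i \<and> x \<in> P a i)}"
  have B: "graded_submodule Z B"
  proof (rule graded_submoduleI)
    fix g x assume "(g, x) \<in> B" then show "x \<in> carrier M"
      using submodule_carrier[OF K] by (auto simp: B_def)
  next
    fix g x y assume xy: "(g, x) \<in> B" "(g, y) \<in> B"
    consider "x = \<zero>\<^bsub>M\<^esub>" | "y = \<zero>\<^bsub>M\<^esub>"
      | a i where "g = (int a, int i)" "x \<in> K i" "x \<in> P a i" "y \<in> K i" "y \<in> P a i"
      using xy by (auto simp: B_def)
    then show "(g, x \<oplus>\<^bsub>M\<^esub> y) \<in> B"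
    proof cases
      case 3
      then show ?thesis using submoduleE(5)[OF K] submoduleE(5)[OF P] by (auto simp: B_def)
    qed (use xy submodule_carrier[OF K] in \<open>auto simp: B_def\<close>)
  next
    fix r g x assume "r \<in> carrier R" "(g, x) \<in> B"
    then show "(g, r \<odot>\<^bsub>M\<^esub> x) \<in> B"
      using submoduleE(4)[OF K] submoduleE(4)[OF P] by (auto simp: B_def)
  next
    fix z \<delta> g x assume z: "(z, \<delta>) \<in> Z" and x: "(g, x) \<in> B"
    show "(g + \<delta>, z \<odot>\<^bsub>M\<^esub> x) \<in> B"
    proof (cases "x = \<zero>\<^bsub>M\<^esub>")
      case True
      then show ?thesis using Zcases[OF z] by (simp add: B_def)
    next
      case False
      with x obtain a i where n: "g = (int a, int i)" "x \<in> K i" "x \<in> P a i" by (auto simp: B_def)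
      from Zcases[OF z] consider "z \<in> m" "\<delta> = (1, 0)" | "z \<in> I" "\<delta> = (0, 1)" by blast
      then show ?thesis
      proof cases
        case 1
        have "g + \<delta> = (int (Suc a), int i)" by (simp add: n 1)
        moreover have "z \<odot>\<^bsub>M\<^esub> x \<in> K i" using submoduleE(4)[OF K _ n(2)] Zcases[OF z] by blast
        ultimately show ?thesis using P1[OF 1(1) n(3)] unfolding B_def by blast
      next
        case 2
        have "g + \<delta> = (int a, int (Suc i))" by (simp add: n 2)
        then show ?thesis using KI[OF 2(1) n(2)] PI[OF 2(1) n(3)] unfolding B_def by blast
      qed
    qed
  qed (simp add: B_def)
  have shift1: "((+) (1::int, 0::int) ^^ u) (g, h) = (g + int u, h)" for u g h by (induction u) auto
  have shift2: "((+) (0::int, 1::int) ^^ u) (g, h) = (g, h + int u)" for u g h by (induction u) auto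
  \<comment> \<open>Second degrees up to n0 suffice: F_i lies in I^(i-n0) M, which is reached from
    the copy of \<open>M\<close> in degree (0, min i n0) by i - n0 operators from
    \<open>I\<close>.\<close>
  define G where "G = (\<lambda>j. (0::int, int j)) ` {..n0}"
  let ?S = "graded_span R M Z (G \<times> carrier M)"
  have span: "graded_submodule Z ?S" by (rule graded_submodule_span[OF _ Z(2)]) auto
  have F_S: "((0, int i), x) \<in> ?S" if x: "x \<in> F i" for x i
  proof -
    have "ideal_smult R M (ideal_power R I (i - n0)) (carrier M) \<subseteq> {x. ((0, int i), x) \<in> ?S}"
    proof (rule ideal_smult_least[OF graded_component_submodule[OF span]])
      fix r y assume r: "r \<in> ideal_power R I (i - n0)" and y: "y \<in> carrier M"
      have "((0, int (min i n0)), y) \<in> ?S" using y by (auto simp: G_def intro: graded_span.base)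
      from graded_ideal_power_smult[OF span V(1) _ this r[unfolded V(3)], of "(0, 1)"]
      show "r \<odot>\<^bsub>M\<^esub> y \<in> {x. ((0, int i), x) \<in> ?S}" by (simp add: Z_def shift2 min_def split: if_splits)
    qed
    with F_le x show ?thesis by blast
  qed
  have "B \<subseteq> ?S"
  proof clarify
    fix g h x assume x: "((g, h), x) \<in> B"
    show "((g, h), x) \<in> ?S"
    proof (cases "x = \<zero>\<^bsub>M\<^esub>")
      case True
      then show ?thesis by (simp add: graded_span.zero)
    next
      case False
      with x obtain a i where n: "g = int a" "h = int i" "x \<in> P a i" by (auto simp: B_def)
      have "P a i \<subseteq> {x. ((int a, int i), x) \<in> ?S}"
        unfolding P_def
      proof (rule ideal_smult_least[OF graded_component_submodule[OF span]])
        fix r y assume r: "r \<in> ideal_power R m a" and y: "y \<in> F i"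
        from graded_ideal_power_smult[OF span W(1) _ F_S[OF y] r[unfolded W(3)], of "(1, 0)"]
        show "r \<odot>\<^bsub>M\<^esub> y \<in> {x. ((int a, int i), x) \<in> ?S}" by (simp add: Z_def shift1)
      qed
      with n show ?thesis by blast
    qed
  qed
  moreover have "finite G" by (simp add: G_def)
  ultimately obtain T where T: "finite T" "T \<subseteq> B" "B \<subseteq> graded_span R M Z T"
    using graded_hilbert_basis[OF noethM _ Z B] by meson
  define c where "c = Max ((\<lambda>t. nat (fst (fst t))) ` T)"
  have c: "nat (fst (fst t)) \<le> c" if "t \<in> T" for t
    unfolding c_def using T(1) that by (intro Max_ge) auto
  \<comment> \<open>The degree determines i, so an exponent witnessing membership in
    \<open>K i\<close> serves; for the zero element, present in every degree, any exponent
    does.\<close>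
  have "\<exists>k. \<forall>i. (\<exists>a. fst t = (int a, int i)) \<longrightarrow> (\<forall>r \<in> ideal_power R m k. r \<odot>\<^bsub>M\<^esub> snd t \<in> F (Suc i))"
    if "t \<in> T" for t
  proof -
    obtain g x where t: "t = (g, x)" by (cases t)
    with that T(2) have "x = \<zero>\<^bsub>M\<^esub> \<or> (\<exists>a i. g = (int a, int i) \<and> x \<in> K i)" by (auto simp: B_def)
    then show ?thesis
    proof
      assume "x = \<zero>\<^bsub>M\<^esub>"
      then show ?thesis using submodule_zero[OF F] pc by (auto simp: t)
    next
      assume "\<exists>a i. g = (int a, int i) \<and> x \<in> K i"
      then obtain a i k where "g = (int a, int i)" "\<forall>r \<in> ideal_power R m k. r \<odot>\<^bsub>M\<^esub> x \<in> F (Suc i)"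
        by (auto simp: K_def)
      then show ?thesis by (intro exI[of _ k]) (auto simp: t)
    qed
  qed
  then obtain kk where kk: "\<And>t i a r. t \<in> T \<Longrightarrow> fst t = (int a, int i) \<Longrightarrow> r \<in> ideal_power R m (kk t)
      \<Longrightarrow> r \<odot>\<^bsub>M\<^esub> snd t \<in> F (Suc i)"
    by metis
  define k where "k = Max (kk ` T)"
  have k: "kk t \<le> k" if "t \<in> T" for t
    unfolding k_def using T(1) that by (intro Max_ge) auto
  \<comment> \<open>c pays for the first degree of a generator, k for carrying it into
    F_(i+1).\<close>
  define e where "e = c + k"
  \<comment> \<open>The wanted conclusion is the case u = 0, r = 1. General u makes the property
    inductive: an operator z from \<open>m\<close> raises a by one and turns r in m^u into r z in
    m^(u+1). The guard e \<le> u + a keeps the subtraction from being truncated.\<close>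
  define Q where "Q a i = {x \<in> carrier M. \<forall>u r. r \<in> ideal_power R m u \<longrightarrow> e \<le> u + a
    \<longrightarrow> r \<odot>\<^bsub>M\<^esub> x \<in> P (u + a - e) (Suc i)}" for a i
  have Q: "submodule (Q a i) R M" for a i
  proof (rule submoduleI')
    fix x y assume "x \<in> Q a i" "y \<in> Q a i"
    then show "x \<oplus>\<^bsub>M\<^esub> y \<in> Q a i"
      using submoduleE(5)[OF P] pc by (auto simp: Q_def smult_r_distr)
  next
    fix s x assume s: "s \<in> carrier R" and x: "x \<in> Q a i"
    have "r \<odot>\<^bsub>M\<^esub> (s \<odot>\<^bsub>M\<^esub> x) = s \<odot>\<^bsub>M\<^esub> (r \<odot>\<^bsub>M\<^esub> x)" if "r \<in> ideal_power R m u" for r u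
      using pc[OF that] s x by (simp flip: smult_assoc1 add: R.m_comm Q_def)
    with s x submoduleE(4)[OF P s] show "s \<odot>\<^bsub>M\<^esub> x \<in> Q a i" by (auto simp: Q_def)
  qed (use submodule_zero[OF P] pc in \<open>auto simp: Q_def\<close>)
  let ?B' = "{(g, x). x = \<zero>\<^bsub>M\<^esub> \<or> (\<exists>a i. g = (int a, int i) \<and> x \<in> Q a i)}"
  have "graded_submodule Z ?B'"
  proof (rule graded_submoduleI)
    fix g x assume "(g, x) \<in> ?B'" then show "x \<in> carrier M" using submodule_carrier[OF Q] by auto
  next
    fix g x y assume xy: "(g, x) \<in> ?B'" "(g, y) \<in> ?B'"
    then show "(g, x \<oplus>\<^bsub>M\<^esub> y) \<in> ?B'"
      using submoduleE(5)[OF Q] submodule_carrier[OF Q] by auto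
  next
    fix r g x assume "r \<in> carrier R" "(g, x) \<in> ?B'"
    then show "(g, r \<odot>\<^bsub>M\<^esub> x) \<in> ?B'"
      using submoduleE(4)[OF Q] by auto
  next
    fix z \<delta> g x assume z: "(z, \<delta>) \<in> Z" and x: "(g, x) \<in> ?B'"
    show "(g + \<delta>, z \<odot>\<^bsub>M\<^esub> x) \<in> ?B'"
    proof (cases "x = \<zero>\<^bsub>M\<^esub>")
      case True
      then show ?thesis using Zcases[OF z] by simp
    next
      case False
      with x obtain a i where n: "g = (int a, int i)" "x \<in> Q a i" by auto
      have xc: "x \<in> carrier M" using n(2) by (simp add: Q_def)
      from Zcases[OF z] consider "z \<in> m" "\<delta> = (1, 0)" "z \<in> carrier R"
        | "z \<in> I" "\<delta> = (0, 1)" "z \<in> carrier R" by blast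
      then show ?thesis
      proof cases
        case 1
        have "z \<odot>\<^bsub>M\<^esub> x \<in> Q (Suc a) i"
          unfolding Q_def
        proof (intro CollectI conjI allI impI)
          fix u r assume r: "r \<in> ideal_power R m u" and u: "e \<le> u + Suc a"
          have "r \<otimes> z \<in> ideal_power R m (Suc u)"
            using r 1(1) by (simp add: ideal_power_Suc ideal_prod.prod)
          moreover have "e \<le> Suc u + a" using u by simp
          ultimately have "(r \<otimes> z) \<odot>\<^bsub>M\<^esub> x \<in> P (Suc u + a - e) (Suc i)"
            using n(2) unfolding Q_def by blast
          then show "r \<odot>\<^bsub>M\<^esub> (z \<odot>\<^bsub>M\<^esub> x) \<in> P (u + Suc a - e) (Suc i)"
            using pc[OF r] 1(3) xc by (simp add: smult_assoc1)
        qed (use 1(3) xc in simp)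
        moreover have "g + \<delta> = (int (Suc a), int i)" by (simp add: n 1)
        ultimately show ?thesis by blast
      next
        case 2
        have "z \<odot>\<^bsub>M\<^esub> x \<in> Q a (Suc i)"
          unfolding Q_def
        proof (intro CollectI conjI allI impI)
          fix u r assume r: "r \<in> ideal_power R m u" and u: "e \<le> u + a"
          have "r \<odot>\<^bsub>M\<^esub> (z \<odot>\<^bsub>M\<^esub> x) = z \<odot>\<^bsub>M\<^esub> (r \<odot>\<^bsub>M\<^esub> x)"
            using pc[OF r] 2(3) xc by (simp flip: smult_assoc1 add: R.m_comm)
          with n(2) r u PI[OF 2(1)] show "r \<odot>\<^bsub>M\<^esub> (z \<odot>\<^bsub>M\<^esub> x) \<in> P (u + a - e) (Suc (Suc i))"
            unfolding Q_def by auto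
        qed (use 2(3) xc in simp)
        moreover have "g + \<delta> = (int a, int (Suc i))" by (simp add: n 2)
        ultimately show ?thesis by blast
      qed
    qed
  qed simp
  moreover have "T \<subseteq> ?B'"
  proof clarify
    fix g h x assume t: "((g, h), x) \<in> T" and "\<not> (\<exists>a i. (g, h) = (int a, int i) \<and> x \<in> Q a i)"
    moreover have "x \<in> Q a i" if gh: "(g, h) = (int a, int i)" for a i
      unfolding Q_def
    proof (intro CollectI conjI allI impI)
      show xc: "x \<in> carrier M" using t T(2) graded_submoduleD(1)[OF B] by blast
      fix u r assume r: "r \<in> ideal_power R m u" and u: "e \<le> u + a"
      have a: "a \<le> c" using c[OF t] gh by simp
      \<comment> \<open>Here k \<le> u, since e \<le> u + a and a \<le> c. The factor m^k carries x
        into F_(i+1), and a \<le> c gives u + a - e \<le> u - k for the remaining factor.\<close>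
      have "r \<in> ideal_power R m ((u - k) + k)" using r u a by (simp add: e_def)
      then have r: "r \<in> ideal_power R m (u - k) \<cdot> ideal_power R m k"
        by (simp only: ideal_power_add[OF m])
      have "ideal_power R m (u - k) \<cdot> ideal_power R m k
        \<subseteq> {r \<in> carrier R. r \<odot>\<^bsub>M\<^esub> x \<in> P (u - k) (Suc i)}"
      proof (rule ideal_prod_least[OF colon_ideal[OF P xc]])
        fix r s assume r: "r \<in> ideal_power R m (u - k)" and s: "s \<in> ideal_power R m k"
        have "s \<in> ideal_power R m (kk ((g, h), x))"
          using s ideal_power_antimono[OF m k[OF t]] by blast
        with kk[OF t] gh have "s \<odot>\<^bsub>M\<^esub> x \<in> F (Suc i)" by auto
        then have "r \<odot>\<^bsub>M\<^esub> (s \<odot>\<^bsub>M\<^esub> x) \<in> P (u - k) (Suc i)"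
          unfolding P_def by (rule ideal_smultI[OF r])
        then show "r \<otimes> s \<in> {r \<in> carrier R. r \<odot>\<^bsub>M\<^esub> x \<in> P (u - k) (Suc i)}"
          using pc[OF r] pc[OF s] xc by (simp add: smult_assoc1)
      qed
      with r have "r \<odot>\<^bsub>M\<^esub> x \<in> P (u - k) (Suc i)" by blast
      moreover have "u + a - e \<le> u - k" using a unfolding e_def by arith
      ultimately show "r \<odot>\<^bsub>M\<^esub> x \<in> P (u + a - e) (Suc i)" using P_mono by blast
    qed
    ultimately show "x = \<zero>\<^bsub>M\<^esub>" using t T(2) by (auto simp: B_def)
  qed
  ultimately have sub: "B \<subseteq> ?B'" using graded_span_least T(3) by blast
  have "x \<in> P (a - e) (Suc i)"
    if a: "e \<le> a" and x: "x \<in> P a i" and kx: "\<forall>r \<in> ideal_power R m k. r \<odot>\<^bsub>M\<^esub> x \<in> F (Suc i)"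
    for a i x k
  proof -
    have "P a i \<subseteq> F i"
      unfolding P_def by (rule ideal_smult_subset[OF ideal_power_subset_carrier[OF m] F])
    with x kx have "x \<in> K i" unfolding K_def by blast
    with x have "((int a, int i), x) \<in> B" by (auto simp: B_def)
    with sub have "x = \<zero>\<^bsub>M\<^esub> \<or> x \<in> Q a i" by auto
    then show ?thesis
    proof
      assume "x \<in> Q a i"
      moreover have "\<one> \<in> ideal_power R m 0" "e \<le> 0 + a" using a by (simp_all add: ideal_power_0)
      ultimately have "\<one> \<odot>\<^bsub>M\<^esub> x \<in> P (0 + a - e) (Suc i)" "x \<in> carrier M"
        unfolding Q_def by blast+
      then show ?thesis by simp
    qed (use submodule_zero[OF P] in simp)
  qed
  then show ?thesis unfolding P_def by blast
qed

text \<open>Starting from m^(en) F_0, each step to the next member of the filtration uses up e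
  powers of \<open>m\<close>. The torsion condition on x modulo F_n is available at every step
  because F_n lies in F_(i+1).\<close>

lemma filtration_linear_growth:
  assumes noeth: "noetherian_ring R" and fg: "finitely_generated R M"
    and m: "ideal m R" and I: "ideal I R"
    and F: "\<And>i. submodule (F i) R M" and F0: "F 0 = carrier M" and F_dec: "\<And>i. F (Suc i) \<subseteq> F i"
    and IF: "\<And>i. ideal_smult R M I (F i) \<subseteq> F (Suc i)"
    and F_le: "\<And>i. F i \<subseteq> ideal_smult R M (ideal_power R I (i - n0)) (carrier M)"
  shows "\<exists>e. \<forall>n x k. x \<in> ideal_smult R M (ideal_power R m (e * n)) (carrier M)
    \<longrightarrow> (\<forall>r \<in> ideal_power R m k. r \<odot>\<^bsub>M\<^esub> x \<in> F n) \<longrightarrow> x \<in> F n"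
proof -
  from filtration_artin_rees[OF noeth fg m I F IF F_le] obtain e where
    e: "\<And>a i x k. a \<ge> e \<Longrightarrow> x \<in> ideal_smult R M (ideal_power R m a) (F i)
    \<Longrightarrow> (\<forall>r \<in> ideal_power R m k. r \<odot>\<^bsub>M\<^esub> x \<in> F (Suc i))
    \<Longrightarrow> x \<in> ideal_smult R M (ideal_power R m (a - e)) (F (Suc i))"
    by blast
  have dec: "F j \<subseteq> F i" if "i \<le> j" for i j
    using that by (rule lift_Suc_antimono_le[where f = F, OF F_dec])
  have "x \<in> F n" if x: "x \<in> ideal_smult R M (ideal_power R m (e * n)) (carrier M)"
    and kx: "\<forall>r \<in> ideal_power R m k. r \<odot>\<^bsub>M\<^esub> x \<in> F n" for n x k
  proof -
    have "x \<in> ideal_smult R M (ideal_power R m (e * (n - i))) (F i)" if "i \<le> n" for i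
      using that
    proof (induction i)
      case 0
      then show ?case using x by (simp add: F0)
    next
      case (Suc i)
      then have "x \<in> ideal_smult R M (ideal_power R m (e * (n - i))) (F i)" by simp
      moreover have "n - i = Suc (n - Suc i)" using Suc.prems by simp
      then have n: "e * (n - i) = e + e * (n - Suc i)" by simp
      moreover have "\<forall>r \<in> ideal_power R m k. r \<odot>\<^bsub>M\<^esub> x \<in> F (Suc i)"
        using kx dec[OF Suc.prems] by blast
      ultimately show ?case using e[of "e * (n - i)" x i k] by simp
    qed
    from this[of n] show ?thesis by (simp add: ideal_power_0_smult[OF F])
  qed
  then show ?thesis by blast
qed

end

section \<open>Bounds on lengths\<close>

text \<open>A strictly monotone rank function into \<open>{0..k}\<close> certifies that all chains between \<open>X\<close>
  and \<open>Y\<close> have length at most \<open>k\<close>; such certificates are easier to combine than chains.\<close>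

definition rank_function :: "('x set \<Rightarrow> nat) \<Rightarrow> 'x set set \<Rightarrow> 'x set \<Rightarrow> 'x set \<Rightarrow> nat \<Rightarrow> bool"
  where "rank_function h L X Y k \<longleftrightarrow> (\<forall>C\<in>L. X \<subseteq> C \<longrightarrow> C \<subseteq> Y \<longrightarrow>
    h C \<le> k \<and> (\<forall>C'\<in>L. C \<subset> C' \<longrightarrow> C' \<subseteq> Y \<longrightarrow> h C < h C'))"

definition ranked :: "'x set set \<Rightarrow> 'x set \<Rightarrow> 'x set \<Rightarrow> nat \<Rightarrow> bool"
  where "ranked L X Y k \<longleftrightarrow> (\<exists>h. rank_function h L X Y k)"

lemma rankedI:
  assumes "\<And>C. C \<in> L \<Longrightarrow> X \<subseteq> C \<Longrightarrow> C \<subseteq> Y \<Longrightarrow> h C \<le> k"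
    and "\<And>C C'. C \<in> L \<Longrightarrow> X \<subseteq> C \<Longrightarrow> C' \<in> L \<Longrightarrow> C \<subset> C' \<Longrightarrow> C' \<subseteq> Y \<Longrightarrow> h C < h C'"
  shows "ranked L X Y k"
  unfolding ranked_def rank_function_def
  by (intro exI[of _ h] ballI impI conjI) (rule assms; assumption)+

lemma rank_functionD:
  assumes "rank_function h L X Y k"
  shows "\<And>C. C \<in> L \<Longrightarrow> X \<subseteq> C \<Longrightarrow> C \<subseteq> Y \<Longrightarrow> h C \<le> k"
    and "\<And>C C'. C \<in> L \<Longrightarrow> X \<subseteq> C \<Longrightarrow> C' \<in> L \<Longrightarrow> C \<subset> C' \<Longrightarrow> C' \<subseteq> Y \<Longrightarrow> h C < h C'"
  using assms unfolding rank_function_def by auto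

lemma ranked_mono: "ranked L X Y k \<Longrightarrow> X \<subseteq> X' \<Longrightarrow> k \<le> k' \<Longrightarrow> ranked L X' Y k'"
  unfolding ranked_def rank_function_def by (meson order_trans)

text \<open>A rank function is pulled back along the strictly monotone map \<Phi>.\<close>

lemma ranked_transfer:
  assumes "ranked L' X' Y' k"
    and map: "\<And>C. C \<in> L \<Longrightarrow> X \<subseteq> C \<Longrightarrow> C \<subseteq> Y \<Longrightarrow> \<Phi> C \<in> L' \<and> X' \<subseteq> \<Phi> C \<and> \<Phi> C \<subseteq> Y'"
    and mono: "\<And>C C'. C \<in> L \<Longrightarrow> X \<subseteq> C \<Longrightarrow> C' \<in> L \<Longrightarrow> C \<subset> C' \<Longrightarrow> C' \<subseteq> Y \<Longrightarrow> \<Phi> C \<subset> \<Phi> C'"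
  shows "ranked L X Y k"
proof -
  obtain h where "rank_function h L' X' Y' k"
    using assms(1) unfolding ranked_def by blast
  note h = rank_functionD[OF this]
  show ?thesis
  proof (rule rankedI[where h = "\<lambda>C. h (\<Phi> C)"])
    fix C assume "C \<in> L" "X \<subseteq> C" "C \<subseteq> Y"
    from map[OF this] show "h (\<Phi> C) \<le> k" by (blast intro: h(1))
  next
    fix C C' assume C: "C \<in> L" "X \<subseteq> C" "C' \<in> L" "C \<subset> C'" "C' \<subseteq> Y"
    then have "C \<subseteq> Y" "X \<subseteq> C'" by blast+
    with map[of C] map[of C'] C mono[OF C] show "h (\<Phi> C) < h (\<Phi> C')" by (blast intro: h(2))
  qed
qed

lemma ranked_refl: "ranked L X X 0"
  by (rule rankedI[where h = "\<lambda>_. 0"]) auto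

text \<open>The rank of Y itself is the cut: it bounds the ranks below Y, and subtracting it gives a
  rank function above Y. This is the inequality opposite to \<open>ranked_add\<close>.\<close>

lemma ranked_split:
  assumes "ranked L X Z k" "X \<subseteq> Y" "Y \<subseteq> Z" "Y \<in> L"
  shows "\<exists>a b. a + b \<le> k \<and> ranked L X Y a \<and> ranked L Y Z b"
proof -
  obtain h where "rank_function h L X Z k"
    using assms(1) unfolding ranked_def by blast
  note h = rank_functionD[OF this]
  have hY: "h Y \<le> h C" if "C \<in> L" "Y \<subseteq> C" "C \<subseteq> Z" for C
  proof (cases "C = Y")
    case False
    with that(2) have "Y \<subset> C" by blast
    from h(2)[OF assms(4,2) that(1) this that(3)] show ?thesis by simp
  qed simp
  have "ranked L X Y (h Y)"
  proof (rule rankedI[where h = h])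
    fix C assume "C \<in> L" "X \<subseteq> C" "C \<subseteq> Y"
    then show "h C \<le> h Y" using h(2)[of C Y] assms(3,4) by (cases "C = Y") (auto simp: psubset_eq)
  qed (use h(2) assms in auto)
  moreover have "ranked L Y Z (k - h Y)"
  proof (rule rankedI[where h = "\<lambda>C. h C - h Y"])
    fix C assume "C \<in> L" "Y \<subseteq> C" "C \<subseteq> Z"
    then show "h C - h Y \<le> k - h Y" using h(1)[of C] assms by (simp add: diff_le_mono)
  next
    fix C C' assume C: "C \<in> L" "Y \<subseteq> C" "C' \<in> L" "C \<subset> C'" "C' \<subseteq> Z"
    have "X \<subseteq> C" "C \<subseteq> Z" using C assms(2) by blast+
    with h(2)[OF C(1) _ C(3-5)] hY[OF C(1,2)] show "h C - h Y < h C' - h Y"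
      by (simp add: diff_less_mono)
  qed
  moreover have "h Y \<le> k" using h(1) assms by auto
  ultimately show ?thesis by (intro exI[of _ "h Y"] exI[of _ "k - h Y"]) auto
qed

lemma ranked_chain:
  assumes "ranked L X Y k" "\<And>i. i \<le> j \<Longrightarrow> C i \<in> L \<and> X \<subseteq> C i \<and> C i \<subseteq> Y"
    and "\<And>i. i < j \<Longrightarrow> C i \<subset> C (Suc i)"
  shows "j \<le> k"
proof -
  obtain h where "rank_function h L X Y k"
    using assms(1) unfolding ranked_def by blast
  note h = rank_functionD[OF this]
  have "i \<le> h (C i)" if "i \<le> j" for i
    using that
  proof (induction i)
    case (Suc i)
    then have "h (C i) < h (C (Suc i))" 
      using h(2)[of "C i" "C (Suc i)"] assms(2)[of i] assms(2)[of "Suc i"] assms(3)[of i] by auto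
    with Suc show ?case by simp
  qed simp
  from this[of j] show ?thesis using h(1)[of "C j"] assms(2)[of j] by force
qed

section \<open>Lengths of intervals of submodules\<close>

context module
begin

text \<open>Modular law: an element x = c + y of C' has y = x - c in C' and in Y, hence in C. A
  strict inclusion therefore stays strict after intersecting with Y or after adding Y.\<close>

lemma submodule_modular_eq:
  assumes C: "submodule C R M" and C': "submodule C' R M" and Y: "submodule Y R M"
    and "C \<subseteq> C'" "C' \<inter> Y \<subseteq> C" "C' \<subseteq> C <+>\<^bsub>M\<^esub> Y"
  shows "C = C'"
proof
  show "C' \<subseteq> C"
  proof
    fix x assume x: "x \<in> C'"
    with assms(6) obtain c y where cy: "c \<in> C" "y \<in> Y" "x = c \<oplus>\<^bsub>M\<^esub> y" by (auto simp: set_add_def')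
    have "c \<in> carrier M" "y \<in> carrier M" using submodule_carrier C Y cy by blast+
    then have "y = x \<ominus>\<^bsub>M\<^esub> c"
      by (simp add: cy(3) a_minus_def M.a_comm[of c y] M.a_assoc M.r_neg)
    moreover have "x \<ominus>\<^bsub>M\<^esub> c \<in> C'" using submodule_minus[OF C' x] cy(1) assms(4) by blast
    ultimately have "y \<in> C" using cy(2) assms(5) by blast
    with submoduleE(5)[OF C cy(1)] cy(3) show "x \<in> C" by simp
  qed
qed fact

text \<open>Intersecting with Y moves a submodule into the interval from X to Y, adding Y moves it
  into the one from Y to Z. By \<open>submodule_modular_eq\<close> the sum of the two ranks is
  strictly monotone.\<close>

lemma ranked_add:
  assumes Y: "submodule Y R M" and XY: "X \<subseteq> Y" and YZ: "Y \<subseteq> Z" and Z: "submodule Z R M"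
    and r: "ranked {N. submodule N R M} X Y a" "ranked {N. submodule N R M} Y Z b"
  shows "ranked {N. submodule N R M} X Z (a + b)"
proof -
  let ?L = "{N. submodule N R M}"
  obtain h where "rank_function h ?L X Y a"
    using r(1) unfolding ranked_def by blast
  note h = rank_functionD[OF this]
  obtain g where "rank_function g ?L Y Z b"
    using r(2) unfolding ranked_def by blast
  note g = rank_functionD[OF this]
  have int: "C \<inter> Y \<in> ?L \<and> X \<subseteq> C \<inter> Y \<and> C \<inter> Y \<subseteq> Y" if "C \<in> ?L" "X \<subseteq> C" for C
    using that XY submodule_Int[OF _ Y] by simp
  have sum: "C <+>\<^bsub>M\<^esub> Y \<in> ?L \<and> Y \<subseteq> C <+>\<^bsub>M\<^esub> Y \<and> C <+>\<^bsub>M\<^esub> Y \<subseteq> Z" if "C \<in> ?L" "C \<subseteq> Z" for C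
    using that submodule_set_add[OF _ Y] set_add_incl2[OF _ Y] set_add_least[OF Z _ YZ] by simp
  show ?thesis
  proof (rule rankedI[where h = "\<lambda>C. h (C \<inter> Y) + g (C <+>\<^bsub>M\<^esub> Y)"])
    fix C assume C: "C \<in> ?L" "X \<subseteq> C" "C \<subseteq> Z"
    from h(1)[of "C \<inter> Y"] g(1)[of "C <+>\<^bsub>M\<^esub> Y"] int[OF C(1,2)] sum[OF C(1,3)]
    show "h (C \<inter> Y) + g (C <+>\<^bsub>M\<^esub> Y) \<le> a + b" by simp
  next
    fix C C' assume C: "C \<in> ?L" "X \<subseteq> C" "C' \<in> ?L" "C \<subset> C'" "C' \<subseteq> Z"
    then have C': "X \<subseteq> C'" "C \<subseteq> Z" by blast+
    have subs: "C \<inter> Y \<subseteq> C' \<inter> Y" "C <+>\<^bsub>M\<^esub> Y \<subseteq> C' <+>\<^bsub>M\<^esub> Y"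
      using C(4) by (auto simp: set_add_def')
    have "C \<inter> Y \<noteq> C' \<inter> Y \<or> C <+>\<^bsub>M\<^esub> Y \<noteq> C' <+>\<^bsub>M\<^esub> Y"
    proof (rule ccontr)
      assume "\<not> ?thesis"
      then have eq: "C \<inter> Y = C' \<inter> Y" "C <+>\<^bsub>M\<^esub> Y = C' <+>\<^bsub>M\<^esub> Y" by auto
      have "C' \<subseteq> C <+>\<^bsub>M\<^esub> Y" unfolding eq(2) using set_add_incl1[OF _ Y] C by simp
      moreover have "C' \<inter> Y \<subseteq> C" using eq(1) by blast
      ultimately have "C = C'" using submodule_modular_eq[of C C' Y] C Y by auto
      with C(4) show False by blast
    qed
    moreover have "C \<inter> Y \<noteq> C' \<inter> Y \<Longrightarrow> h (C \<inter> Y) < h (C' \<inter> Y)"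
      using h(2) int[OF C(1,2)] int[OF C(3) C'(1)] subs(1) by (metis psubsetI)
    moreover have "C <+>\<^bsub>M\<^esub> Y \<noteq> C' <+>\<^bsub>M\<^esub> Y \<Longrightarrow> g (C <+>\<^bsub>M\<^esub> Y) < g (C' <+>\<^bsub>M\<^esub> Y)"
      using g(2) sum[OF C(1) C'(2)] sum[OF C(3,5)] subs(2) by (metis psubsetI)
    ultimately show "h (C \<inter> Y) + g (C <+>\<^bsub>M\<^esub> Y) < h (C' \<inter> Y) + g (C' <+>\<^bsub>M\<^esub> Y)"
      by (metis add_less_le_mono add_le_less_mono order_refl less_imp_le)
  qed
qed

text \<open>Modulo X, everything in Y is a multiple of x, and J kills x. Sending C to the ideal of
  all r with r x in C therefore compares the interval strictly with the ideals above J.\<close>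

lemma ranked_cyclic:
  assumes X: "submodule X R M" and x: "x \<in> carrier M"
    and Jx: "\<And>r. r \<in> J \<Longrightarrow> r \<odot>\<^bsub>M\<^esub> x \<in> X" and Jc: "J \<subseteq> carrier R"
    and Y: "\<And>y. y \<in> Y \<Longrightarrow> \<exists>z\<in>X. \<exists>r\<in>carrier R. y = z \<oplus>\<^bsub>M\<^esub> r \<odot>\<^bsub>M\<^esub> x"
    and r: "ranked {K. ideal K R} J (carrier R) k"
  shows "ranked {N. submodule N R M} X Y k"
proof (rule ranked_transfer[OF r, where \<Phi> = "\<lambda>C. {r \<in> carrier R. r \<odot>\<^bsub>M\<^esub> x \<in> C}"])
  fix C assume C: "C \<in> {N. submodule N R M}" "X \<subseteq> C" "C \<subseteq> Y"
  then show "{r \<in> carrier R. r \<odot>\<^bsub>M\<^esub> x \<in> C} \<in> {K. ideal K R} \<and> J \<subseteq> {r \<in> carrier R. r \<odot>\<^bsub>M\<^esub> x \<in> C}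
    \<and> {r \<in> carrier R. r \<odot>\<^bsub>M\<^esub> x \<in> C} \<subseteq> carrier R"
    using colon_ideal[OF _ x] Jx Jc by auto
next
  fix C C' assume C: "C \<in> {N. submodule N R M}" "X \<subseteq> C" "C' \<in> {N. submodule N R M}" "C \<subset> C'" "C' \<subseteq> Y"
  then obtain y where y: "y \<in> C'" "y \<notin> C" by blast
  with Y C(5) obtain z r where zr: "z \<in> X" "r \<in> carrier R" "y = z \<oplus>\<^bsub>M\<^esub> r \<odot>\<^bsub>M\<^esub> x" by blast
  have zc: "z \<in> carrier M" using submodule_carrier[OF X zr(1)] .
  have "r \<odot>\<^bsub>M\<^esub> x = y \<ominus>\<^bsub>M\<^esub> z"
    using zc zr(2) x by (simp add: zr(3) a_minus_def M.a_comm[of z] M.a_assoc M.r_neg)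
  also have "\<dots> \<in> C'" using submodule_minus[of C' y z] y(1) zr(1) C by auto
  finally have "r \<odot>\<^bsub>M\<^esub> x \<in> C'" .
  moreover have "r \<odot>\<^bsub>M\<^esub> x \<notin> C" using y(2) zr C(1,2) submoduleE(5)[of C z "r \<odot>\<^bsub>M\<^esub> x"] by auto
  ultimately show "{r \<in> carrier R. r \<odot>\<^bsub>M\<^esub> x \<in> C} \<subset> {r \<in> carrier R. r \<odot>\<^bsub>M\<^esub> x \<in> C'}"
    using C(4) zr(2) by blast
qed

end

text \<open>Makes the module lemmas available for ideals: \<open>submodule_regular_module\<close>
  identifies the submodules of this module with the ideals of R.\<close>

definition regular_module :: "('a, 'b) ring_scheme \<Rightarrow> ('a, 'a) module"
  where "regular_module R = \<lparr>carrier = carrier R, mult = mult R, one = one R, zero = zero R,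
    add = add R, smult = mult R\<rparr>"

lemma regular_module_simps [simp]:
  "carrier (regular_module R) = carrier R" "zero (regular_module R) = zero R"
  "add (regular_module R) = add R" "smult (regular_module R) = mult R"
  "set_add (regular_module R) = set_add R"
  by (auto simp: regular_module_def set_add_def' fun_eq_iff)

section \<open>Ideals as submodules of the ring, and lengths of R / (J + m^n)\<close>

context cring
begin

lemma module_regular_module: "module R (regular_module R)"
proof (rule moduleI)
  show "abelian_group (regular_module R)"
  proof (rule abelian_groupI)
    fix x assume "x \<in> carrier (regular_module R)"
    then show "\<exists>y\<in>carrier (regular_module R). y \<oplus>\<^bsub>regular_module R\<^esub> x = \<zero>\<^bsub>regular_module R\<^esub>"
      by (auto intro: bexI[of _ "\<ominus> x"] l_neg)
  qed (auto simp: a_ac)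
qed (auto simp: is_cring m_assoc l_distr r_distr)

lemma submodule_regular_module: "submodule N R (regular_module R) \<longleftrightarrow> ideal N R"
proof
  interpret RM: module R "regular_module R" by (rule module_regular_module)
  assume N: "submodule N R (regular_module R)"
  have "ideal {r \<in> carrier R. r \<odot>\<^bsub>regular_module R\<^esub> \<one> \<in> N} R"
    by (rule RM.colon_ideal[OF N]) simp
  moreover have "{r \<in> carrier R. r \<odot>\<^bsub>regular_module R\<^esub> \<one> \<in> N} = N"
    using RM.submodule_carrier[OF N] by auto
  ultimately show "ideal N R" by simp
next
  interpret RM: module R "regular_module R" by (rule module_regular_module)
  assume N: "ideal N R"
  show "submodule N R (regular_module R)"
    by (rule RM.submoduleI')
      (auto simp: ideal.Icarr[OF N] ideal.I_l_closed[OF N] additive_subgroup.zero_closed[OF ideal.axioms(1)[OF N]]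
        additive_subgroup.a_closed[OF ideal.axioms(1)[OF N]])
qed

lemma regular_module_finitely_generated: "finitely_generated R (regular_module R)"
proof -
  interpret RM: module R "regular_module R" by (rule module_regular_module)
  have sub: "submodule (submodule_span R (regular_module R) {\<one>}) R (regular_module R)"
    by (rule RM.submodule_span_submodule) simp
  have "r \<in> submodule_span R (regular_module R) {\<one>}" if "r \<in> carrier R" for r
    using RM.submoduleE(4)[OF sub that, of \<one>] RM.submodule_span_incl[of "{\<one>}"] that by simp
  then have "carrier (regular_module R) = submodule_span R (regular_module R) {\<one>}"
    using RM.submodule_carrier[OF sub] by auto
  then show ?thesis unfolding finitely_generated_def by (intro exI[of _ "{\<one>}"]) auto
qed

text \<open>\<open>hilbert_le m J n k\<close> states that the length of \<open>R / (J + m^n)\<close> is at most \<open>k\<close>.\<close>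

definition hilbert_le :: "'a set \<Rightarrow> 'a set \<Rightarrow> nat \<Rightarrow> nat \<Rightarrow> bool"
  where "hilbert_le m J n k \<longleftrightarrow> ranked {K. ideal K R} (J <+>\<^bsub>R\<^esub> ideal_power R m n) (carrier R) k"

lemma set_add_ideal_incl:
  assumes "ideal J R" "ideal K R"
  shows "J \<subseteq> J <+>\<^bsub>R\<^esub> K" "K \<subseteq> J <+>\<^bsub>R\<^esub> K" "J <+>\<^bsub>R\<^esub> K \<subseteq> carrier R"
proof -
  interpret RM: module R "regular_module R" by (rule module_regular_module)
  from assms have "submodule J R (regular_module R)" "submodule K R (regular_module R)"
    by (simp_all add: submodule_regular_module)
  from RM.set_add_incl1[OF this] RM.set_add_incl2[OF this]
  show "J \<subseteq> J <+>\<^bsub>R\<^esub> K" "K \<subseteq> J <+>\<^bsub>R\<^esub> K" by simp_all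
  show "J <+>\<^bsub>R\<^esub> K \<subseteq> carrier R" using ideal.Icarr[OF add_ideals[OF assms]] by blast
qed

lemma set_add_ideal_least:
  "ideal L R \<Longrightarrow> J \<subseteq> L \<Longrightarrow> K \<subseteq> L \<Longrightarrow> J <+>\<^bsub>R\<^esub> K \<subseteq> L"
  using module.set_add_least[OF module_regular_module, of L J K] by (simp add: submodule_regular_module)

lemma hilbert_le_mono: "hilbert_le m J n k \<Longrightarrow> k \<le> k' \<Longrightarrow> hilbert_le m J n k'"
  unfolding hilbert_le_def by (rule ranked_mono) auto

lemma hilbert_le_0:
  assumes "ideal J R" "ideal m R" shows "hilbert_le m J 0 0"
proof -
  have "J <+>\<^bsub>R\<^esub> ideal_power R m 0 = carrier R"
    using set_add_ideal_incl[OF assms(1) oneideal] by (auto simp: ideal_power_0)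
  then show ?thesis unfolding hilbert_le_def by (simp add: ranked_refl)
qed

lemma hilbert_le_carrier:
  assumes "ideal m R" shows "hilbert_le m (carrier R) n 0"
proof -
  have "carrier R <+>\<^bsub>R\<^esub> ideal_power R m n = carrier R"
    using set_add_ideal_incl[OF oneideal ideal_power_ideal[OF assms]] by blast
  then show ?thesis unfolding hilbert_le_def by (simp add: ranked_refl)
qed

text \<open>The kernel of R/(J + m^n) onto R/(J' + m^n) is cyclic, generated by a and killed by K
  and m^n'. With n' = n and K = J : a this gives the step for an ideal that is not prime; with n =
  n' + 1, K = J and a in \<open>m\<close> it gives the step used in
  \<open>hilbert_le_sum\<close>.\<close>

lemma hilbert_le_add:
  assumes m: "ideal m R" and J: "ideal J R" "ideal J' R" "ideal K R" and a: "a \<in> carrier R"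
    and K: "\<And>r. r \<in> K \<Longrightarrow> r \<otimes> a \<in> J"
    and n: "\<And>r. r \<in> ideal_power R m n' \<Longrightarrow> r \<otimes> a \<in> ideal_power R m n"
    and J': "J \<subseteq> J'" "\<And>y. y \<in> J' \<Longrightarrow> \<exists>j\<in>J. \<exists>r\<in>carrier R. y = j \<oplus> r \<otimes> a"
    and p: "hilbert_le m K n' p" and q: "hilbert_le m J' n q"
  shows "hilbert_le m J n (p + q)"
proof -
  interpret RM: module R "regular_module R" by (rule module_regular_module)
  note P = ideal_power_ideal[OF m]
  let ?X = "J <+>\<^bsub>R\<^esub> ideal_power R m n" let ?Y = "J' <+>\<^bsub>R\<^esub> ideal_power R m n"
  let ?L = "K <+>\<^bsub>R\<^esub> ideal_power R m n'"
  have X: "ideal ?X R" and Y: "ideal ?Y R" and L: "ideal ?L R" by (intro add_ideals J P)+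
  note incl = set_add_ideal_incl[OF J(1) P[of n]] set_add_ideal_incl[OF J(2) P[of n]]
  have XY: "?X \<subseteq> ?Y" by (rule set_add_ideal_least[OF Y]) (use incl J'(1) in blast)+
  have "ranked {N. submodule N R (regular_module R)} ?X ?Y p"
  proof (rule RM.ranked_cyclic)
    show "submodule ?X R (regular_module R)" using X by (simp add: submodule_regular_module)
    show "a \<in> carrier (regular_module R)" using a by simp
    show "?L \<subseteq> carrier R" using set_add_ideal_incl(3)[OF J(3) P] .
    show "ranked {K. ideal K R} ?L (carrier R) p" using p by (simp add: hilbert_le_def)
  next
    fix r assume "r \<in> ?L"
    then obtain k s where *: "k \<in> K" "s \<in> ideal_power R m n'" "r = k \<oplus> s" by (auto simp: set_add_def')
    then have "r \<otimes> a = k \<otimes> a \<oplus> s \<otimes> a"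
      using a ideal.Icarr[OF J(3)] ideal.Icarr[OF P] by (simp add: l_distr)
    with K[OF *(1)] n[OF *(2)] show "r \<odot>\<^bsub>regular_module R\<^esub> a \<in> ?X"
      unfolding set_add_def' by auto
  next
    fix y assume "y \<in> ?Y"
    then obtain k s where *: "k \<in> J'" "s \<in> ideal_power R m n" "y = k \<oplus> s" by (auto simp: set_add_def')
    from J'(2)[OF *(1)] obtain j r where jr: "j \<in> J" "r \<in> carrier R" "k = j \<oplus> r \<otimes> a" by blast
    have "y = (j \<oplus> s) \<oplus> r \<otimes> a"
      using jr(2) a ideal.Icarr[OF J(1) jr(1)] ideal.Icarr[OF P *(2)] by (simp add: *(3) jr(3) a_ac)
    moreover have "j \<oplus> s \<in> ?X" using jr(1) *(2) unfolding set_add_def' by blast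
    ultimately show "\<exists>z\<in>?X. \<exists>r\<in>carrier R. y = z \<oplus>\<^bsub>regular_module R\<^esub> r \<odot>\<^bsub>regular_module R\<^esub> a"
      using jr(2) by auto
  qed
  then have "ranked {N. submodule N R (regular_module R)} ?X (carrier R) (p + q)"
    by (rule RM.ranked_add[rotated 4])
      (use q X Y oneideal XY incl(6) in \<open>auto simp: submodule_regular_module hilbert_le_def\<close>)
  then show ?thesis by (simp add: submodule_regular_module hilbert_le_def)
qed

lemma set_add_cgenideal:
  assumes J: "ideal J R" and x: "x \<in> carrier R"
  shows "ideal (J <+>\<^bsub>R\<^esub> PIdl x) R" "J \<subseteq> J <+>\<^bsub>R\<^esub> PIdl x" "x \<in> J <+>\<^bsub>R\<^esub> PIdl x"
    and "\<And>y. y \<in> J <+>\<^bsub>R\<^esub> PIdl x \<Longrightarrow> \<exists>j\<in>J. \<exists>r\<in>carrier R. y = j \<oplus> r \<otimes> x"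
    and "\<And>L. ideal L R \<Longrightarrow> J \<subseteq> L \<Longrightarrow> x \<in> L \<Longrightarrow> J <+>\<^bsub>R\<^esub> PIdl x \<subseteq> L"
proof -
  note c = cgenideal_ideal[OF x]
  show "ideal (J <+>\<^bsub>R\<^esub> PIdl x) R" "J \<subseteq> J <+>\<^bsub>R\<^esub> PIdl x"
    using add_ideals[OF J c] set_add_ideal_incl[OF J c] by auto
  show "x \<in> J <+>\<^bsub>R\<^esub> PIdl x" using set_add_ideal_incl(2)[OF J c] cgenideal_self[OF x] by blast
  show "\<And>y. y \<in> J <+>\<^bsub>R\<^esub> PIdl x \<Longrightarrow> \<exists>j\<in>J. \<exists>r\<in>carrier R. y = j \<oplus> r \<otimes> x"
    unfolding set_add_def' cgenideal_def by blast
  show "\<And>L. ideal L R \<Longrightarrow> J \<subseteq> L \<Longrightarrow> x \<in> L \<Longrightarrow> J <+>\<^bsub>R\<^esub> PIdl x \<subseteq> L"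
    by (rule set_add_ideal_least) (auto intro: cgenideal_minimal[THEN subsetD])
qed

text \<open>Iterates the step from n to n + 1. All summands g 1, ..., g n are replaced by the
  largest one, which does not affect the order of growth when g is polynomial.\<close>

lemma hilbert_le_sum:
  assumes m: "ideal m R" and J: "ideal J R" and x: "x \<in> m"
    and g: "mono g" and le: "\<And>n. hilbert_le m (J <+>\<^bsub>R\<^esub> PIdl x) n (g n)"
  shows "hilbert_le m J n (n * g n)"
proof (induction n)
  case 0
  then show ?case using hilbert_le_0[OF J m] by simp
next
  case (Suc n)
  have xc: "x \<in> carrier R" using ideal.Icarr[OF m x] .
  note c = set_add_cgenideal[OF J xc]
  have "hilbert_le m J (Suc n) (n * g n + g (Suc n))"
  proof (rule hilbert_le_add[OF m J c(1) J xc _ _ c(2) c(4) Suc le])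
    fix r assume "r \<in> J" then show "r \<otimes> x \<in> J" by (rule ideal.I_r_closed[OF J _ xc])
  next
    fix r assume "r \<in> ideal_power R m n" then show "r \<otimes> x \<in> ideal_power R m (Suc n)"
      using x by (simp add: ideal_power_Suc ideal_prod.prod)
  qed
  then show ?case
    by (rule hilbert_le_mono) (use monoD[OF g, of n "Suc n"] in simp)
qed

text \<open>Only \<open>m\<close> and R itself can contain J, so at most one strict inclusion
  remains.\<close>

lemma hilbert_le_maximal:
  assumes m: "maximalideal m R" and J: "ideal J R" "m \<subseteq> J"
  shows "hilbert_le m J n 1"
  unfolding hilbert_le_def
proof (rule rankedI[where h = "\<lambda>C. if C = carrier R then 1 else 0"])
  fix C C' assume C: "C \<in> {K. ideal K R}" "J <+>\<^bsub>R\<^esub> ideal_power R m n \<subseteq> C" "C' \<in> {K. ideal K R}"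
    "C \<subset> C'" "C' \<subseteq> carrier R"
  have mi: "ideal m R" using m by (rule maximalideal.axioms(1))
  have "m \<subseteq> C" using J(2) C(2) set_add_ideal_incl(1)[OF J(1) ideal_power_ideal[OF mi]] by blast
  then have "C' = m \<or> C' = carrier R" "C = m \<or> C = carrier R"
    using C maximalideal.I_maximal[OF m, of C] maximalideal.I_maximal[OF m, of C'] by auto
  with C(4,5) \<open>m \<subseteq> C\<close> show "(if C = carrier R then 1 else 0) < (if C' = carrier R then 1 else (0::nat))"
    by auto
qed auto

end

section \<open>Hilbert-Samuel functions and prime chains\<close>

definition prime_chain :: "('a, 'b) ring_scheme \<Rightarrow> 'a set \<Rightarrow> nat \<Rightarrow> (nat \<Rightarrow> 'a set) \<Rightarrow> bool"
  where "prime_chain R J k P \<longleftrightarrow>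
    (\<forall>i\<le>k. primeideal (P i) R \<and> J \<subseteq> P i) \<and> (\<forall>i<k. P i \<subset> P (Suc i))"

lemma prime_chain_antimono: "prime_chain R J' k P \<Longrightarrow> J \<subseteq> J' \<Longrightarrow> prime_chain R J k P"
  unfolding prime_chain_def by blast

text \<open>This is how the dimension drops: a chain over an ideal strictly above the prime J can be
  lengthened by J.\<close>

lemma prime_chain_Cons:
  assumes "prime_chain R J' k P" "primeideal J R" "J \<subset> J'"
  shows "prime_chain R J (Suc k) (case_nat J P)"
  unfolding prime_chain_def
proof (intro conjI allI impI)
  have P: "primeideal (P i) R \<and> J' \<subseteq> P i \<and> J \<subseteq> P i" if "i \<le> k" for i
    using assms(1,3) that unfolding prime_chain_def by blast
  fix i
  show "primeideal (case_nat J P i) R" "J \<subseteq> case_nat J P i" if "i \<le> Suc k"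
    using that assms(2) P[of "i - 1"] by (auto split: nat.split)
  show "case_nat J P i \<subset> case_nat J P (Suc i)" if "i < Suc k"
    using that assms P[of 0] by (cases i) (auto simp: prime_chain_def)
qed

text \<open>A maximal counterexample would contradict \<open>step\<close>. Zorn's lemma provides
  one, because in a Noetherian ring the union of a nonempty chain of ideals belongs to the
  chain.\<close>

lemma (in noetherian_ring) ideal_induct:
  assumes J: "ideal J R"
    and step: "\<And>J. ideal J R \<Longrightarrow> (\<And>K. ideal K R \<Longrightarrow> J \<subset> K \<Longrightarrow> P K) \<Longrightarrow> P J"
  shows "P J"
proof (rule ccontr)
  let ?A = "{J. ideal J R \<and> \<not> P J}"
  assume "\<not> P J"
  then have "?A \<noteq> {}" using J by blast
  then have "\<exists>K\<in>?A. \<forall>X\<in>?A. K \<subseteq> X \<longrightarrow> X = K"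
  proof (rule subset_Zorn_nonempty)
    fix C assume C: "C \<noteq> {}" "subset.chain ?A C"
    then have "subset.chain {I. ideal I R} C" unfolding subset.chain_def by blast
    from ideal_chain_is_trivial[OF C(1) this] C(2) show "\<Union>C \<in> ?A" unfolding subset.chain_def by blast
  qed
  then obtain K where "ideal K R" "\<not> P K" "\<And>X. ideal X R \<Longrightarrow> \<not> P X \<Longrightarrow> K \<subseteq> X \<Longrightarrow> X = K" by blast
  with step[of K] show False by blast
qed

section \<open>Upper and lower growth estimates over a local ring\<close>

context noetherian_local_ring
begin

lemma m_ideal: "ideal m R"
  using maximal by (rule maximalideal.axioms(1))

lemma proper_ideal_subset_m:
  assumes "ideal J R" "J \<noteq> carrier R" shows "J \<subseteq> m"
proof -
  have "J \<noteq> carrier R \<longrightarrow> J \<subseteq> m"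
  proof (rule ideal_induct[OF assms(1)], rule impI)
    fix J assume J: "ideal J R" and IH: "\<And>K. ideal K R \<Longrightarrow> J \<subset> K \<Longrightarrow> K \<noteq> carrier R \<longrightarrow> K \<subseteq> m"
      and neq: "J \<noteq> carrier R"
    show "J \<subseteq> m"
    proof (cases "maximalideal J R")
      case True
      then show ?thesis using unique_maximal by blast
    next
      case False
      have "\<exists>K. ideal K R \<and> J \<subset> K \<and> K \<noteq> carrier R"
      proof (rule ccontr)
        assume "\<not> ?thesis"
        then have "maximalideal J R" using neq by (intro maximalidealI[OF J]) auto
        with False show False ..
      qed
      with IH show ?thesis by blast
    qed
  qed
  with assms(2) show ?thesis by blast
qed

text \<open>The strict bound d stands for the dimension plus one, so that d = 0 covers J = R, where
  no prime lies above J and all lengths vanish. Passing from a prime J to J + (x) lowers d by one,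
  and summation over n restores one power of n + 1.\<close>

theorem hilbert_upper_bound:
  assumes "ideal J R" "\<And>k P. prime_chain R J k P \<Longrightarrow> k < d"
  shows "\<exists>C. \<forall>n. hilbert_le m J n (C * (if d = 0 then 0 else (n + 1) ^ (d - 1)))"
proof -
  define f where "f d n = (if d = 0 then 0 else (n + 1) ^ (d - 1) :: nat)" for d n
  have mono_f: "mono (\<lambda>n. C * f d n)" for C d
    by (auto simp: mono_def f_def intro!: mult_le_mono power_mono)
  \<comment> \<open>For d = 1 the left side is 0, by the separate value of \<open>f\<close> at
    0.\<close>
  have f_Suc: "n * f (d - 1) n \<le> f d n" if "d > 0" for n d
  proof (cases "d = 1")
    case False
    with that obtain c where c: "d = Suc (Suc c)" by (metis One_nat_def Suc_pred gr0I not_less_eq not_less_zero)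
    have "n * (n + 1) ^ c \<le> (n + 1) * (n + 1) ^ c" by (rule mult_le_mono1) simp
    then show ?thesis by (simp add: f_def c)
  qed (simp add: f_def)
  have "\<forall>d. (\<forall>k P. prime_chain R J k P \<longrightarrow> k < d) \<longrightarrow> (\<exists>C. \<forall>n. hilbert_le m J n (C * f d n))"
  proof (rule ideal_induct[OF assms(1)], intro allI impI)
    fix J d assume J: "ideal J R"
      and IH: "\<And>K. ideal K R \<Longrightarrow> J \<subset> K \<Longrightarrow>
        \<forall>d. (\<forall>k P. prime_chain R K k P \<longrightarrow> k < d) \<longrightarrow> (\<exists>C. \<forall>n. hilbert_le m K n (C * f d n))"
      and chain: "\<forall>k P. prime_chain R J k P \<longrightarrow> k < d"
    \<comment> \<open>In the third case b lies in J : a, so that both J : a and J + (a) are strictly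
      larger than J.\<close>
    consider "J = carrier R" | "primeideal J R"
      | a b where "a \<in> carrier R" "b \<in> carrier R" "a \<otimes> b \<in> J" "a \<notin> J" "b \<notin> J"
      using primeidealI[OF J is_cring] by blast
    then show "\<exists>C. \<forall>n. hilbert_le m J n (C * f d n)"
    proof cases
      case 1
      have "hilbert_le m J n (0 * f d n)" for n using hilbert_le_carrier[OF m_ideal] by (simp add: 1)
      then show ?thesis by blast
    next
      case 2
      have "prime_chain R J 0 (\<lambda>_. J)" using 2 by (simp add: prime_chain_def)
      with chain have d: "d > 0" by blast
      show ?thesis
      proof (cases "m \<subseteq> J")
        case True
        have "hilbert_le m J n (1 * f d n)" for n
          by (rule hilbert_le_mono[OF hilbert_le_maximal[OF maximal J True]]) (use d in \<open>simp add: f_def\<close>)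
        then show ?thesis by blast
      next
        case False
        then obtain x where x: "x \<in> m" "x \<notin> J" by blast
        have xc: "x \<in> carrier R" using ideal.Icarr[OF m_ideal x(1)] .
        note c = set_add_cgenideal[OF J xc]
        have JJ: "J \<subset> J <+>\<^bsub>R\<^esub> PIdl x" using c(2,3) x(2) by blast
        have "\<forall>k P. prime_chain R (J <+>\<^bsub>R\<^esub> PIdl x) k P \<longrightarrow> k < d - 1"
          using prime_chain_Cons[OF _ 2 JJ] chain by fastforce
        with IH[OF c(1) JJ] obtain C where "\<forall>n. hilbert_le m (J <+>\<^bsub>R\<^esub> PIdl x) n (C * f (d - 1) n)" by blast
        then have "hilbert_le m J n (n * (C * f (d - 1) n))" for n
          by (intro hilbert_le_sum[OF m_ideal J x(1) mono_f]) blast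
        moreover have "n * (C * f (d - 1) n) \<le> C * f d n" for n
          using mult_le_mono2[OF f_Suc[OF d, of n], of C] by (simp add: mult.left_commute)
        ultimately have "hilbert_le m J n (C * f d n)" for n
          by (blast intro: hilbert_le_mono)
        then show ?thesis by blast
      qed
    next
      case 3
      note c = set_add_cgenideal[OF J 3(1)]
      let ?K = "{r \<in> carrier R. r \<otimes> a \<in> J}"
      have K: "ideal ?K R"
        using module.colon_ideal[OF module_regular_module, of J a] J 3(1)
        by (simp add: submodule_regular_module)
      have JK: "J \<subset> ?K"
        using ideal.I_r_closed[OF J _ 3(1)] ideal.Icarr[OF J] 3 by (auto simp: m_comm)
      have JJ: "J \<subset> J <+>\<^bsub>R\<^esub> PIdl a" using c(2,3) 3(4) by blast
      have "\<forall>k P. prime_chain R ?K k P \<longrightarrow> k < d" "\<forall>k P. prime_chain R (J <+>\<^bsub>R\<^esub> PIdl a) k P \<longrightarrow> k < d"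
        using chain prime_chain_antimono JK JJ by blast+
      with IH[OF K JK] IH[OF c(1) JJ] obtain A B where
        AB: "\<And>n. hilbert_le m ?K n (A * f d n)" "\<And>n. hilbert_le m (J <+>\<^bsub>R\<^esub> PIdl a) n (B * f d n)"
        by blast
      have "hilbert_le m J n (A * f d n + B * f d n)" for n
      proof (rule hilbert_le_add[OF m_ideal J c(1) K 3(1) _ _ c(2,4) AB])
        fix r assume "r \<in> ideal_power R m n"
        then show "r \<otimes> a \<in> ideal_power R m n"
          using ideal.I_r_closed[OF ideal_power_ideal[OF m_ideal] _ 3(1)] by blast
      qed auto
      then have "hilbert_le m J n ((A + B) * f d n)" for n by (simp add: add_mult_distrib)
      then show ?thesis by blast
    qed
  qed
  with assms(2) have "\<exists>C. \<forall>n. hilbert_le m J n (C * f d n)" by blast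
  then show ?thesis by (simp only: f_def)
qed

text \<open>The exponent is the number of generators of \<open>m\<close>, whatever J is and before
  any dimension is known to be finite. The induction is over a set V of generators that J may miss;
  adjoining one of them to J shrinks V and costs one power of n + 1.\<close>

lemma hilbert_polynomial_bound:
  shows "\<exists>C r. \<forall>J n. ideal J R \<longrightarrow> hilbert_le m J n (C * (n + 1) ^ r)"
proof -
  obtain W where W: "W \<subseteq> carrier R" "finite W" "m = Idl W"
    using finetely_gen[OF m_ideal] by blast
  have "V \<subseteq> W \<Longrightarrow> ideal J R \<Longrightarrow> W - V \<subseteq> J \<Longrightarrow> hilbert_le m J n ((n + 1) ^ card V)"
    if "finite V" for V J n
    using that
  proof (induction V arbitrary: J n)
    case empty
    have "m \<subseteq> J" unfolding W(3) by (rule genideal_minimal) (use empty in auto)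
    then show ?case using hilbert_le_maximal[OF maximal empty(2)] by simp
  next
    case (insert x V)
    have x: "x \<in> m" "x \<in> carrier R"
      using insert.prems(1) genideal_self[OF W(1)] W by auto
    note c = set_add_cgenideal[OF insert.prems(2) x(2)]
    have "hilbert_le m (J <+>\<^bsub>R\<^esub> PIdl x) n ((n + 1) ^ card V)" for n
      by (rule insert.IH) (use insert.prems c in auto)
    then have "hilbert_le m J n (n * (n + 1) ^ card V)"
      by (intro hilbert_le_sum[OF m_ideal insert.prems(2) x(1)]) (auto simp: mono_def intro!: power_mono)
    then show ?case by (rule hilbert_le_mono) (use insert.hyps in simp)
  qed
  from this[OF W(2)] have "hilbert_le m J n (1 * (n + 1) ^ card W)" if "ideal J R" for J n
    using that by simp
  then show ?thesis by blast
qed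

text \<open>If y x = p + s with p in P and s in m^n, then s lies in N = P + (x), and Artin-Rees for
  N gives s = q + t x with q in P and t in m^(n-c). Hence (y - t) x is in P, and primality puts y -
  t into P.\<close>

lemma artin_rees_colon:
  assumes P: "primeideal P R" and x: "x \<in> carrier R" "x \<notin> P"
  shows "\<exists>c. \<forall>n y. y \<in> carrier R \<longrightarrow> y \<otimes> x \<in> P <+>\<^bsub>R\<^esub> ideal_power R m n
    \<longrightarrow> y \<in> P <+>\<^bsub>R\<^esub> ideal_power R m (n - c)"
proof -
  interpret RM: module R "regular_module R" by (rule module_regular_module)
  have Pi: "ideal P R" using P by (rule primeideal.axioms(1))
  note Pw = ideal_power_ideal[OF m_ideal]
  note cN = set_add_cgenideal[OF Pi x(1)]
  let ?N = "P <+>\<^bsub>R\<^esub> PIdl x"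
  have "submodule ?N R (regular_module R)" using cN(1) by (simp add: submodule_regular_module)
  from RM.artin_rees[OF noetherian_ring_axioms regular_module_finitely_generated m_ideal this]
  obtain c where c: "\<And>n. ?N \<inter> ideal_smult R (regular_module R) (ideal_power R m n) (carrier R)
    \<subseteq> ideal_smult R (regular_module R) (ideal_power R m (n - c)) ?N" by auto
  have "y \<in> P <+>\<^bsub>R\<^esub> ideal_power R m (n - c)"
    if y: "y \<in> carrier R" "y \<otimes> x \<in> P <+>\<^bsub>R\<^esub> ideal_power R m n" for n y
  proof -
    let ?Q = "P <+>\<^bsub>R\<^esub> ideal_power R m (n - c)"
    have Q: "ideal ?Q R" by (rule add_ideals[OF Pi Pw])
    from y(2) obtain p s where ps: "p \<in> P" "s \<in> ideal_power R m n" "y \<otimes> x = p \<oplus> s"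
      by (auto simp: set_add_def')
    have car: "p \<in> carrier R" "s \<in> carrier R"
      using ideal.Icarr[OF Pi ps(1)] ideal.Icarr[OF Pw ps(2)] by auto
    have yx: "y \<otimes> x \<in> ?N" using ideal.I_l_closed[OF cN(1,3) y(1)] .
    have "s = (\<ominus> p) \<oplus> y \<otimes> x" using car by (simp add: ps(3) r_neg1)
    moreover have "\<ominus> p \<in> ?N"
      using cN(2) ps(1) additive_subgroup.a_inv_closed[OF ideal.axioms(1)[OF Pi]] by blast
    ultimately have "s \<in> ?N" using yx additive_subgroup.a_closed[OF ideal.axioms(1)[OF cN(1)]] by simp
    moreover have "s \<otimes> \<one> \<in> ideal_smult R (regular_module R) (ideal_power R m n) (carrier R)"
      using RM.ideal_smultI[OF ps(2), of \<one> "carrier R"] by simp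
    ultimately have "s \<in> ideal_smult R (regular_module R) (ideal_power R m (n - c)) ?N"
      using c[of n] car by auto
    moreover have "ideal_smult R (regular_module R) (ideal_power R m (n - c)) ?N
      \<subseteq> {s. \<exists>p\<in>P. \<exists>t\<in>ideal_power R m (n - c). s = p \<oplus> t \<otimes> x}" (is "_ \<subseteq> ?L")
    proof (rule RM.ideal_smult_least)
      note pz = additive_subgroup.zero_closed[OF ideal.axioms(1)]
      note pa = additive_subgroup.a_closed[OF ideal.axioms(1)]
      show "submodule ?L R (regular_module R)"
      proof (rule RM.submoduleI')
        show "?L \<subseteq> carrier (regular_module R)" using x(1) ideal.Icarr[OF Pi] ideal.Icarr[OF Pw] by auto
        have "\<zero> = \<zero> \<oplus> \<zero> \<otimes> x" using x(1) by simp
        then show "\<zero>\<^bsub>regular_module R\<^esub> \<in> ?L" using pz[OF Pi] pz[OF Pw] by auto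
      next
        fix u v assume "u \<in> ?L" "v \<in> ?L"
        then obtain p q s t where *: "p \<in> P" "q \<in> P" "s \<in> ideal_power R m (n - c)" "t \<in> ideal_power R m (n - c)"
          "u = p \<oplus> s \<otimes> x" "v = q \<oplus> t \<otimes> x" by blast
        then have "u \<oplus> v = (p \<oplus> q) \<oplus> (s \<oplus> t) \<otimes> x"
          using x(1) ideal.Icarr[OF Pi] ideal.Icarr[OF Pw] by (simp add: l_distr a_ac)
        with pa[OF Pi *(1,2)] pa[OF Pw *(3,4)] show "u \<oplus>\<^bsub>regular_module R\<^esub> v \<in> ?L" by auto
      next
        fix r u assume r: "r \<in> carrier R" and "u \<in> ?L"
        then obtain p s where *: "p \<in> P" "s \<in> ideal_power R m (n - c)" "u = p \<oplus> s \<otimes> x" by blast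
        then have "r \<otimes> u = r \<otimes> p \<oplus> (r \<otimes> s) \<otimes> x"
          using x(1) r ideal.Icarr[OF Pi] ideal.Icarr[OF Pw] by (simp add: r_distr m_assoc)
        with ideal.I_l_closed[OF Pi *(1) r] ideal.I_l_closed[OF Pw *(2) r]
        show "r \<odot>\<^bsub>regular_module R\<^esub> u \<in> ?L" by auto
      qed
      fix a u assume a: "a \<in> ideal_power R m (n - c)" and "u \<in> ?N"
      then obtain j r where jr: "j \<in> P" "r \<in> carrier R" "u = j \<oplus> r \<otimes> x" using cN(4) by blast
      have ac: "a \<in> carrier R" using ideal.Icarr[OF Pw a] .
      have "a \<otimes> u = a \<otimes> j \<oplus> (a \<otimes> r) \<otimes> x"
        using ac jr x(1) ideal.Icarr[OF Pi] by (simp add: r_distr m_assoc)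
      with ideal.I_l_closed[OF Pi jr(1) ac] ideal.I_r_closed[OF Pw a jr(2)]
      show "a \<odot>\<^bsub>regular_module R\<^esub> u \<in> ?L" by auto
    qed
    ultimately obtain q t where qt: "q \<in> P" "t \<in> ideal_power R m (n - c)" "s = q \<oplus> t \<otimes> x" by blast
    have car': "q \<in> carrier R" "t \<in> carrier R"
      using ideal.Icarr[OF Pi qt(1)] ideal.Icarr[OF Pw qt(2)] by auto
    have "(y \<ominus> t) \<otimes> x = p \<oplus> q"
    proof -
      have "(y \<ominus> t) \<otimes> x = y \<otimes> x \<ominus> t \<otimes> x"
        using y(1) car' x(1) by (simp add: a_minus_def l_distr l_minus)
      also have "\<dots> = p \<oplus> q" using car car' x(1) by (simp add: ps(3) qt(3) a_minus_def a_assoc r_neg)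
      finally show ?thesis .
    qed
    moreover have "p \<oplus> q \<in> P" using additive_subgroup.a_closed[OF ideal.axioms(1)[OF Pi] ps(1) qt(1)] .
    ultimately have "y \<ominus> t \<in> P"
      using primeideal.I_prime[OF P _ x(1), of "y \<ominus> t"] y(1) car' x(2) by auto
    moreover have "y = (y \<ominus> t) \<oplus> t" using y(1) car' by (simp add: a_minus_def a_assoc l_neg)
    ultimately show ?thesis using qt(2) unfolding set_add_def' by blast
  qed
  then show ?thesis by blast
qed

text \<open>Since \<open>hilbert_le\<close> only expresses upper bounds, lengths are replaced by
  numbers a and b below every admissible bound. For x in P' outside P, the interval from P + m^n to
  R is cut at P + m^n + (x). The part above the cut contains all ideals above P' + m^n; into the
  part below, the ideals above P + m^(n-c) are mapped through multiplication by x.\<close>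

lemma hilbert_lower_step:
  assumes P: "primeideal P R" and P': "ideal P' R" "P \<subset> P'"
  shows "\<exists>c. \<forall>n k a b. (\<forall>k. hilbert_le m P (n - c) k \<longrightarrow> a \<le> k) \<longrightarrow> (\<forall>k. hilbert_le m P' n k \<longrightarrow> b \<le> k)
    \<longrightarrow> hilbert_le m P n k \<longrightarrow> a + b \<le> k"
proof -
  have Pi: "ideal P R" using P by (rule primeideal.axioms(1))
  from P'(2) obtain x where xP': "x \<in> P'" and xP: "x \<notin> P" by blast
  have xc: "x \<in> carrier R" using ideal.Icarr[OF P'(1) xP'] .
  from artin_rees_colon[OF P xc xP] obtain c where
    c: "\<And>n y. y \<in> carrier R \<Longrightarrow> y \<otimes> x \<in> P <+>\<^bsub>R\<^esub> ideal_power R m n \<Longrightarrow> y \<in> P <+>\<^bsub>R\<^esub> ideal_power R m (n - c)"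
    by blast
  note Pw = ideal_power_ideal[OF m_ideal]
  have "a + b \<le> k" if a: "\<And>k. hilbert_le m P (n - c) k \<Longrightarrow> a \<le> k"
    and b: "\<And>k. hilbert_le m P' n k \<Longrightarrow> b \<le> k" and k: "hilbert_le m P n k" for n k a b
  proof -
    let ?X = "P <+>\<^bsub>R\<^esub> ideal_power R m n"
    have X: "ideal ?X R" by (rule add_ideals[OF Pi Pw])
    note Y = set_add_cgenideal[OF X xc]
    let ?Y = "?X <+>\<^bsub>R\<^esub> PIdl x"
    have Yc: "?Y \<subseteq> carrier R" using ideal.Icarr[OF Y(1)] by blast
    from ranked_split[OF k[unfolded hilbert_le_def] Y(2) Yc] Y(1) obtain k1 k2 where
      k12: "k1 + k2 \<le> k" "ranked {K. ideal K R} ?X ?Y k1" "ranked {K. ideal K R} ?Y (carrier R) k2" by auto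
    have "hilbert_le m P' n k2"
      unfolding hilbert_le_def
    proof (rule ranked_mono[OF k12(3) _ order_refl])
      note i = set_add_ideal_incl[OF P'(1) Pw[of n]]
      show "?Y \<subseteq> P' <+>\<^bsub>R\<^esub> ideal_power R m n"
      proof (rule Y(5)[OF add_ideals[OF P'(1) Pw]])
        show "?X \<subseteq> P' <+>\<^bsub>R\<^esub> ideal_power R m n"
          by (rule set_add_ideal_least[OF add_ideals[OF P'(1) Pw]]) (use P'(2) i in blast)+
      qed (use i xP' in blast)
    qed
    then have "b \<le> k2" by (rule b)
    moreover have "hilbert_le m P (n - c) k1"
      unfolding hilbert_le_def
    proof (rule ranked_transfer[OF k12(2), where \<Phi> = "\<lambda>D. {z \<oplus> d \<otimes> x | z d. z \<in> ?X \<and> d \<in> D}"])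
      let ?\<Phi> = "\<lambda>D. {z \<oplus> d \<otimes> x | z d. z \<in> ?X \<and> d \<in> D}"
      note aX = additive_subgroup.a_closed[OF ideal.axioms(1)[OF X]]
      note zX = additive_subgroup.zero_closed[OF ideal.axioms(1)[OF X]]
      fix D assume "D \<in> {K. ideal K R}" "P <+>\<^bsub>R\<^esub> ideal_power R m (n - c) \<subseteq> D" "D \<subseteq> carrier R"
      then have D: "ideal D R" by simp
      note aD = additive_subgroup.a_closed[OF ideal.axioms(1)[OF D]]
      note zD = additive_subgroup.zero_closed[OF ideal.axioms(1)[OF D]]
      note car = ideal.Icarr[OF X] ideal.Icarr[OF D]
      interpret RM: module R "regular_module R" by (rule module_regular_module)
      have "submodule (?\<Phi> D) R (regular_module R)"
      proof (rule RM.submoduleI')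
        show "?\<Phi> D \<subseteq> carrier (regular_module R)" using car xc by auto
        have "\<zero> = \<zero> \<oplus> \<zero> \<otimes> x" using xc by simp
        then show "\<zero>\<^bsub>regular_module R\<^esub> \<in> ?\<Phi> D" using zX zD by auto
      next
        fix u v assume "u \<in> ?\<Phi> D" "v \<in> ?\<Phi> D"
        then obtain p q s t where *: "p \<in> ?X" "q \<in> ?X" "s \<in> D" "t \<in> D"
          "u = p \<oplus> s \<otimes> x" "v = q \<oplus> t \<otimes> x" by blast
        then have "u \<oplus> v = (p \<oplus> q) \<oplus> (s \<oplus> t) \<otimes> x" using xc car by (simp add: l_distr a_ac)
        with aX[OF *(1,2)] aD[OF *(3,4)] show "u \<oplus>\<^bsub>regular_module R\<^esub> v \<in> ?\<Phi> D" by auto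
      next
        fix r u assume r: "r \<in> carrier R" and "u \<in> ?\<Phi> D"
        then obtain p s where *: "p \<in> ?X" "s \<in> D" "u = p \<oplus> s \<otimes> x" by blast
        then have "r \<otimes> u = r \<otimes> p \<oplus> (r \<otimes> s) \<otimes> x" using xc r car by (simp add: r_distr m_assoc)
        with ideal.I_l_closed[OF X *(1) r] ideal.I_l_closed[OF D *(2) r]
        show "r \<odot>\<^bsub>regular_module R\<^esub> u \<in> ?\<Phi> D" by auto
      qed
      moreover have "?X \<subseteq> ?\<Phi> D"
      proof
        fix z assume z: "z \<in> ?X"
        then have "z = z \<oplus> \<zero> \<otimes> x" using car xc by simp
        then show "z \<in> ?\<Phi> D" using z zD by blast
      qed
      moreover have "?\<Phi> D \<subseteq> ?Y"
      proof clarify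
        fix z d assume zd: "z \<in> ?X" "d \<in> D"
        show "z \<oplus> d \<otimes> x \<in> ?Y"
          by (rule additive_subgroup.a_closed[OF ideal.axioms(1)[OF Y(1)]])
            (use zd Y(2) ideal.I_l_closed[OF Y(1,3)] car in auto)
      qed
      ultimately show "?\<Phi> D \<in> {K. ideal K R} \<and> ?X \<subseteq> ?\<Phi> D \<and> ?\<Phi> D \<subseteq> ?Y"
        by (simp add: submodule_regular_module)
    next
      let ?\<Phi> = "\<lambda>D. {z \<oplus> d \<otimes> x | z d. z \<in> ?X \<and> d \<in> D}"
      fix D D' assume D: "D \<in> {K. ideal K R}" "P <+>\<^bsub>R\<^esub> ideal_power R m (n - c) \<subseteq> D"
        "D' \<in> {K. ideal K R}" "D \<subset> D'" "D' \<subseteq> carrier R"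
      then obtain r where r: "r \<in> D'" "r \<notin> D" "r \<in> carrier R" by blast
      have Di: "ideal D R" using D(1) by simp
      have "\<zero> \<oplus> r \<otimes> x \<in> ?\<Phi> D'" using r(1) additive_subgroup.zero_closed[OF ideal.axioms(1)[OF X]] by blast
      \<comment> \<open>Otherwise (r - d) x would lie in P + m^n for some d in D, so r - d would lie
        in P + m^(n-c) by the choice of c, hence in D, and r with it.\<close>
      moreover have "\<zero> \<oplus> r \<otimes> x \<notin> ?\<Phi> D"
      proof
        assume "\<zero> \<oplus> r \<otimes> x \<in> ?\<Phi> D"
        then obtain z d where zd: "z \<in> ?X" "d \<in> D" "r \<otimes> x = z \<oplus> d \<otimes> x" using r(3) xc by auto
        have car: "z \<in> carrier R" "d \<in> carrier R" using ideal.Icarr[OF X zd(1)] ideal.Icarr[OF Di zd(2)] by auto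
        have "(r \<ominus> d) \<otimes> x = r \<otimes> x \<ominus> d \<otimes> x"
          using r(3) car xc by (simp add: a_minus_def l_distr l_minus)
        also have "\<dots> = z" using car xc by (simp add: zd(3) a_minus_def a_assoc r_neg)
        finally have "r \<ominus> d \<in> P <+>\<^bsub>R\<^esub> ideal_power R m (n - c)"
          using c[of "r \<ominus> d" n] zd(1) r(3) car by simp
        then have "(r \<ominus> d) \<oplus> d \<in> D"
          using D(2) zd(2) by (intro additive_subgroup.a_closed[OF ideal.axioms(1)[OF Di]]) blast+
        then show False using r(2,3) car by (simp add: a_minus_def a_assoc l_neg)
      qed
      ultimately show "?\<Phi> D \<subset> ?\<Phi> D'" using D(4) by blast
    qed
    then have "a \<le> k1" by (rule a)
    ultimately show ?thesis using k12(1) by simp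
  qed
  then show ?thesis by blast
qed

text \<open>After scaling the argument by b, the inequality of \<open>hilbert_lower_step\<close>
  becomes Pascal's rule. The outer induction drops the first prime of the chain, the inner one runs
  over n.\<close>

lemma hilbert_lower_bound:
  assumes "prime_chain R J k P"
  shows "\<exists>b. \<forall>n l. hilbert_le m (P 0) (b * (n + 1)) l \<longrightarrow> n choose k \<le> l"
  using assms
proof (induction k arbitrary: P)
  case 0
  then have P: "primeideal (P 0) R" by (simp add: prime_chain_def)
  have Pi: "ideal (P 0) R" using P by (rule primeideal.axioms(1))
  have "P 0 \<subseteq> m" using proper_ideal_subset_m[OF Pi] primeideal.I_notcarr[OF P] by blast
  have "1 \<le> l" if l: "hilbert_le m (P 0) (1 * (n + 1)) l" for n l
  proof -
    let ?X = "P 0 <+>\<^bsub>R\<^esub> ideal_power R m (n + 1)"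
    have X: "ideal ?X R" by (rule add_ideals[OF Pi ideal_power_ideal[OF m_ideal]])
    have "ideal_power R m (n + 1) \<subseteq> m"
      using ideal_power_antimono[OF m_ideal, of 1 "n + 1"] ideal_power_1[OF m_ideal] by simp
    with \<open>P 0 \<subseteq> m\<close> have "?X \<subseteq> m" by (rule set_add_ideal_least[OF m_ideal])
    moreover have "m \<subset> carrier R" using ideal.Icarr[OF m_ideal] maximalideal.I_notcarr[OF maximal] by blast
    ultimately have *: "?X \<subset> carrier R" by blast
    show ?thesis
      by (rule ranked_chain[OF l[unfolded hilbert_le_def], where C = "\<lambda>i. if i = 0 then ?X else carrier R"])
        (use * X oneideal in auto)
  qed
  then show ?case by (intro exI[of _ 1]) auto
next
  case (Suc k)
  have "prime_chain R J k (\<lambda>i. P (Suc i))" using Suc.prems by (simp add: prime_chain_def)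
  from Suc.IH[OF this] obtain b' where
    b': "\<And>n l. hilbert_le m (P 1) (b' * (n + 1)) l \<Longrightarrow> n choose k \<le> l" by auto
  have P: "primeideal (P 0) R" "primeideal (P 1) R" "P 0 \<subset> P 1" using Suc.prems by (auto simp: prime_chain_def)
  have Pi: "ideal (P 0) R" "ideal (P 1) R" using P(1,2) by (auto dest: primeideal.axioms(1))
  from hilbert_lower_step[OF P(1) Pi(2) P(3)] obtain c where
    c: "\<And>n k a b. (\<And>k. hilbert_le m (P 0) (n - c) k \<Longrightarrow> a \<le> k) \<Longrightarrow> (\<And>k. hilbert_le m (P 1) n k \<Longrightarrow> b \<le> k)
    \<Longrightarrow> hilbert_le m (P 0) n k \<Longrightarrow> a + b \<le> k" by blast
  have antimono: "hilbert_le m Q i l" if "hilbert_le m Q j l" "i \<le> j" "ideal Q R" for Q i j l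
  proof -
    have "Q <+>\<^bsub>R\<^esub> ideal_power R m j \<subseteq> Q <+>\<^bsub>R\<^esub> ideal_power R m i"
      using ideal_power_antimono[OF m_ideal that(2)] by (auto simp: set_add_def')
    with that(1) show ?thesis unfolding hilbert_le_def by (rule ranked_mono) simp
  qed
  \<comment> \<open>b \<ge> c makes b (n + 2) - c at least b (n + 1), the argument of the inner
    induction hypothesis; b \<ge> b' makes the bound for \<open>P 1\<close> applicable.\<close>
  define b where "b = max b' c"
  have "n choose Suc k \<le> l" if "hilbert_le m (P 0) (b * (n + 1)) l" for n l
    using that
  proof (induction n arbitrary: l)
    case (Suc n)
    have "(n choose Suc k) + (n choose k) \<le> l"
    proof (rule c[of "b * (Suc n + 1)"])
      fix l assume l: "hilbert_le m (P 0) (b * (Suc n + 1) - c) l"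
      have "b * (n + 1) \<le> b * (Suc n + 1) - c" by (simp add: b_def)
      from Suc.IH[OF antimono[OF l this Pi(1)]] show "n choose Suc k \<le> l" .
    next
      fix l assume l: "hilbert_le m (P 1) (b * (Suc n + 1)) l"
      have "b' * (n + 1) \<le> b * (Suc n + 1)" by (rule mult_le_mono) (auto simp: b_def)
      from b'[OF antimono[OF l this Pi(2)]] show "n choose k \<le> l" .
    qed (use Suc.prems in simp)
    then show ?case by simp
  qed simp
  then show ?case by blast
qed

text \<open>A chain longer than the exponent r of \<open>hilbert_polynomial_bound\<close> would
  force a binomial coefficient of degree r + 1 in n below a polynomial of degree r.\<close>

theorem prime_chains_bounded: "\<exists>r. \<forall>J k P. prime_chain R J k P \<longrightarrow> k \<le> r"
proof -
  obtain C r where C: "\<And>J n. ideal J R \<Longrightarrow> hilbert_le m J n (C * (n + 1) ^ r)"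
    using hilbert_polynomial_bound by blast
  have "k \<le> r" if k: "prime_chain R J k P" for J k P
  proof (rule ccontr)
    assume "\<not> k \<le> r"
    with k have chain: "prime_chain R J (Suc r) P" by (auto simp: prime_chain_def)
    then have P0: "ideal (P 0) R" by (auto simp: prime_chain_def dest: primeideal.axioms(1))
    from hilbert_lower_bound[OF chain] obtain b where
      b: "\<And>n l. hilbert_le m (P 0) (b * (n + 1)) l \<Longrightarrow> n choose Suc r \<le> l" by blast
    have le: "n choose Suc r \<le> C * (b * (n + 1) + 1) ^ r" for n using b[OF C[OF P0]] .
    \<comment> \<open>Chosen so that b (n + 1) + 1 \<le> D t for n = (r + 1) t and t \<ge> 1. For
      these n the binomial coefficient is at least t^(r+1), and cancelling t^r leaves t \<le> C
      D^r.\<close>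
    define D where "D = b * (r + 2) + 1"
    have "t \<le> C * D ^ r" if t: "t \<ge> 1" for t
    proof -
      let ?n = "Suc r * t"
      have "Suc r * 1 \<le> ?n" by (rule mult_le_mono2[OF t])
      then have "Suc r \<le> ?n" by (simp only: mult_1_right)
      from binomial_ge_n_over_k_pow_k[OF this, where 'a = real]
      have "(real ?n / real (Suc r)) ^ Suc r \<le> real (?n choose Suc r)" .
      moreover have "real ?n / real (Suc r) = real t"
        by (metis nonzero_mult_div_cancel_left of_nat_0_eq_iff of_nat_mult old.nat.distinct(2))
      ultimately have "real t ^ Suc r \<le> real (?n choose Suc r)" by (simp only:)
      then have "t ^ Suc r \<le> ?n choose Suc r" by (simp only: of_nat_power[symmetric] of_nat_le_iff)
      also have "\<dots> \<le> C * (b * (?n + 1) + 1) ^ r" by (rule le)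
      also have "\<dots> \<le> C * (D * t) ^ r"
      proof (intro mult_le_mono2 power_mono)
        have "b * (?n + 1) \<le> b * ((r + 2) * t)" using t by (intro mult_le_mono2) simp
        moreover have "D * t = b * ((r + 2) * t) + t" by (simp add: D_def algebra_simps)
        ultimately show "b * (?n + 1) + 1 \<le> D * t" using t by linarith
      qed simp
      finally have "t ^ r * t \<le> t ^ r * (C * D ^ r)" by (simp add: power_mult_distrib mult_ac)
      then show ?thesis using t by simp
    qed
    from this[of "Suc (C * D ^ r)"] show False by simp
  qed
  then show ?thesis by blast
qed

end

section \<open>Local cohomology and Krull dimension\<close>

text \<open>Primes of R/J correspond to primes containing J; preimage \<open>pull\<close> and image
  \<open>push\<close> both preserve strict inclusions, so the same chain lengths occur on both
  sides.\<close>

lemma (in cring) krull_dim_quotient: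
  assumes J: "ideal J R"
  shows "krull_dim (R Quot J) = Sup {ereal (real k) | k. \<exists>P. prime_chain R J k P}"
proof -
  interpret J: ideal J R by (rule J)
  have surj: "\<exists>r\<in>carrier R. q = J +> r" if "q \<in> carrier (R Quot J)" for q
    using that by (auto simp: FactRing_def A_RCOSETS_def')
  have in_J: "J +> r = J" if "r \<in> J" for r using J.a_rcos_const[OF that] .
  have mult_Quot: "(J +> a) \<otimes>\<^bsub>R Quot J\<^esub> (J +> b) = J +> (a \<otimes> b)" if "a \<in> carrier R" "b \<in> carrier R" for a b
    using J.rcoset_mult_add[OF that] by (simp add: FactRing_def)
  have closed_Quot: "J +> a \<in> carrier (R Quot J)" if "a \<in> carrier R" for a
    using that by (auto simp: FactRing_def A_RCOSETS_def')
  have zero_Quot: "\<zero>\<^bsub>R Quot J\<^esub> = J" by (simp add: FactRing_def)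
  have one_Quot: "\<one>\<^bsub>R Quot J\<^esub> = J +> \<one>" by (simp add: FactRing_def)
  define pull where "pull Q = {r \<in> carrier R. J +> r \<in> Q}" for Q
  have pull_prime: "primeideal (pull Q) R \<and> J \<subseteq> pull Q" if Q: "primeideal Q (R Quot J)" for Q
  proof
    have Qi: "ideal Q (R Quot J)" using Q by (rule primeideal.axioms(1))
    have pQ: "ideal (pull Q) R"
      unfolding pull_def by (rule ring_hom_ring.ideal_vimage[OF J.rcos_ring_hom_ring Qi])
    show "primeideal (pull Q) R"
    proof (rule primeidealI[OF pQ is_cring])
      show "carrier R \<noteq> pull Q"
      proof
        assume "carrier R = pull Q"
        then have "\<one>\<^bsub>R Quot J\<^esub> \<in> Q" by (auto simp: pull_def one_Quot)
        then have "Q = carrier (R Quot J)" by (rule ideal.one_imp_carrier[OF Qi])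
        with primeideal.I_notcarr[OF Q] show False by simp
      qed
      fix a b assume ab: "a \<in> carrier R" "b \<in> carrier R" "a \<otimes> b \<in> pull Q"
      then have "(J +> a) \<otimes>\<^bsub>R Quot J\<^esub> (J +> b) \<in> Q" by (simp add: pull_def mult_Quot)
      from primeideal.I_prime[OF Q closed_Quot closed_Quot this] ab show "a \<in> pull Q \<or> b \<in> pull Q"
        by (simp add: pull_def)
    qed
    have "J \<in> Q" using additive_subgroup.zero_closed[OF ideal.axioms(1)[OF Qi]] zero_Quot by simp
    then show "J \<subseteq> pull Q" using J.Icarr in_J by (auto simp: pull_def)
  qed
  have pull_strict: "pull Q \<subset> pull Q'" if Q: "primeideal Q' (R Quot J)" "Q \<subset> Q'" for Q Q'
  proof -
    obtain q where q: "q \<in> Q'" "q \<notin> Q" using Q(2) by blast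
    have "q \<in> carrier (R Quot J)" using ideal.Icarr[OF primeideal.axioms(1)[OF Q(1)] q(1)] .
    with surj q Q(2) show ?thesis by (auto simp: pull_def)
  qed
  define push where "push P = (+>) J ` P" for P
  have push_iff: "J +> r \<in> push P \<longleftrightarrow> r \<in> P" if P: "ideal P R" "J \<subseteq> P" and r: "r \<in> carrier R" for P r
  proof
    assume "J +> r \<in> push P"
    then obtain p where p: "p \<in> P" "J +> r = J +> p" by (auto simp: push_def)
    have "r \<in> J +> p" using p(2) J.a_rcos_self[OF r] by simp
    then obtain j where "j \<in> J" "r = j \<oplus> p" by (auto simp: a_r_coset_def')
    with P p(1) show "r \<in> P" using additive_subgroup.a_closed[OF ideal.axioms(1)[OF P(1)]] by blast
  qed (auto simp: push_def)
  have push_prime: "primeideal (push P) (R Quot J)" if P: "primeideal P R" "J \<subseteq> P" for P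
  proof (rule primeidealI)
    have Pi: "ideal P R" using P(1) by (rule primeideal.axioms(1))
    note iff = push_iff[OF Pi P(2)]
    show "ideal (push P) (R Quot J)" unfolding push_def by (rule ring_ideal_imp_quot_ideal[OF J Pi])
    show "cring (R Quot J)" using J.quotient_is_cring is_cring by blast
    show "carrier (R Quot J) \<noteq> push P"
    proof
      assume "carrier (R Quot J) = push P"
      then have "J +> \<one> \<in> push P" using closed_Quot by blast
      then have "\<one> \<in> P" using iff by simp
      with ideal.one_imp_carrier[OF Pi] primeideal.I_notcarr[OF P(1)] show False by simp
    qed
    fix a b assume "a \<in> carrier (R Quot J)" "b \<in> carrier (R Quot J)" and ab: "a \<otimes>\<^bsub>R Quot J\<^esub> b \<in> push P"
    then obtain r s where rs: "r \<in> carrier R" "a = J +> r" "s \<in> carrier R" "b = J +> s"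
      using surj by meson
    with ab have "r \<otimes> s \<in> P" using iff by (simp add: mult_Quot)
    from primeideal.I_prime[OF P(1) rs(1,3) this] show "a \<in> push P \<or> b \<in> push P"
      using iff rs by simp
  qed
  have push_strict: "push P \<subset> push P'" if P: "ideal P R" "ideal P' R" "J \<subseteq> P" "P \<subset> P'" for P P'
  proof -
    obtain p where p: "p \<in> P'" "p \<notin> P" using P(4) by blast
    have pc: "p \<in> carrier R" using ideal.Icarr[OF P(2) p(1)] .
    have "J +> p \<in> push P'" "J +> p \<notin> push P"
      using push_iff[OF P(2) _ pc] push_iff[OF P(1,3) pc] p P by auto
    then show ?thesis using P(4) by (auto simp: push_def)
  qed
  have "(\<exists>Q :: nat \<Rightarrow> 'a set set. (\<forall>i\<le>k. primeideal (Q i) (R Quot J)) \<and> (\<forall>i<k. Q i \<subset> Q (Suc i)))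
    \<longleftrightarrow> (\<exists>P. prime_chain R J k P)" for k
  proof
    assume "\<exists>Q :: nat \<Rightarrow> 'a set set. (\<forall>i\<le>k. primeideal (Q i) (R Quot J)) \<and> (\<forall>i<k. Q i \<subset> Q (Suc i))"
    then obtain Q :: "nat \<Rightarrow> 'a set set" where
      Q: "\<And>i. i \<le> k \<Longrightarrow> primeideal (Q i) (R Quot J)" "\<And>i. i < k \<Longrightarrow> Q i \<subset> Q (Suc i)" by blast
    have "prime_chain R J k (\<lambda>i. pull (Q i))"
      unfolding prime_chain_def using pull_prime[OF Q(1)] pull_strict[OF Q(1) Q(2)] by auto
    then show "\<exists>P. prime_chain R J k P" by blast
  next
    assume "\<exists>P. prime_chain R J k P"
    then obtain P where P: "\<And>i. i \<le> k \<Longrightarrow> primeideal (P i) R" "\<And>i. i \<le> k \<Longrightarrow> J \<subseteq> P i"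
      "\<And>i. i < k \<Longrightarrow> P i \<subset> P (Suc i)" unfolding prime_chain_def by blast
    have "push (P i) \<subset> push (P (Suc i))" if "i < k" for i
      using that by (intro push_strict P primeideal.axioms(1)) auto
    then show "\<exists>Q :: nat \<Rightarrow> 'a set set. (\<forall>i\<le>k. primeideal (Q i) (R Quot J)) \<and> (\<forall>i<k. Q i \<subset> Q (Suc i))"
      using push_prime[OF P(1,2)] by (intro exI[of _ "\<lambda>i. push (P i)"]) auto
  qed
  then show ?thesis unfolding krull_dim_def by simp
qed

section \<open>Torsion of a quotient, and the comparison of M with R / ann M\<close>

context module
begin

lemma abelian_subgroup_submodule:
  assumes "submodule N R M" shows "abelian_subgroup N M"
  by (rule abelian_subgroupI3)
    (use submodule.axioms(1)[OF assms] in \<open>auto simp: additive_subgroup_def M.abelian_group_axioms\<close>)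

text \<open>All cosets in the union defining the scalar action coincide, since a times an element of
  N stays in N.\<close>

lemma quotient_module_smult_coset:
  assumes N: "submodule N R M" and a: "a \<in> carrier R" and x: "x \<in> carrier M"
  shows "a \<odot>\<^bsub>quotient_module M N\<^esub> (N +>\<^bsub>M\<^esub> x) = N +>\<^bsub>M\<^esub> (a \<odot>\<^bsub>M\<^esub> x)"
proof -
  interpret N: abelian_subgroup N M by (rule abelian_subgroup_submodule[OF N])
  have "N +>\<^bsub>M\<^esub> (a \<odot>\<^bsub>M\<^esub> y) = N +>\<^bsub>M\<^esub> (a \<odot>\<^bsub>M\<^esub> x)" if y: "y \<in> N +>\<^bsub>M\<^esub> x" for y
  proof -
    obtain n where n: "n \<in> N" "y = n \<oplus>\<^bsub>M\<^esub> x" using y by (auto simp: a_r_coset_def')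
    then have "a \<odot>\<^bsub>M\<^esub> y = a \<odot>\<^bsub>M\<^esub> n \<oplus>\<^bsub>M\<^esub> a \<odot>\<^bsub>M\<^esub> x"
      using a x submodule_carrier[OF N n(1)] by (simp add: smult_r_distr)
    moreover have "a \<odot>\<^bsub>M\<^esub> n \<in> N" by (rule submoduleE(4)[OF N a n(1)])
    ultimately have "a \<odot>\<^bsub>M\<^esub> y \<in> N +>\<^bsub>M\<^esub> (a \<odot>\<^bsub>M\<^esub> x)" by (auto simp: a_r_coset_def')
    then show ?thesis using N.a_repr_independence'[of "a \<odot>\<^bsub>M\<^esub> y" "a \<odot>\<^bsub>M\<^esub> x"] a x by simp
  qed
  moreover have "N +>\<^bsub>M\<^esub> x \<noteq> {}" using N.a_rcos_self[OF x] by blast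
  ultimately have "(\<Union>y\<in>N +>\<^bsub>M\<^esub> x. N +>\<^bsub>M\<^esub> (a \<odot>\<^bsub>M\<^esub> y)) = N +>\<^bsub>M\<^esub> (a \<odot>\<^bsub>M\<^esub> x)"
    by (intro SUP_eq_const)
  then show ?thesis by (simp only: quotient_module_def module.simps)
qed

text \<open>Let L be the submodule of M for which L/N is the torsion. By \<open>NX\<close> the
  intersection of L and X lies in N, so L/N is a quotient of L/(L \<inter> X), which embeds into
  M/X. On chains, each member is lifted to M and enlarged by X, and
  \<open>submodule_modular_eq\<close> keeps the inclusions strict.\<close>

lemma length_H0_le:
  assumes N: "submodule N R M" and X: "submodule X R M" and m: "ideal m R"
    and NX: "\<And>x k. x \<in> X \<Longrightarrow> \<forall>r \<in> ideal_power R m k. r \<odot>\<^bsub>M\<^esub> x \<in> N \<Longrightarrow> x \<in> N"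
    and b: "ranked {L. submodule L R M} X (carrier M) b"
  shows "length_H0 R m (quotient_module M N) \<le> enat b"
  unfolding length_H0_def module_length_def
proof (rule Sup_least, clarify)
  interpret N: abelian_subgroup N M by (rule abelian_subgroup_submodule[OF N])
  let ?Q = "quotient_module M N"
  let ?H = "local_cohomology0 R m ?Q"
  fix k and C :: "nat \<Rightarrow> 'c set set"
  assume C: "\<forall>i\<le>k. submodule (C i) R (?Q\<lparr>carrier := ?H\<rparr>)" and strict: "\<forall>i<k. C i \<subset> C (Suc i)"
  have Q: "carrier ?Q = a_rcosets\<^bsub>M\<^esub> N" "zero ?Q = N" "add ?Q = set_add M"
    by (simp_all add: quotient_module_def)
  have H_coset: "\<exists>x\<in>carrier M. c = N +>\<^bsub>M\<^esub> x" if "c \<in> ?H" for c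
    using that by (auto simp: local_cohomology0_def Q A_RCOSETS_def')
  \<comment> \<open>The union of a set of cosets is its preimage in M.\<close>
  have memU: "x \<in> \<Union>D \<longleftrightarrow> x \<in> carrier M \<and> N +>\<^bsub>M\<^esub> x \<in> D" if "D \<subseteq> ?H" for D x
  proof
    assume "x \<in> \<Union>D"
    then obtain c where c: "c \<in> D" "x \<in> c" by blast
    with that H_coset obtain y where y: "y \<in> carrier M" "c = N +>\<^bsub>M\<^esub> y" by blast
    with c N.a_repr_independence'[of x y] N.a_elemrcos_carrier[of y x]
    show "x \<in> carrier M \<and> N +>\<^bsub>M\<^esub> x \<in> D" by simp
  qed (use N.a_rcos_self in blast)
  have CH: "C i \<subseteq> ?H" if "i \<le> k" for i
    using subgroup.subset[OF submodule.axioms(1)] C that by fastforce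
  have U: "submodule (\<Union>(C i)) R M" "N \<subseteq> \<Union>(C i)" if i: "i \<le> k" for i
  proof -
    note mem = memU[OF CH[OF i]]
    have Ci: "submodule (C i) R (?Q\<lparr>carrier := ?H\<rparr>)" using C i by blast
    have NC: "N \<in> C i" using subgroup.one_closed[OF submodule.axioms(1)[OF Ci]] by (simp add: Q)
    then show "N \<subseteq> \<Union>(C i)" by blast
    show "submodule (\<Union>(C i)) R M"
    proof (rule submoduleI')
      show "\<Union>(C i) \<subseteq> carrier M" using mem by blast
      show "\<zero>\<^bsub>M\<^esub> \<in> \<Union>(C i)" using NC submodule_zero[OF N] by blast
    next
      fix x y assume "x \<in> \<Union>(C i)" "y \<in> \<Union>(C i)"
      then have xy: "x \<in> carrier M" "N +>\<^bsub>M\<^esub> x \<in> C i" "y \<in> carrier M" "N +>\<^bsub>M\<^esub> y \<in> C i" using mem by auto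
      have "(N +>\<^bsub>M\<^esub> x) <+>\<^bsub>M\<^esub> (N +>\<^bsub>M\<^esub> y) \<in> C i"
        using subgroup.m_closed[OF submodule.axioms(1)[OF Ci] xy(2,4)] by (simp add: Q)
      then show "x \<oplus>\<^bsub>M\<^esub> y \<in> \<Union>(C i)" using xy mem by (simp add: N.a_rcos_sum)
    next
      fix a x assume a: "a \<in> carrier R" and "x \<in> \<Union>(C i)"
      then have x: "x \<in> carrier M" "N +>\<^bsub>M\<^esub> x \<in> C i" using mem by auto
      have "a \<odot>\<^bsub>?Q\<^esub> (N +>\<^bsub>M\<^esub> x) \<in> C i"
        using submodule.smult_closed[OF Ci a x(2)] by simp
      then show "a \<odot>\<^bsub>M\<^esub> x \<in> \<Union>(C i)"
        using x a mem by (simp add: quotient_module_smult_coset[OF N])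
    qed
  qed
  have tors: "x \<in> N" if "i \<le> k" "x \<in> \<Union>(C i)" "x \<in> X" for i x
  proof -
    have x: "x \<in> carrier M" "N +>\<^bsub>M\<^esub> x \<in> ?H" using memU[OF CH[OF that(1)]] CH[OF that(1)] that(2) by auto
    then obtain l where l: "\<forall>a\<in>ideal_power R m l. a \<odot>\<^bsub>?Q\<^esub> (N +>\<^bsub>M\<^esub> x) = N"
      by (auto simp: local_cohomology0_def Q)
    have "a \<odot>\<^bsub>M\<^esub> x \<in> N" if a: "a \<in> ideal_power R m l" for a
    proof -
      have ac: "a \<in> carrier R" using a ideal_power_subset_carrier[OF m] by blast
      have "N +>\<^bsub>M\<^esub> (a \<odot>\<^bsub>M\<^esub> x) = N" using l a quotient_module_smult_coset[OF N ac x(1)] by simp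
      with N.a_rcos_self[of "a \<odot>\<^bsub>M\<^esub> x"] ac x(1) show ?thesis by simp
    qed
    then show ?thesis using NX[OF that(3)] by blast
  qed
  have "k \<le> b"
  proof (rule ranked_chain[OF b, where C = "\<lambda>i. \<Union>(C i) <+>\<^bsub>M\<^esub> X"])
    fix i assume i: "i \<le> k"
    have "submodule (\<Union>(C i) <+>\<^bsub>M\<^esub> X) R M" by (rule submodule_set_add[OF U(1)[OF i] X])
    then show "\<Union>(C i) <+>\<^bsub>M\<^esub> X \<in> {L. submodule L R M} \<and> X \<subseteq> \<Union>(C i) <+>\<^bsub>M\<^esub> X \<and> \<Union>(C i) <+>\<^bsub>M\<^esub> X \<subseteq> carrier M"
      using set_add_incl2[OF U(1)[OF i] X] submoduleE(1) by blast
  next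
    fix i assume i: "i < k"
    then have i': "i \<le> k" "Suc i \<le> k" by simp_all
    obtain c where c: "c \<in> C (Suc i)" "c \<notin> C i" using strict i by blast
    with H_coset CH[OF i'(2)] obtain x where x: "x \<in> carrier M" "c = N +>\<^bsub>M\<^esub> x" by blast
    with c memU[OF CH[OF i'(1)]] memU[OF CH[OF i'(2)]]
    have "x \<in> \<Union>(C (Suc i))" "x \<notin> \<Union>(C i)" by blast+
    then have neq: "\<Union>(C i) \<noteq> \<Union>(C (Suc i))" by blast
    have sub: "\<Union>(C i) \<subseteq> \<Union>(C (Suc i))" using strict i by blast
    then have le: "\<Union>(C i) <+>\<^bsub>M\<^esub> X \<subseteq> \<Union>(C (Suc i)) <+>\<^bsub>M\<^esub> X" unfolding set_add_def' by blast
    have "\<Union>(C i) <+>\<^bsub>M\<^esub> X \<noteq> \<Union>(C (Suc i)) <+>\<^bsub>M\<^esub> X"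
    proof
      assume eq: "\<Union>(C i) <+>\<^bsub>M\<^esub> X = \<Union>(C (Suc i)) <+>\<^bsub>M\<^esub> X"
      have "\<Union>(C i) = \<Union>(C (Suc i))"
      proof (rule submodule_modular_eq[OF U(1)[OF i'(1)] U(1)[OF i'(2)] X sub])
        show "\<Union>(C (Suc i)) \<inter> X \<subseteq> \<Union>(C i)" using tors[OF i'(2)] U(2)[OF i'(1)] by blast
        show "\<Union>(C (Suc i)) \<subseteq> \<Union>(C i) <+>\<^bsub>M\<^esub> X"
          unfolding eq by (rule set_add_incl1[OF U(1)[OF i'(2)] X])
      qed
      with neq show False ..
    qed
    with le show "\<Union>(C i) <+>\<^bsub>M\<^esub> X \<subset> \<Union>(C (Suc i)) <+>\<^bsub>M\<^esub> X" by blast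
  qed
  then show "enat k \<le> enat b" by simp
qed

lemma annihilator_ideal: "ideal (annihilator R M) R"
proof -
  have sub: "submodule {\<zero>\<^bsub>M\<^esub>} R M" by (rule submoduleI') auto
  have eq: "annihilator R M = \<Inter>((\<lambda>x. {r \<in> carrier R. r \<odot>\<^bsub>M\<^esub> x \<in> {\<zero>\<^bsub>M\<^esub>}}) ` carrier M)"
    unfolding annihilator_def by (auto intro: M.zero_closed)
  show ?thesis unfolding eq by (rule i_Intersect) (use colon_ideal[OF sub] in auto)
qed

text \<open>Adding the generators of M to m^n M one at a time gives layers that are cyclic and
  killed by ann M + m^n; g is the number of generators.\<close>

lemma ranked_finitely_generated:
  assumes fg: "finitely_generated R M" and m: "ideal m R"
  shows "\<exists>g. \<forall>n b. hilbert_le m (annihilator R M) n b \<longrightarrow>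
    ranked {L. submodule L R M} (ideal_smult R M (ideal_power R m n) (carrier M)) (carrier M) (g * b)"
proof -
  let ?J = "annihilator R M"
  note Pw = ideal_power_ideal[OF m]
  obtain G where G: "finite G" "G \<subseteq> carrier M" "carrier M = submodule_span R M G"
    using fg unfolding finitely_generated_def by blast
  have "ranked {L. submodule L R M} (ideal_smult R M (ideal_power R m n) (carrier M)) (carrier M) (card G * b)"
    if b: "hilbert_le m ?J n b" for n b
  proof -
    let ?X = "ideal_smult R M (ideal_power R m n) (carrier M)"
    have X: "submodule ?X R M" by (rule ideal_power_smult_submodule[OF m]) simp
    have "\<exists>L. submodule L R M \<and> ?X \<subseteq> L \<and> V \<subseteq> L \<and> ranked {L. submodule L R M} ?X L (card V * b)"
      if "finite V" "V \<subseteq> carrier M" for V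
      using that
    proof (induction V)
      case empty
      then show ?case using X by (intro exI[of _ ?X]) (auto simp: ranked_refl)
    next
      case (insert x V)
      then obtain L where L: "submodule L R M" "?X \<subseteq> L" "V \<subseteq> L" "ranked {L. submodule L R M} ?X L (card V * b)"
        and x: "x \<in> carrier M" by auto
      let ?C = "{r \<odot>\<^bsub>M\<^esub> x | r. r \<in> carrier R}"
      note C = submodule_cyclic[OF x]
      let ?L' = "L <+>\<^bsub>M\<^esub> ?C"
      have L': "submodule ?L' R M" by (rule submodule_set_add[OF L(1) C])
      note incl = set_add_incl1[OF L(1) C] set_add_incl2[OF L(1) C]
      have "ranked {L. submodule L R M} L ?L' b"
      proof (rule ranked_cyclic[OF L(1) x])
        show "ranked {K. ideal K R} (?J <+>\<^bsub>R\<^esub> ideal_power R m n) (carrier R) b"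
          using b by (simp add: hilbert_le_def)
        show "?J <+>\<^bsub>R\<^esub> ideal_power R m n \<subseteq> carrier R"
          by (rule set_add_ideal_incl(3)[OF annihilator_ideal Pw])
      next
        fix r assume "r \<in> ?J <+>\<^bsub>R\<^esub> ideal_power R m n"
        then obtain j s where js: "j \<in> ?J" "s \<in> ideal_power R m n" "r = j \<oplus> s" by (auto simp: set_add_def')
        have "s \<odot>\<^bsub>M\<^esub> x \<in> L" using ideal_smultI[OF js(2) x] L(2) by blast
        moreover have "r \<odot>\<^bsub>M\<^esub> x = s \<odot>\<^bsub>M\<^esub> x"
          using js x ideal.Icarr[OF Pw js(2)] by (simp add: annihilator_def smult_l_distr)
        ultimately show "r \<odot>\<^bsub>M\<^esub> x \<in> L" by simp
      qed (auto simp: set_add_def')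
      from ranked_add[OF L(1,2) incl(1) L' L(4) this]
      have "ranked {L. submodule L R M} ?X ?L' (card (insert x V) * b)"
        using insert.hyps by (simp add: add.commute)
      moreover have "x \<in> ?L'"
      proof -
        have "\<one> \<odot>\<^bsub>M\<^esub> x \<in> ?C" by blast
        then show ?thesis using incl(2) x by auto
      qed
      ultimately show ?case using L(2,3) L' incl(1) by (intro exI[of _ ?L']) auto
    qed
    from this[OF G(1,2)] obtain L where L: "submodule L R M" "G \<subseteq> L"
      "ranked {L. submodule L R M} ?X L (card G * b)" by blast
    have "L = carrier M" using submodule_span_least[OF L(1,2)] G(3) submoduleE(1)[OF L(1)] by auto
    with L(3) show ?thesis by simp
  qed
  then show ?thesis by blast
qed

end

section \<open>The dimension bound for the torsion lengths\<close>

context noetherian_local_ring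
begin

text \<open>The chain lengths are bounded, so the supremum is a maximum, and its successor serves as
  d in \<open>hilbert_upper_bound\<close>. If no prime contains J, the dimension is -\<infinity> and
  d = 0.\<close>

lemma krull_dim_quotient_hilbert_bound:
  assumes J: "ideal J R"
  shows "krull_dim (R Quot J) \<noteq> \<infinity>"
    and "\<exists>C. \<forall>n. hilbert_le m J n (C *
      (if krull_dim (R Quot J) = -\<infinity> then 0 else (n + 1) ^ nat_of_dim (krull_dim (R Quot J))))"
proof -
  let ?S = "{k. \<exists>P. prime_chain R J k P}"
  have dim: "krull_dim (R Quot J) = Sup ((\<lambda>k. ereal (real k)) ` ?S)"
    unfolding krull_dim_quotient[OF J] by (rule arg_cong[where f = Sup]) auto
  obtain r where r: "\<And>k P. prime_chain R J k P \<Longrightarrow> k \<le> r" using prime_chains_bounded by blast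
  have fin: "finite ?S" by (rule finite_subset[of _ "{..r}"]) (use r in auto)
  have "krull_dim (R Quot J) \<noteq> \<infinity> \<and> (\<exists>C. \<forall>n. hilbert_le m J n (C *
      (if krull_dim (R Quot J) = -\<infinity> then 0 else (n + 1) ^ nat_of_dim (krull_dim (R Quot J)))))"
  proof (cases "?S = {}")
    case True
    have "krull_dim (R Quot J) = -\<infinity>" unfolding dim True by (simp add: bot_ereal_def)
    with hilbert_upper_bound[OF J, of 0] True show ?thesis by simp
  next
    case False
    have "Sup ((\<lambda>k. ereal (real k)) ` ?S) = ereal (real (Max ?S))"
    proof (rule antisym)
      show "Sup ((\<lambda>k. ereal (real k)) ` ?S) \<le> ereal (real (Max ?S))"
        by (rule SUP_least) (use Max_ge[OF fin] in simp)
      show "ereal (real (Max ?S)) \<le> Sup ((\<lambda>k. ereal (real k)) ` ?S)"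
        by (rule SUP_upper) (rule Max_in[OF fin False])
    qed
    then have D: "krull_dim (R Quot J) = ereal (real (Max ?S))" using dim by simp
    have "k < Suc (Max ?S)" if "prime_chain R J k P" for k P
      using Max_ge[OF fin, of k] that by (auto simp: less_Suc_eq_le)
    from hilbert_upper_bound[OF J this] show ?thesis unfolding D by (simp add: nat_of_dim_def)
  qed
  then show "krull_dim (R Quot J) \<noteq> \<infinity>"
    and "\<exists>C. \<forall>n. hilbert_le m J n (C *
      (if krull_dim (R Quot J) = -\<infinity> then 0 else (n + 1) ^ nat_of_dim (krull_dim (R Quot J))))"
    by blast+
qed

text \<open>Finite generation over the Rees ring is expressed by the inclusion of F_n into I^(n-n0)
  M, a form that the I-adic filtration satisfies at once with n0 = 0. The comparison submodule X of
  \<open>length_H0_le\<close> is m^(en) M.\<close>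

theorem length_H0_filtration_bound:
  fixes M (structure)
  assumes M: "module R M" "finitely_generated R M" and I: "ideal I R"
    and F: "\<And>i. submodule (F i) R M" and F0: "F 0 = carrier M" and F_dec: "\<And>i. F (Suc i) \<subseteq> F i"
    and IF: "\<And>i. ideal_smult R M I (F i) \<subseteq> F (Suc i)"
    and F_le: "\<And>i. F i \<subseteq> ideal_smult R M (ideal_power R I (i - n0)) (carrier M)"
  shows "\<exists>C. \<forall>n. length_H0 R m (quotient_module M (F n)) \<le> enat (C *
      (if module_dim R M = -\<infinity> then 0 else (n + 1) ^ nat_of_dim (module_dim R M)))"
proof -
  interpret M: module R M by (rule M(1))
  let ?f = "\<lambda>n. if module_dim R M = -\<infinity> then 0 else (n + 1) ^ nat_of_dim (module_dim R M)"
  from M.filtration_linear_growth[OF noetherian_ring_axioms M(2) m_ideal I F F0 F_dec IF F_le]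
  obtain e where e: "\<And>n x k. x \<in> ideal_smult R M (ideal_power R m (e * n)) (carrier M)
    \<Longrightarrow> \<forall>r \<in> ideal_power R m k. r \<odot>\<^bsub>M\<^esub> x \<in> F n \<Longrightarrow> x \<in> F n" by blast
  obtain C where C: "\<And>n. hilbert_le m (annihilator R M) n (C * ?f n)"
    using krull_dim_quotient_hilbert_bound(2)[OF M.annihilator_ideal] unfolding module_dim_def by blast
  obtain g where g: "\<And>n b. hilbert_le m (annihilator R M) n b \<Longrightarrow>
    ranked {L. submodule L R M} (ideal_smult R M (ideal_power R m n) (carrier M)) (carrier M) (g * b)"
    using M.ranked_finitely_generated[OF M(2) m_ideal] by blast
  \<comment> \<open>Absorbs the passage from n to e n: (e n + 1)^d \<le> (e + 1)^d (n +
    1)^d.\<close>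
  define E where "E = (e + 1) ^ nat_of_dim (module_dim R M)"
  have "length_H0 R m (quotient_module M (F n)) \<le> enat ((g * C * E) * ?f n)" for n
  proof -
    have "length_H0 R m (quotient_module M (F n)) \<le> enat (g * (C * ?f (e * n)))"
      by (rule M.length_H0_le[OF F M.ideal_power_smult_submodule[OF m_ideal order_refl] m_ideal e g[OF C]])
    also have "?f (e * n) \<le> E * ?f n"
    proof -
      have "e * n + 1 \<le> (e + 1) * (n + 1)" by simp
      from power_mono[OF this] show ?thesis by (simp add: E_def power_mult_distrib[symmetric])
    qed
    then have "enat (g * (C * ?f (e * n))) \<le> enat ((g * C * E) * ?f n)"
      by (simp only: enat_ord_simps mult.assoc mult_le_mono2)
    finally show ?thesis .
  qed
  then show ?thesis by blast
qed

end

section \<open>Filtrations over the Rees ring\<close>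

lemma (in module) finsum_in_submodule:
  assumes "submodule N R M" "finite A" "\<And>i. i \<in> A \<Longrightarrow> f i \<in> N"
  shows "finsum M f A \<in> N"
  using assms(2,3)
proof (induction A)
  case empty
  then show ?case using submodule_zero[OF assms(1)] by simp
next
  case (insert a A)
  then have "f \<in> A \<rightarrow> carrier M" "f a \<in> carrier M" using submodule_carrier[OF assms(1)] by auto
  with insert have "finsum M f (insert a A) = f a \<oplus>\<^bsub>M\<^esub> finsum M f A" by simp
  also have "\<dots> \<in> N" using insert by (intro submoduleE(5)[OF assms(1)]) auto
  finally show ?case .
qed

context filtered_module
begin

lemma filtration_power_smult:
  assumes I: "ideal I R" and r: "r \<in> ideal_power R I i" and x: "x \<in> F k"
  shows "r \<odot>\<^bsub>M\<^esub> x \<in> F (k + i)"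
  using r x
proof (induction i arbitrary: r k x)
  case 0
  then show ?case using submoduleE(4)[OF filtration_submodule] by (simp add: ideal_power_0)
next
  case (Suc i)
  have xc: "x \<in> carrier M" using submodule_carrier[OF filtration_submodule Suc.prems(2)] .
  have "ideal_power R I i \<cdot> I \<subseteq> {r \<in> carrier R. r \<odot>\<^bsub>M\<^esub> x \<in> F (k + Suc i)}"
  proof (rule ideal_prod_least[OF colon_ideal[OF filtration_submodule xc]])
    fix s z assume s: "s \<in> ideal_power R I i" and z: "z \<in> I"
    have c: "s \<in> carrier R" "z \<in> carrier R"
      using s z ideal.Icarr[OF I] ideal.Icarr[OF ideal_power_ideal[OF I]] by auto
    have "z \<odot>\<^bsub>M\<^esub> x \<in> F (Suc k)" using filtration_mult ideal_smultI[OF z Suc.prems(2)] by blast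
    from Suc.IH[OF s this] show "s \<otimes> z \<in> {r \<in> carrier R. r \<odot>\<^bsub>M\<^esub> x \<in> F (k + Suc i)}"
      using c xc by (simp add: smult_assoc1)
  qed
  with Suc.prems(1) show ?case by (auto simp: ideal_power_Suc)
qed

text \<open>Convolution respects the condition because each term a_i f_(n-i) lies in G_n. Once G
  accommodates the generators, this confines the whole Rees module.\<close>

lemma rees_submodule:
  assumes I: "ideal I R"
    and G: "\<And>n. submodule (G n) R M"
    and IG: "\<And>i n r x. r \<in> ideal_power R I i \<Longrightarrow> x \<in> G n \<Longrightarrow> r \<odot>\<^bsub>M\<^esub> x \<in> G (n + i)"
  shows "submodule {f \<in> carrier (rees_module M F). \<forall>n. f n \<in> G n} (rees_ring R I) (rees_module M F)"
    (is "submodule ?N _ _")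
proof (rule submodule.intro)
  let ?P = "rees_module M F"
  note D = filtration_submodule
  have P: "carrier ?P = {f. (\<forall>n. f n \<in> F n) \<and> finite {n. f n \<noteq> \<zero>\<^bsub>M\<^esub>}}"
    "zero ?P = (\<lambda>n. \<zero>\<^bsub>M\<^esub>)" "\<And>f g. f \<oplus>\<^bsub>?P\<^esub> g = (\<lambda>n. f n \<oplus>\<^bsub>M\<^esub> g n)"
    "\<And>a f. a \<odot>\<^bsub>?P\<^esub> f = (\<lambda>n. \<Oplus>\<^bsub>M\<^esub>i \<in> {..n}. a i \<odot>\<^bsub>M\<^esub> f (n - i))"
    by (simp_all add: rees_module_def)
  have car: "f n \<in> carrier M" if "f \<in> carrier ?P" for f n
    using that submodule_carrier[OF D] by (auto simp: P)
  show "subgroup ?N (add_monoid ?P)"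
  proof
    show "?N \<subseteq> carrier (add_monoid ?P)" by auto
    show "\<one>\<^bsub>add_monoid ?P\<^esub> \<in> ?N" using submodule_zero[OF D] submodule_zero[OF G] by (simp add: P)
  next
    fix f g assume fg: "f \<in> ?N" "g \<in> ?N"
    have "{n. f n \<oplus>\<^bsub>M\<^esub> g n \<noteq> \<zero>\<^bsub>M\<^esub>} \<subseteq> {n. f n \<noteq> \<zero>\<^bsub>M\<^esub>} \<union> {n. g n \<noteq> \<zero>\<^bsub>M\<^esub>}" by auto
    from finite_subset[OF this] fg show "f \<otimes>\<^bsub>add_monoid ?P\<^esub> g \<in> ?N"
      using submoduleE(5)[OF D] submoduleE(5)[OF G] by (simp add: P)
  next
    fix f assume f: "f \<in> ?N"
    have fc: "f n \<in> carrier M" for n using f car by blast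
    let ?g = "\<lambda>n. \<ominus>\<^bsub>M\<^esub> f n"
    have "{n. \<ominus>\<^bsub>M\<^esub> f n \<noteq> \<zero>\<^bsub>M\<^esub>} \<subseteq> {n. f n \<noteq> \<zero>\<^bsub>M\<^esub>}" by auto
    from finite_subset[OF this] f have g: "?g \<in> ?N"
      using submoduleE(3)[OF D] submoduleE(3)[OF G] by (simp add: P)
    \<comment> \<open>The inverse is computed from its definition, as only the operations of the
      Rees module are at hand here, not its group structure.\<close>
    have "inv\<^bsub>add_monoid ?P\<^esub> f = ?g"
      unfolding m_inv_def
    proof (rule the_equality)
      show "?g \<in> carrier (add_monoid ?P) \<and> f \<otimes>\<^bsub>add_monoid ?P\<^esub> ?g = \<one>\<^bsub>add_monoid ?P\<^esub>
        \<and> ?g \<otimes>\<^bsub>add_monoid ?P\<^esub> f = \<one>\<^bsub>add_monoid ?P\<^esub>"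
        using g fc by (simp add: P(2,3) M.r_neg M.l_neg)
    next
      fix h assume h: "h \<in> carrier (add_monoid ?P) \<and> f \<otimes>\<^bsub>add_monoid ?P\<^esub> h = \<one>\<^bsub>add_monoid ?P\<^esub>
        \<and> h \<otimes>\<^bsub>add_monoid ?P\<^esub> f = \<one>\<^bsub>add_monoid ?P\<^esub>"
      show "h = ?g"
      proof
        fix n
        have "h n \<oplus>\<^bsub>M\<^esub> f n = \<zero>\<^bsub>M\<^esub>" using h by (auto simp: P(2,3) fun_eq_iff)
        moreover have "h n \<in> carrier M" using h car by simp
        ultimately show "h n = \<ominus>\<^bsub>M\<^esub> f n" using fc[of n] by (simp add: M.minus_equality)
      qed
    qed
    with g show "inv\<^bsub>add_monoid ?P\<^esub> f \<in> ?N" by simp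
  qed
  show "submodule_axioms ?N (rees_ring R I) ?P"
  proof
    fix a f assume a: "a \<in> carrier (rees_ring R I)" and f: "f \<in> ?N"
    have up: "a \<in> up R" and aI: "\<And>i. a i \<in> ideal_power R I i"
      using a by (auto simp: rees_ring_def UP_def)
    have "a i \<odot>\<^bsub>M\<^esub> f (n - i) \<in> F n \<inter> G n" if "i \<le> n" for i n
      using filtration_power_smult[OF I aI, of "f (n - i)" "n - i" i] IG[OF aI, of "f (n - i)" "n - i" i] f that
      by (auto simp: P(1))
    then have mem: "(a \<odot>\<^bsub>?P\<^esub> f) n \<in> F n \<inter> G n" for n
      unfolding P(4) by (intro finsum_in_submodule submodule_Int D G) auto
    obtain p where p: "bound \<zero> p a" using up by (auto simp: up_def)
    have "finite {n. f n \<noteq> \<zero>\<^bsub>M\<^esub>}" using f by (simp add: P(1))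
    then obtain q where q: "\<And>n. f n \<noteq> \<zero>\<^bsub>M\<^esub> \<Longrightarrow> n \<le> q"
      unfolding finite_nat_set_iff_bounded_le by blast
    \<comment> \<open>For n > p + q every term has i > p or n - i > q and vanishes, so the support
      stays finite.\<close>
    have "(a \<odot>\<^bsub>?P\<^esub> f) n = \<zero>\<^bsub>M\<^esub>" if n: "p + q < n" for n
    proof -
      have "a i \<odot>\<^bsub>M\<^esub> f (n - i) = \<zero>\<^bsub>M\<^esub>" if "i \<le> n" for i
      proof (cases "i \<le> p")
        case True
        then have "f (n - i) = \<zero>\<^bsub>M\<^esub>" using q[of "n - i"] n by fastforce
        moreover have "a i \<in> carrier R" using subsetD[OF ideal_power_subset_carrier[OF I] aI] .
        ultimately show ?thesis by simp
      next
        case False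
        then have "a i = \<zero>" using bound.bound[OF p, of i] by simp
        then show ?thesis using f car by simp
      qed
      then show ?thesis unfolding P(4) by (intro M.add.finprod_one_eqI) auto
    qed
    then have "{n. (a \<odot>\<^bsub>?P\<^esub> f) n \<noteq> \<zero>\<^bsub>M\<^esub>} \<subseteq> {..p + q}" by (auto simp: not_less[symmetric])
    from finite_subset[OF this] mem show "a \<odot>\<^bsub>?P\<^esub> f \<in> ?N" by (simp add: P(1))
  qed
qed

text \<open>n0 bounds the degrees in which the finitely many generators live. Every element is built
  from them with coefficients in powers of \<open>I\<close>, so its n-th entry lies in I^(n-n0) M;
  this is applied to sequences whose only nonzero entry is some x in F_n.\<close>

lemma filtration_eventually_adic:
  assumes I: "ideal I R"
  shows "\<exists>n0. \<forall>n. F n \<subseteq> ideal_smult R M (ideal_power R I (n - n0)) (carrier M)"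
proof -
  let ?P = "rees_module M F"
  have P: "carrier ?P = {f. (\<forall>n. f n \<in> F n) \<and> finite {n. f n \<noteq> \<zero>\<^bsub>M\<^esub>}}"
    by (simp add: rees_module_def)
  obtain A where A: "finite A" "A \<subseteq> carrier ?P" "carrier ?P = submodule_span (rees_ring R I) ?P A"
    using rees_fin_gen unfolding finitely_generated_def by blast
  have "finite (\<Union>f\<in>A. {n. f n \<noteq> \<zero>\<^bsub>M\<^esub>})" using A(1,2) by (auto simp: P)
  then obtain n0 where n0: "\<And>f n. f \<in> A \<Longrightarrow> f n \<noteq> \<zero>\<^bsub>M\<^esub> \<Longrightarrow> n \<le> n0"
    unfolding finite_nat_set_iff_bounded_le by blast
  define G where "G n = ideal_smult R M (ideal_power R I (n - n0)) (carrier M)" for n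
  have G: "submodule (G n) R M" for n unfolding G_def by (rule ideal_power_smult_submodule[OF I]) simp
  have IG: "r \<odot>\<^bsub>M\<^esub> x \<in> G (n + i)" if "r \<in> ideal_power R I i" "x \<in> G n" for i n r x
  proof -
    have "r \<odot>\<^bsub>M\<^esub> x \<in> ideal_smult R M (ideal_power R I (i + (n - n0))) (carrier M)"
      by (rule ideal_power_smult_mult[OF I _ that(1) that(2)[unfolded G_def]]) simp
    moreover have "n + i - n0 \<le> i + (n - n0)" by arith
    ultimately show ?thesis
      unfolding G_def using ideal_power_smult_antimono[OF I order_refl] by blast
  qed
  let ?N = "{f \<in> carrier ?P. \<forall>n. f n \<in> G n}"
  have "f n \<in> G n" if f: "f \<in> A" for f n
  proof (cases "n \<le> n0")
    case True
    then have "G n = carrier M" unfolding G_def by (simp add: ideal_power_0_smult[OF carrier_is_submodule])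
    moreover have "f n \<in> F n" using f A(2) by (auto simp: P)
    ultimately show ?thesis using submodule_carrier[OF filtration_submodule] by blast
  next
    case False
    then have "f n = \<zero>\<^bsub>M\<^esub>" using n0[OF f] by blast
    then show ?thesis using submodule_zero[OF G] by simp
  qed
  with A(2) have "A \<subseteq> ?N" by blast
  with rees_submodule[where G = G, OF I G IG] have "submodule_span (rees_ring R I) ?P A \<subseteq> ?N"
    unfolding submodule_span_def by (intro Inter_lower) simp
  then have N: "carrier ?P \<subseteq> ?N" using A(3) by simp
  have "F n \<subseteq> G n" for n
  proof
    fix x assume x: "x \<in> F n"
    let ?f = "\<lambda>k. if k = n then x else \<zero>\<^bsub>M\<^esub>"
    have "?f \<in> carrier ?P" using x submodule_zero[OF filtration_submodule]
      by (auto simp: P intro!: finite_subset[of _ "{n}"])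
    with N have "?f \<in> ?N" by blast
    then have "\<forall>k. ?f k \<in> G k" by blast
    from this[rule_format, of n] show "x \<in> G n" by simp
  qed
  then show ?thesis unfolding G_def by blast
qed

end

text \<open>Finiteness of the dimension and of the lengths is asserted alongside the growth estimate
  because \<open>nat_of_dim\<close> and \<open>the_enat\<close> would otherwise hide infinite
  values.\<close>

theorem corollary17:
  fixes R :: "('a, 'b) ring_scheme" and m I :: "'a set"
  assumes "noetherian_local_ring R m" and "ideal I R"
  shows "(\<forall>(M :: ('a, 'c, 'd) module_scheme) F. filtered_module R M I F \<longrightarrow>
            module_dim R M \<noteq> \<infinity> \<and>
            (\<forall>n. length_H0 R m (quotient_module M (F n)) \<noteq> \<infinity>) \<and>
            (\<lambda>n. real (the_enat (length_H0 R m (quotient_module M (F n)))))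
              \<in> O(\<lambda>n. dim_power n (module_dim R M)))
       \<and> (\<forall>M :: ('a, 'c, 'd) module_scheme. module R M \<and> finitely_generated R M \<longrightarrow>
            epsilon_multiplicity R m I M < \<infinity>)"
proof -
  interpret noetherian_local_ring R m by (rule assms(1))
  note I = assms(2)
  \<comment> \<open>Passes from (n + 1)^d to n^d, at the cost of the factor 2^d and of excluding n =
    0. The ceiling turns the real number \<open>dim_power\<close> into a natural number that fits
    inside \<open>enat\<close>.\<close>
  have bound: "\<exists>B. \<forall>n\<ge>1. length_H0 R m (quotient_module M (F n)) \<le> enat (B * nat \<lceil>dim_power n (module_dim R M)\<rceil>)"
    if "\<forall>n. length_H0 R m (quotient_module M (F n)) \<le> enat (C *
      (if module_dim R M = -\<infinity> then 0 else (n + 1) ^ nat_of_dim (module_dim R M)))"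
    for M :: "('a, 'c, 'd) module_scheme" and F C
  proof -
    let ?d = "nat_of_dim (module_dim R M)"
    have "length_H0 R m (quotient_module M (F n)) \<le> enat ((C * 2 ^ ?d) * nat \<lceil>dim_power n (module_dim R M)\<rceil>)"
      if n: "n \<ge> 1" for n
    proof -
      have "(if module_dim R M = -\<infinity> then 0 else (n + 1) ^ ?d) \<le> 2 ^ ?d * nat \<lceil>dim_power n (module_dim R M)\<rceil>"
      proof -
        have "(n + 1) ^ ?d \<le> (2 * n) ^ ?d" by (rule power_mono) (use n in auto)
        moreover have "nat \<lceil>real n ^ ?d\<rceil> = n ^ ?d" by (metis ceiling_of_nat nat_int of_nat_power)
        ultimately show ?thesis by (simp add: dim_power_def power_mult_distrib)
      qed
      then have "enat (C * (if module_dim R M = -\<infinity> then 0 else (n + 1) ^ ?d))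
        \<le> enat ((C * 2 ^ ?d) * nat \<lceil>dim_power n (module_dim R M)\<rceil>)"
        by (simp only: enat_ord_simps mult.assoc mult_le_mono2)
      with \<open>\<forall>n. _ \<le> enat (C * _)\<close> show ?thesis by (meson order_trans)
    qed
    then show ?thesis by blast
  qed
  \<comment> \<open>The ceiling loses nothing, since \<open>dim_power\<close> takes natural
    values.\<close>
  have dp: "real (nat \<lceil>dim_power n D\<rceil>) = dim_power n D" for n D
  proof (cases "D = -\<infinity>")
    case False
    have "nat \<lceil>real n ^ nat_of_dim D\<rceil> = n ^ nat_of_dim D" by (metis ceiling_of_nat nat_int of_nat_power)
    with False show ?thesis by (simp add: dim_power_def)
  qed (simp add: dim_power_def)
  show ?thesis
  proof (intro conjI allI impI)
    fix M :: "('a, 'c, 'd) module_scheme" and F assume fm: "filtered_module R M I F"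
    interpret filtered_module R M I F by (rule fm)
    obtain n0 where n0: "\<And>n. F n \<subseteq> ideal_smult R M (ideal_power R I (n - n0)) (carrier M)"
      using filtration_eventually_adic[OF I] by blast
    from length_H0_filtration_bound[OF module_axioms fin_gen I filtration_submodule filtration_0
        filtration_decreasing filtration_mult n0]
    obtain C where C: "\<forall>n. length_H0 R m (quotient_module M (F n)) \<le> enat (C *
      (if module_dim R M = -\<infinity> then 0 else (n + 1) ^ nat_of_dim (module_dim R M)))" by blast
    show "module_dim R M \<noteq> \<infinity>"
      unfolding module_dim_def by (rule krull_dim_quotient_hilbert_bound(1)[OF annihilator_ideal])
    show fin: "length_H0 R m (quotient_module M (F n)) \<noteq> \<infinity>" for n
      using C by (metis enat_ord_code(5) infinity_ileE)
    from bound[OF C] obtain B where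
      B: "\<And>n. n \<ge> 1 \<Longrightarrow> length_H0 R m (quotient_module M (F n)) \<le> enat (B * nat \<lceil>dim_power n (module_dim R M)\<rceil>)"
      by blast
    have "real (the_enat (length_H0 R m (quotient_module M (F n)))) \<le> real B * dim_power n (module_dim R M)"
      if "n \<ge> 1" for n
    proof -
      have "the_enat (length_H0 R m (quotient_module M (F n))) \<le> B * nat \<lceil>dim_power n (module_dim R M)\<rceil>"
        using B[OF that] by (cases "length_H0 R m (quotient_module M (F n))") auto
      then have "real (the_enat (length_H0 R m (quotient_module M (F n)))) \<le> real (B * nat \<lceil>dim_power n (module_dim R M)\<rceil>)"
        by (simp only: of_nat_le_iff)
      then show ?thesis by (simp only: of_nat_mult dp)
    qed
    moreover have "dim_power n (module_dim R M) \<ge> 0" for n by (simp add: dim_power_def)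
    ultimately show "(\<lambda>n. real (the_enat (length_H0 R m (quotient_module M (F n)))))
        \<in> O(\<lambda>n. dim_power n (module_dim R M))"
      by (intro bigoI[where c = "real B"] eventually_sequentiallyI[of 1]) simp
  next
    fix M :: "('a, 'c, 'd) module_scheme" assume M: "module R M \<and> finitely_generated R M"
    then interpret module R M by blast
    let ?F = "\<lambda>n. ideal_smult R M (ideal_power R I n) (carrier M)"
    let ?D = "module_dim R M"
    have F: "submodule (?F n) R M" for n by (rule ideal_power_smult_submodule[OF I]) simp
    have "\<exists>C. \<forall>n. length_H0 R m (quotient_module M (?F n)) \<le> enat (C *
      (if ?D = -\<infinity> then 0 else (n + 1) ^ nat_of_dim ?D))"
    proof (rule length_H0_filtration_bound[where F = ?F and I = I and ?n0.0 = 0])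
      show "?F 0 = carrier M" by (rule ideal_power_0_smult[OF carrier_is_submodule])
      show "?F (Suc i) \<subseteq> ?F i" for i by (rule ideal_power_smult_antimono[OF I]) auto
      show "ideal_smult R M I (?F i) \<subseteq> ?F (Suc i)" for i
      proof (rule ideal_smult_least[OF F])
        fix a x assume "a \<in> I" "x \<in> ?F i"
        then show "a \<odot>\<^bsub>M\<^esub> x \<in> ?F (Suc i)"
          using ideal_power_smult_mult[OF I, of "carrier M" a 1 x i] ideal_power_1[OF I] by simp
      qed
    qed (use M I F in auto)
    then obtain C where "\<forall>n. length_H0 R m (quotient_module M (?F n)) \<le> enat (C *
      (if ?D = -\<infinity> then 0 else (n + 1) ^ nat_of_dim ?D))" by blast
    from bound[OF this] obtain B where
      B: "\<And>n. n \<ge> 1 \<Longrightarrow> length_H0 R m (quotient_module M (?F n)) \<le> enat (B * nat \<lceil>dim_power n ?D\<rceil>)"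
      by blast
    let ?c = "ereal (fact (nat_of_dim ?D) * real B)"
    have "ereal (fact (nat_of_dim ?D)) * ereal_of_enat (length_H0 R m (quotient_module M (?F n)))
      / ereal (dim_power n ?D) \<le> ?c" if n: "n \<ge> 1" for n
    proof -
      obtain l where l: "length_H0 R m (quotient_module M (?F n)) = enat l" "l \<le> B * nat \<lceil>dim_power n ?D\<rceil>"
        using B[OF n] by (cases "length_H0 R m (quotient_module M (?F n))") auto
      from l(2) have "real l \<le> real (B * nat \<lceil>dim_power n ?D\<rceil>)" by (simp only: of_nat_le_iff)
      then have le: "real l \<le> real B * dim_power n ?D" by (simp only: of_nat_mult dp)
      show ?thesis
      proof (cases "?D = -\<infinity>")
        \<comment> \<open>The zero module: \<open>dim_power\<close> is 0, but so is the length, and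
          0 / 0 is 0 in \<open>ereal\<close>.\<close>
        case True
        with le have "l = 0" by (simp add: dim_power_def)
        then show ?thesis by (simp add: l)
      next
        case False
        then have pos: "dim_power n ?D > 0" using n by (simp add: dim_power_def)
        with le have "fact (nat_of_dim ?D) * real l / dim_power n ?D \<le> fact (nat_of_dim ?D) * real B"
          by (simp add: divide_le_eq mult.assoc)
        with pos show ?thesis by (simp add: l)
      qed
    qed
    then have "epsilon_multiplicity R m I M \<le> ?c"
      unfolding epsilon_multiplicity_def by (intro Limsup_bounded eventually_sequentiallyI[of 1]) auto
    also have "\<dots> < \<infinity>" by simp
    finally show "epsilon_multiplicity R m I M < \<infinity>" .
  qed
qed

end
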